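(* Fix $\alpha\in(0,1]$. Let $P$ be a Borel probability measure on $\mathbb{R}^d$ supported on a compact convex set $\mathcal{X}\subset\mathbb{R}^d$ with nonempty interior (so $\mathcal{X}=\mathrm{supp}\,P$), having a Lebesgue density $\rho$ that is Lipschitz continuous and strictly positive on $\mathcal{X}$. Let $Q$ be a probability measure with finite support $\mathcal{Y}=\{y_1,\dots,y_N\}\subset\mathbb{R}^d$ (distinct points) with $\min_{1\le i\le N}Q(\{y_i\})\ge c_0$ for some constant $c_0\in(0,1)$. Suppose in addition that one of the following holds: (a) $\mathcal{X}$ is a polytope; or (b) $\mathcal{H}^{d-1}(\partial\mathcal{X}\cap H)=0$ for every hyperplane $H$ in $\mathbb{R}^d$. Let $Y_1,Y_2,\dots$ be i.i.d. with law $Q$, let $\hat Q_n=n^{-1}\sum_{i=1}^n\delta_{Y_i}$, let $\hat T_n^{\varepsilon}$ be the entropic map with parameter $\varepsilon>0$ for the pair $(P,\hat Q_n)$, and let $T^0$ be the Brenier map for $(P,Q)$. Let $(\varepsilon_n)$ be a sequence of positive numbers with $$\varepsilon_n=o\big(n^{-\frac{1}{2(1+\alpha)}}\wedge n^{-1/4}/\log^{3/2}n\big).$$ Then, as $n\to\infty$, $$\sqrt n\,(\hat T_n^{\varepsilon_n}-T^0)\ \xrightarrow{d}\ \mathbb{G}\quad\text{in }(\mathcal{C}^\alpha)^*,$$ where $\mathbb{G}$ is the centered Gaussian variable in $(\mathcal{C}^\alpha)^*$ that is the limit in distribution in $(\mathcal{C}^\alpha)^*$ of $\sqrt n\,(\hat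 T_n^0-T^0)$, with $\hat T_n^0$ the Brenier map for $(P,\hat Q_n)$.
   Context: $\|\cdot\|$ and $\langle\cdot,\cdot\rangle$ are the Euclidean norm and inner product; $\mathcal{H}^{d-1}$ is $(d-1)$-dimensional Hausdorff measure; $a\wedge b=\min\{a,b\}$; $\xrightarrow{d}$ is convergence in distribution. Brenier and entropic maps. Let $R$ be a probability measure with finite support $\{y_1,\dots,y_M\}\subset\mathbb{R}^d$ (distinct points) and masses $r_i=R(\{y_i\})>0$, $r=(r_1,\dots,r_M)^\intercal$; $\mathbb{1}_M$ is the vector of ones. Let $z^0\in\mathbb{R}^M$ be the unique minimizer of $z\mapsto\int\max_{1\le i\le M}(\langle x,y_i\rangle-z_i)\,dP(x)+\langle z,r\rangle$ subject to $\langle z,\mathbb{1}_M\rangle=0$. With Laguerre cells $C_i(z)=\bigcap_{j\ne i}\{x\in\mathcal{X}:\langle y_i-y_j,x\rangle\ge z_i-z_j\}$, which partition $\mathcal{X}$ up to Lebesgue-null sets, the Brenier map for $(P,R)$ is the $P$-a.e. defined map equal to $y_i$ on $C_i(z^0)$. For $\varepsilon>0$ let $z^\varepsilon\in\mathbb{R}^M$ be the unique minimizer of $z\mapsto\int\varepsilon\log\big(\sum_{i=1}^M e^{(\langle x,y_i\rangle-z_i)/\varepsilon}\big)\,dP(x)+\langle z,r\rangle$ subject to $\langle z,\mathbb{1}_M\rangle=0$. The entropic map for $(P,R)$ with parameter $\varepsilon$ is $$x\mapsto\sum_{i=1}^M y_i\,\frac{e^{(\langle x,y_i\rangle-z_i^\varepsilon)/\varepsilon}}{\sum_{j=1}^M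 e^{(\langle x,y_j\rangle-z_j^\varepsilon)/\varepsilon}},\quad x\in\mathcal{X}.$$ (Equivalently, it is $\mathbb{E}_{(X,Y)\sim\pi^\varepsilon}[Y\mid X=x]$, where $\pi^\varepsilon$ is the unique maximizer of $\int\langle x,y\rangle\,d\pi-\varepsilon D_{\mathsf{KL}}(\pi\|P\otimes R)$ over couplings $\pi$ of $P$ and $R$.) For $R=\hat Q_n$ the support is the set of observed values, a subset of $\mathcal{Y}$. Dual Hölder space. $\|\varphi\|_{\mathcal{C}^\alpha}=\sup_{x\in\mathcal{X}}\|\varphi(x)\|+\sup_{x\ne y\in\mathcal{X}}\|\varphi(x)-\varphi(y)\|/\|x-y\|^\alpha$. $\mathcal{C}^\alpha=\mathcal{C}^\alpha(\mathcal{X};\mathbb{R}^d)$ is the Banach space of maps $\varphi:\mathcal{X}\to\mathbb{R}^d$ with $\|\varphi\|_{\mathcal{C}^\alpha}<\infty$, and $(\mathcal{C}^\alpha)^*$ is its topological dual with norm $\|\ell\|_{(\mathcal{C}^\alpha)^*}=\sup_{\|\varphi\|_{\mathcal{C}^\alpha}\le1}\ell(\varphi)$. A bounded measurable $T:\mathcal{X}\to\mathbb{R}^d$ is identified with the functional $\varphi\mapsto\int\langle\varphi(x),T(x)\rangle\,dP(x)$ in $(\mathcal{C}^\alpha)^*$. The variable $\mathbb{G}$. It is a known result (from earlier work: Sadhu, Goldfeld and Kato) that, under the hypotheses on $P$, $Q$ and $\mathcal{X}$ in the claim, there is a centered Gaussian random variable $\mathbb{G}$ in $(\mathcal{C}^\alpha)^*$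 with $\sqrt n(\hat T_n^0-T^0)\xrightarrow{d}\mathbb{G}$ in $(\mathcal{C}^\alpha)^*$; this determines the law of $\mathbb{G}$. *)

theory Defs
  imports "HOL-Probability.Probability" "HOL-Library.Landau_Symbols"
begin

section \<open>Geometric measure theory\<close>

definition topological_support :: "'a::topological_space measure \<Rightarrow> 'a set" where
  "topological_support P = {x. \<forall>U. open U \<and> x \<in> U \<longrightarrow> emeasure P U > 0}"

text \<open>
  The normalisation makes the \<open>DIM('a)\<close>-dimensional measure agree with Lebesgue measure.  The empty
  set is treated separately because \<open>0 ^ 0 = 1\<close>; for \<open>s = 0\<close> one gets counting measure.
\<close>

definition hausdorff_content :: "nat \<Rightarrow> real \<Rightarrow> 'a::metric_space set \<Rightarrow> ennreal" where
  "hausdorff_content s \<delta> A =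
     (INF U \<in> {U :: nat \<Rightarrow> 'a set. A \<subseteq> (\<Union>i. U i) \<and> (\<forall>i. bounded (U i) \<and> diameter (U i) \<le> \<delta>)}.
        \<Sum>i. if U i = {} then 0 else ennreal (unit_ball_vol (real s) * (diameter (U i) / 2) ^ s))"

definition hausdorff_measure :: "nat \<Rightarrow> 'a::metric_space set \<Rightarrow> ennreal" where
  "hausdorff_measure s A = (SUP \<delta> \<in> {0<..}. hausdorff_content s \<delta> A)"

section \<open>Brenier and entropic maps\<close>

text \<open>
  The target measure \<open>R\<close> is a \<open>pmf\<close> with finite support.  Vectors indexed by the support points are
  functions on the whole space that vanish off the support, so that the minimisers are unique.
\<close>

definition normalised_potentials :: "'a pmf \<Rightarrow> ('a \<Rightarrow> real) set" where
  "normalised_potentials R =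
     {z. (\<forall>y. y \<notin> set_pmf R \<longrightarrow> z y = 0) \<and> (\<Sum>y\<in>set_pmf R. z y) = 0}"

definition brenier_objective ::
    "'a::euclidean_space measure \<Rightarrow> 'a pmf \<Rightarrow> ('a \<Rightarrow> real) \<Rightarrow> real" where
  "brenier_objective P R z =
     (\<integral>x. Max ((\<lambda>y. x \<bullet> y - z y) ` set_pmf R) \<partial>P) + (\<Sum>y\<in>set_pmf R. z y * pmf R y)"

definition brenier_potential :: "'a::euclidean_space measure \<Rightarrow> 'a pmf \<Rightarrow> 'a \<Rightarrow> real" where
  "brenier_potential P R =
     (THE z. is_arg_min (brenier_objective P R) (\<lambda>z. z \<in> normalised_potentials R) z)"

definition laguerre_cell :: "'a::euclidean_space set \<Rightarrow> 'a set \<Rightarrow> ('a \<Rightarrow> real) \<Rightarrow> 'a \<Rightarrow> 'a set" where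
  "laguerre_cell X S z y = {x \<in> X. \<forall>y'\<in>S - {y}. (y - y') \<bullet> x \<ge> z y - z y'}"

text \<open>
  On the Lebesgue-null overlaps of cells some incident support point is chosen.  The choice depends
  only on the set of cells containing \<open>x\<close>, which makes the map measurable.  Values off \<open>X\<close> are
  irrelevant.
\<close>

definition brenier_map ::
    "'a::euclidean_space set \<Rightarrow> 'a measure \<Rightarrow> 'a pmf \<Rightarrow> 'a \<Rightarrow> 'a" where
  "brenier_map X P R x =
     (SOME y. y \<in> set_pmf R \<and> x \<in> laguerre_cell X (set_pmf R) (brenier_potential P R) y)"

definition entropic_objective ::
    "'a::euclidean_space measure \<Rightarrow> 'a pmf \<Rightarrow> real \<Rightarrow> ('a \<Rightarrow> real) \<Rightarrow> real" where
  "entropic_objective P R \<epsilon> z =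
     (\<integral>x. \<epsilon> * ln (\<Sum>y\<in>set_pmf R. exp ((x \<bullet> y - z y) / \<epsilon>)) \<partial>P) + (\<Sum>y\<in>set_pmf R. z y * pmf R y)"

definition entropic_potential ::
    "'a::euclidean_space measure \<Rightarrow> 'a pmf \<Rightarrow> real \<Rightarrow> 'a \<Rightarrow> real" where
  "entropic_potential P R \<epsilon> =
     (THE z. is_arg_min (entropic_objective P R \<epsilon>) (\<lambda>z. z \<in> normalised_potentials R) z)"

definition entropic_map ::
    "'a::euclidean_space measure \<Rightarrow> 'a pmf \<Rightarrow> real \<Rightarrow> 'a \<Rightarrow> 'a" where
  "entropic_map P R \<epsilon> x =
     (let z = entropic_potential P R \<epsilon> in
      \<Sum>y\<in>set_pmf R.
        (exp ((x \<bullet> y - z y) / \<epsilon>) / (\<Sum>y'\<in>set_pmf R. exp ((x \<bullet> y' - z y') / \<epsilon>))) *\<^sub>R y)"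

text \<open>The sample \<open>Y\<^sub>1, \<dots>, Y\<^sub>n\<close> is indexed from \<open>0\<close>; only \<open>n \<ge> 1\<close> is meaningful.\<close>

definition empirical_pmf :: "(nat \<Rightarrow> 'w \<Rightarrow> 'a) \<Rightarrow> nat \<Rightarrow> 'w \<Rightarrow> 'a pmf" where
  "empirical_pmf Y n \<omega> = map_pmf (\<lambda>i. Y i \<omega>) (pmf_of_set {..<n})"

section \<open>The Hoelder space and its dual\<close>

definition holder_norm :: "'a::euclidean_space set \<Rightarrow> real \<Rightarrow> ('a \<Rightarrow> 'a) \<Rightarrow> ennreal" where
  "holder_norm X \<alpha> \<phi> =
     (SUP x\<in>X. ennreal (norm (\<phi> x))) +
     (SUP (x, y)\<in>{(x, y). x \<in> X \<and> y \<in> X \<and> x \<noteq> y}.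
        ennreal (norm (\<phi> x - \<phi> y) / norm (x - y) powr \<alpha>))"

text \<open>
  A map on \<open>X\<close> is represented by its extension by \<open>0\<close>, and a functional on the Hoelder space by its
  extension by \<open>0\<close> to all functions; both representations respect the linear structure.
\<close>

definition holder_space :: "'a::euclidean_space set \<Rightarrow> real \<Rightarrow> ('a \<Rightarrow> 'a) set" where
  "holder_space X \<alpha> = {\<phi>. (\<forall>x. x \<notin> X \<longrightarrow> \<phi> x = 0) \<and> holder_norm X \<alpha> \<phi> < \<infinity>}"

definition holder_dual :: "'a::euclidean_space set \<Rightarrow> real \<Rightarrow> (('a \<Rightarrow> 'a) \<Rightarrow> real) set" where
  "holder_dual X \<alpha> =
     {l. (\<forall>\<phi>. \<phi> \<notin> holder_space X \<alpha> \<longrightarrow> l \<phi> = 0) \<and>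
         (\<forall>\<phi>\<in>holder_space X \<alpha>. \<forall>\<psi>\<in>holder_space X \<alpha>. l (\<lambda>x. \<phi> x + \<psi> x) = l \<phi> + l \<psi>) \<and>
         (\<forall>\<phi>\<in>holder_space X \<alpha>. \<forall>c. l (\<lambda>x. c *\<^sub>R \<phi> x) = c * l \<phi>) \<and>
         (\<exists>K. \<forall>\<phi>\<in>holder_space X \<alpha>. \<bar>l \<phi>\<bar> \<le> K * enn2real (holder_norm X \<alpha> \<phi>))}"

text \<open>The unit ball is symmetric, so the absolute value does not change the supremum on the dual.\<close>

definition dual_norm :: "'a::euclidean_space set \<Rightarrow> real \<Rightarrow> (('a \<Rightarrow> 'a) \<Rightarrow> real) \<Rightarrow> real" where
  "dual_norm X \<alpha> l =
     enn2real (SUP \<phi>\<in>{\<phi>\<in>holder_space X \<alpha>. holder_norm X \<alpha> \<phi> \<le> 1}. ennreal \<bar>l \<phi>\<bar>)"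

definition dual_dist ::
    "'a::euclidean_space set \<Rightarrow> real \<Rightarrow> (('a \<Rightarrow> 'a) \<Rightarrow> real) \<Rightarrow> (('a \<Rightarrow> 'a) \<Rightarrow> real) \<Rightarrow> real" where
  "dual_dist X \<alpha> l l' = dual_norm X \<alpha> (\<lambda>\<phi>. l \<phi> - l' \<phi>)"

definition dual_topology :: "'a::euclidean_space set \<Rightarrow> real \<Rightarrow> (('a \<Rightarrow> 'a) \<Rightarrow> real) topology" where
  "dual_topology X \<alpha> = Metric_space.mtopology (holder_dual X \<alpha>) (dual_dist X \<alpha>)"

definition dual_embedding ::
    "'a::euclidean_space set \<Rightarrow> real \<Rightarrow> 'a measure \<Rightarrow> ('a \<Rightarrow> 'a) \<Rightarrow> ('a \<Rightarrow> 'a) \<Rightarrow> real" where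
  "dual_embedding X \<alpha> P T \<phi> = (if \<phi> \<in> holder_space X \<alpha> then \<integral>x. \<phi> x \<bullet> T x \<partial>P else 0)"

text \<open>The topology is only meaningful because the dual is a metric space.\<close>

lemma holder_norm_scale: "holder_norm X \<alpha> (\<lambda>x. c *\<^sub>R \<phi> x) = ennreal \<bar>c\<bar> * holder_norm X \<alpha> \<phi>"
proof -
  have "ennreal (norm (c *\<^sub>R \<phi> x - c *\<^sub>R \<phi> y) / norm (x - y) powr \<alpha>) =
      ennreal \<bar>c\<bar> * ennreal (norm (\<phi> x - \<phi> y) / norm (x - y) powr \<alpha>)" for x y
    by (simp add: ennreal_mult[symmetric] scaleR_diff_right[symmetric] del: scaleR_diff_right)
  moreover have "ennreal (norm (c *\<^sub>R \<phi> x)) = ennreal \<bar>c\<bar> * ennreal (norm (\<phi> x))" for x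
    by (simp add: ennreal_mult)
  ultimately show ?thesis
    unfolding holder_norm_def distrib_left SUP_mult_left_ennreal by (simp add: case_prod_unfold)
qed

lemma holder_dual_bound:
  assumes "l \<in> holder_dual X \<alpha>"
  obtains K where "\<And>\<phi>. \<phi> \<in> holder_space X \<alpha> \<Longrightarrow> \<bar>l \<phi>\<bar> \<le> K * enn2real (holder_norm X \<alpha> \<phi>)"
proof -
  have "\<exists>K. \<forall>\<phi>\<in>holder_space X \<alpha>. \<bar>l \<phi>\<bar> \<le> K * enn2real (holder_norm X \<alpha> \<phi>)"
    using assms by (simp add: holder_dual_def)
  then show thesis using that by blast
qed

lemma bdd_above_unit_ball:
  assumes "l \<in> holder_dual X \<alpha>"
  shows "bdd_above ((\<lambda>\<phi>. \<bar>l \<phi>\<bar>) ` {\<phi>\<in>holder_space X \<alpha>. holder_norm X \<alpha> \<phi> \<le> 1})"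
proof -
  obtain K where K: "\<And>\<phi>. \<phi> \<in> holder_space X \<alpha> \<Longrightarrow> \<bar>l \<phi>\<bar> \<le> K * enn2real (holder_norm X \<alpha> \<phi>)"
    using holder_dual_bound[OF assms] by blast
  have "\<bar>l \<phi>\<bar> \<le> \<bar>K\<bar>" if "\<phi> \<in> holder_space X \<alpha>" "holder_norm X \<alpha> \<phi> \<le> 1" for \<phi>
  proof -
    have e: "0 \<le> enn2real (holder_norm X \<alpha> \<phi>)" "enn2real (holder_norm X \<alpha> \<phi>) \<le> 1"
      using that(2) by (auto intro: enn2real_leI)
    have "K * enn2real (holder_norm X \<alpha> \<phi>) \<le> \<bar>K\<bar> * 1"
      by (rule mult_mono) (use e in auto)
    with K[OF that(1)] show ?thesis by simp
  qed
  then show ?thesis by (intro bdd_aboveI2[where M = "\<bar>K\<bar>"]) auto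
qed

lemma holder_dual_diff:
  assumes "l \<in> holder_dual X \<alpha>" "l' \<in> holder_dual X \<alpha>"
  shows "(\<lambda>\<phi>. l \<phi> - l' \<phi>) \<in> holder_dual X \<alpha>"
proof -
  obtain K where K: "\<And>\<phi>. \<phi> \<in> holder_space X \<alpha> \<Longrightarrow> \<bar>l \<phi>\<bar> \<le> K * enn2real (holder_norm X \<alpha> \<phi>)"
    using holder_dual_bound[OF assms(1)] by blast
  obtain K' where K': "\<And>\<phi>. \<phi> \<in> holder_space X \<alpha> \<Longrightarrow> \<bar>l' \<phi>\<bar> \<le> K' * enn2real (holder_norm X \<alpha> \<phi>)"
    using holder_dual_bound[OF assms(2)] by blast
  have "\<bar>l \<phi> - l' \<phi>\<bar> \<le> (K + K') * enn2real (holder_norm X \<alpha> \<phi>)" if "\<phi> \<in> holder_space X \<alpha>" for \<phi>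
    using K[OF that] K'[OF that] by (simp add: distrib_right)
  then have "\<exists>K. \<forall>\<phi>\<in>holder_space X \<alpha>. \<bar>l \<phi> - l' \<phi>\<bar> \<le> K * enn2real (holder_norm X \<alpha> \<phi>)"
    by blast
  then show ?thesis
    using assms unfolding holder_dual_def by (simp add: right_diff_distrib)
qed

lemma zero_in_unit_ball: "(\<lambda>x. 0) \<in> {\<phi>\<in>holder_space X \<alpha>. holder_norm X \<alpha> \<phi> \<le> 1}"
  using holder_norm_scale[of X \<alpha> 0 "\<lambda>x. 0"] by (simp add: holder_space_def)

lemma dual_norm_eq_SUP:
  assumes "l \<in> holder_dual X \<alpha>"
  shows "dual_norm X \<alpha> l = (SUP \<phi>\<in>{\<phi>\<in>holder_space X \<alpha>. holder_norm X \<alpha> \<phi> \<le> 1}. \<bar>l \<phi>\<bar>)"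
proof -
  let ?B = "{\<phi>\<in>holder_space X \<alpha>. holder_norm X \<alpha> \<phi> \<le> 1}"
  have bdd: "bdd_above ((\<lambda>\<phi>. \<bar>l \<phi>\<bar>) ` ?B)" by (rule bdd_above_unit_ball[OF assms])
  have ne: "?B \<noteq> {}" using zero_in_unit_ball by blast
  have *: "0 \<le> (SUP \<phi>\<in>?B. \<bar>l \<phi>\<bar>)"
    by (rule cSUP_upper2[OF bdd zero_in_unit_ball]) simp
  have "(SUP \<phi>\<in>?B. ennreal \<bar>l \<phi>\<bar>) = ennreal (SUP \<phi>\<in>?B. \<bar>l \<phi>\<bar>)"
  proof (rule antisym)
    show "(SUP \<phi>\<in>?B. ennreal \<bar>l \<phi>\<bar>) \<le> ennreal (SUP \<phi>\<in>?B. \<bar>l \<phi>\<bar>)"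
      by (intro SUP_least ennreal_leI cSUP_upper bdd)
    have top: "(SUP \<phi>\<in>?B. ennreal \<bar>l \<phi>\<bar>) < top"
      using \<open>(SUP \<phi>\<in>?B. ennreal \<bar>l \<phi>\<bar>) \<le> _\<close> ennreal_less_top le_less_trans by blast
    have "(SUP \<phi>\<in>?B. \<bar>l \<phi>\<bar>) \<le> enn2real (SUP \<phi>\<in>?B. ennreal \<bar>l \<phi>\<bar>)"
    proof (rule cSUP_least[OF ne])
      fix \<phi> assume "\<phi> \<in> ?B"
      then have "ennreal \<bar>l \<phi>\<bar> \<le> (SUP \<phi>\<in>?B. ennreal \<bar>l \<phi>\<bar>)" by (rule SUP_upper)
      from enn2real_mono[OF this top] show "\<bar>l \<phi>\<bar> \<le> enn2real (SUP \<phi>\<in>?B. ennreal \<bar>l \<phi>\<bar>)" by simp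
    qed
    from ennreal_leI[OF this] show "ennreal (SUP \<phi>\<in>?B. \<bar>l \<phi>\<bar>) \<le> (SUP \<phi>\<in>?B. ennreal \<bar>l \<phi>\<bar>)"
      by (simp only: ennreal_enn2real[OF top])
  qed
  then show ?thesis using * by (simp add: dual_norm_def)
qed

lemma Metric_space_holder_dual: "Metric_space (holder_dual X \<alpha>) (dual_dist X \<alpha>)"
proof
  let ?B = "{\<phi>\<in>holder_space X \<alpha>. holder_norm X \<alpha> \<phi> \<le> 1}"
  fix x y z :: "('a \<Rightarrow> 'a) \<Rightarrow> real"
  show "0 \<le> dual_dist X \<alpha> x y" by (simp add: dual_dist_def dual_norm_def)
  show "dual_dist X \<alpha> x y = dual_dist X \<alpha> y x"
    by (simp add: dual_dist_def dual_norm_def abs_minus_commute)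
  show "dual_dist X \<alpha> x y = 0 \<longleftrightarrow> x = y" if xy: "x \<in> holder_dual X \<alpha>" "y \<in> holder_dual X \<alpha>"
  proof
    assume 0: "dual_dist X \<alpha> x y = 0"
    define d where "d = (\<lambda>\<phi>. x \<phi> - y \<phi>)"
    have d: "d \<in> holder_dual X \<alpha>" unfolding d_def by (rule holder_dual_diff[OF xy])
    have dB: "d \<phi> = 0" if "\<phi> \<in> ?B" for \<phi>
      using cSUP_upper[OF that bdd_above_unit_ball[OF d]] 0 dual_norm_eq_SUP[OF d]
      by (simp add: dual_dist_def d_def)
    have "d \<phi> = 0" if \<phi>: "\<phi> \<in> holder_space X \<alpha>" for \<phi>
    proof -
      define c where "c = 1 / (enn2real (holder_norm X \<alpha> \<phi>) + 1)"
      have c: "c > 0" by (simp add: c_def add_nonneg_pos)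
      have fin: "holder_norm X \<alpha> \<phi> = ennreal (enn2real (holder_norm X \<alpha> \<phi>))"
        using \<phi> by (simp add: holder_space_def)
      have "ennreal \<bar>c\<bar> * holder_norm X \<alpha> \<phi> = ennreal (c * enn2real (holder_norm X \<alpha> \<phi>))"
        using c by (subst fin) (simp add: ennreal_mult)
      also have "\<dots> \<le> 1"
        using c by (simp add: c_def field_simps)
      finally have "holder_norm X \<alpha> (\<lambda>x. c *\<^sub>R \<phi> x) \<le> 1" by (simp add: holder_norm_scale)
      then have "(\<lambda>x. c *\<^sub>R \<phi> x) \<in> ?B"
        using \<phi> by (auto simp: holder_space_def intro: le_less_trans)
      from dB[OF this] have "c * d \<phi> = 0" using d \<phi> by (simp add: holder_dual_def)
      with c show ?thesis by simp
    qed
    moreover have "d \<phi> = 0" if "\<phi> \<notin> holder_space X \<alpha>" for \<phi>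
      using that xy by (simp add: d_def holder_dual_def)
    ultimately have "d \<phi> = 0" for \<phi> by blast
    then show "x = y" by (auto simp: d_def)
  next
    assume "x = y" then show "dual_dist X \<alpha> x y = 0"
      by (simp add: dual_dist_def dual_norm_def SUP_constant bot_ennreal)
  qed
  show "dual_dist X \<alpha> x z \<le> dual_dist X \<alpha> x y + dual_dist X \<alpha> y z"
    if x: "x \<in> holder_dual X \<alpha>" and y: "y \<in> holder_dual X \<alpha>" and z: "z \<in> holder_dual X \<alpha>"
  proof -
    have "\<bar>x \<phi> - z \<phi>\<bar> \<le> (SUP \<phi>\<in>?B. \<bar>x \<phi> - y \<phi>\<bar>) + (SUP \<phi>\<in>?B. \<bar>y \<phi> - z \<phi>\<bar>)" if "\<phi> \<in> ?B" for \<phi>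
      using cSUP_upper[OF that bdd_above_unit_ball[OF holder_dual_diff[OF x y]]]
        cSUP_upper[OF that bdd_above_unit_ball[OF holder_dual_diff[OF y z]]] by linarith
    then show ?thesis
      unfolding dual_dist_def dual_norm_eq_SUP[OF holder_dual_diff[OF x y]]
        dual_norm_eq_SUP[OF holder_dual_diff[OF y z]] dual_norm_eq_SUP[OF holder_dual_diff[OF x z]]
      using zero_in_unit_ball by (intro cSUP_least) blast+
  qed
qed

section \<open>Random elements\<close>

definition borel_of :: "'b topology \<Rightarrow> 'b measure" where
  "borel_of T = sigma (topspace T) {U. openin T U}"

text \<open>
  The approximating random elements are only required to be measurable up to null sets, which is
  what \<open>completion\<close> expresses; nothing is demanded of them on a null event.
\<close>

definition converges_in_distribution ::
    "'b topology \<Rightarrow> 'w measure \<Rightarrow> (nat \<Rightarrow> 'w \<Rightarrow> 'b) \<Rightarrow> 'v measure \<Rightarrow> ('v \<Rightarrow> 'b) \<Rightarrow> bool" where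
  "converges_in_distribution T M Z N G \<longleftrightarrow>
     (\<forall>n. Z n \<in> completion M \<rightarrow>\<^sub>M borel_of T) \<and> G \<in> N \<rightarrow>\<^sub>M borel_of T \<and>
     (\<forall>f. continuous_map T euclideanreal f \<and> bounded (f ` topspace T) \<longrightarrow>
        (\<lambda>n. \<integral>\<omega>. f (Z n \<omega>) \<partial>completion M) \<longlonglongrightarrow> (\<integral>\<omega>. f (G \<omega>) \<partial>N))"

definition centered_normal :: "real \<Rightarrow> real measure" where
  "centered_normal \<sigma> =
     (if \<sigma> = 0 then return borel 0 else density lborel (\<lambda>x. ennreal (normal_density 0 \<sigma> x)))"

definition holder_bidual ::
    "'a::euclidean_space set \<Rightarrow> real \<Rightarrow> ((('a \<Rightarrow> 'a) \<Rightarrow> real) \<Rightarrow> real) set" where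
  "holder_bidual X \<alpha> =
     {L. (\<forall>l\<in>holder_dual X \<alpha>. \<forall>l'\<in>holder_dual X \<alpha>. L (\<lambda>\<phi>. l \<phi> + l' \<phi>) = L l + L l') \<and>
         (\<forall>l\<in>holder_dual X \<alpha>. \<forall>c. L (\<lambda>\<phi>. c * l \<phi>) = c * L l) \<and>
         (\<exists>K. \<forall>l\<in>holder_dual X \<alpha>. \<bar>L l\<bar> \<le> K * dual_norm X \<alpha> l)}"

definition centered_gaussian ::
    "'a::euclidean_space set \<Rightarrow> real \<Rightarrow> 'v measure \<Rightarrow> ('v \<Rightarrow> ('a \<Rightarrow> 'a) \<Rightarrow> real) \<Rightarrow> bool" where
  "centered_gaussian X \<alpha> N G \<longleftrightarrow>
     G \<in> N \<rightarrow>\<^sub>M borel_of (dual_topology X \<alpha>) \<and>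
     (\<forall>L\<in>holder_bidual X \<alpha>. \<exists>\<sigma>\<ge>0. distr N borel (\<lambda>\<omega>. L (G \<omega>)) = centered_normal \<sigma>)"

end

theory Submission
  imports Defs
begin

text \<open>
  The entropic map is shown to be within \<open>O(\<epsilon>\<^bsup>1+\<alpha>\<^esup>)\<close> of the Brenier map in the dual Hoelder norm, uniformly
  over targets with a given finite support and masses bounded below. With probability tending to one
  the empirical measure is such a target, so the two empirical maps differ by
  \<open>o(n\<^bsup>-1/2\<^esup>)\<close> and the limit law carries over.

  For fixed potentials, the softmax weight \<open>i\<close> on cell \<open>k\<close> is compared with the softmax weight \<open>k\<close>
  on cell \<open>i\<close> by reflecting in the separating hyperplane: up to \<open>O(\<epsilon>\<^bsup>1+\<alpha>\<^esup>)\<close> these cancel, except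
  close to the boundary of \<open>X\<close> or to a third cell, where one is in the intersection of two strips of
  width \<open>O(\<epsilon>)\<close>. Since the cells keep a fixed mass, the hyperplanes are never tangent to \<open>X\<close> and the
  cells of three collinear points do not degenerate, so these exceptional sets contribute
  \<open>O(\<epsilon>\<^sup>2)\<close>. For constant test functions the same estimate bounds the difference of the cell masses
  belonging to the two potentials by \<open>O(\<epsilon>\<^sup>2)\<close>, and the isoperimetric inequality in the convex set
  \<open>X\<close> converts this into a bound for the difference of the potentials.
\<close>

section \<open>Integration along lines\<close>

text \<open>Reflections preserve Lebesgue measure but not \<open>P\<close>, so the cancellation is
  carried out for Lebesgue integrals and the density is absorbed into the test function. A Hoelder
  map times a Lipschitz density is again Hoelder with the same exponent; for a constant map the
  exponent is 1, which is why cell masses are controlled to second order. In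
  \<open>1 + \<alpha>\<close>, one power of \<open>\<epsilon>\<close> is the thickness of the layer
  where two weights compete, and \<open>\<alpha>\<close> more come from the variation of the test
  function across it. The obstacle is that the empirical potentials are random, so no constant may
  depend on a potential: beyond the fixed data, constants see only a lower bound on the cell masses,
  \<open>good c z\<close>. For the Brenier potential this bound is its first-order condition. For
  the entropic potential that condition concerns softmax masses, so a comparison of first order,
  valid for every potential, must make it \<open>good\<close> before the second-order estimate
  applies. Passing from masses to potentials combines monotonicity of subgradients with a lower
  bound for the mass of strips between groups of cells.\<close>

lemma nn_integral_lborel_translate:
  fixes f :: "'a::euclidean_space \<Rightarrow> ennreal"
  assumes [measurable]: "f \<in> borel_measurable borel"
  shows "(\<integral>\<^sup>+x. f (x + c) \<partial>lborel) = (\<integral>\<^sup>+x. f x \<partial>lborel)"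
proof -
  have "(\<integral>\<^sup>+x. f x \<partial>lborel) = (\<integral>\<^sup>+x. f x \<partial>distr lborel borel ((+) c))"
    by (simp add: lborel_distr_plus)
  also have "\<dots> = (\<integral>\<^sup>+x. f (c + x) \<partial>lborel)"
    by (subst nn_integral_distr) auto
  finally show ?thesis by (simp add: add.commute)
qed

lemma nn_integral_lborel_reflect_real:
  fixes h :: "real \<Rightarrow> ennreal"
  assumes [measurable]: "h \<in> borel_measurable borel"
  shows "(\<integral>\<^sup>+s. h (a - s) \<partial>lborel) = (\<integral>\<^sup>+s. h s \<partial>lborel)"
  using nn_integral_real_affine[of h "-1" a] by simp

text \<open>
  Averaging over the translates along \<open>p\<close> and exchanging the integrals replaces rotating \<open>v\<close> onto a
  coordinate axis.
\<close>

lemma nn_integral_le_by_line_average: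
  fixes F G :: "'a::euclidean_space \<Rightarrow> ennreal" and h :: "real \<Rightarrow> ennreal"
  assumes [measurable]: "F \<in> borel_measurable borel" "G \<in> borel_measurable borel"
      "h \<in> borel_measurable borel"
    and le: "\<And>x s. 0 \<le> s \<Longrightarrow> s \<le> 1 \<Longrightarrow> F (x - s *\<^sub>R p) \<le> G x * h (x \<bullet> v - s)"
  shows "(\<integral>\<^sup>+x. F x \<partial>lborel) \<le> (\<integral>\<^sup>+x. G x \<partial>lborel) * (\<integral>\<^sup>+s. h s \<partial>lborel)"
proof -
  have tr: "(\<integral>\<^sup>+x. F (x - s *\<^sub>R p) \<partial>lborel) = (\<integral>\<^sup>+x. F x \<partial>lborel)" for s
    using nn_integral_lborel_translate[of F "- s *\<^sub>R p"] by simp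
  have "(\<integral>\<^sup>+x. F x \<partial>lborel) = (\<integral>\<^sup>+s. (\<integral>\<^sup>+x. F x \<partial>lborel) * indicator {0..1::real} s \<partial>lborel)"
    by (subst nn_integral_cmult) auto
  also have "\<dots> = (\<integral>\<^sup>+s. (\<integral>\<^sup>+x. F (x - s *\<^sub>R p) * indicator {0..1} s \<partial>lborel) \<partial>lborel)"
    by (subst nn_integral_multc) (auto simp: tr)
  also have "\<dots> \<le> (\<integral>\<^sup>+s. (\<integral>\<^sup>+x. G x * h (x \<bullet> v - s) \<partial>lborel) \<partial>lborel)"
    by (intro nn_integral_mono) (auto simp: le split: split_indicator)
  also have "\<dots> = (\<integral>\<^sup>+x. (\<integral>\<^sup>+s. G x * h (x \<bullet> v - s) \<partial>lborel) \<partial>lborel)"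
    by (rule lborel_pair.Fubini') measurable
  also have "\<dots> = (\<integral>\<^sup>+x. G x * (\<integral>\<^sup>+s. h s \<partial>lborel) \<partial>lborel)"
    by (subst nn_integral_cmult) (auto simp: nn_integral_lborel_reflect_real)
  also have "\<dots> = (\<integral>\<^sup>+x. G x \<partial>lborel) * (\<integral>\<^sup>+s. h s \<partial>lborel)"
    by (subst nn_integral_multc) auto
  finally show ?thesis .
qed

text \<open>Translation by \<open>- s *\<^sub>R p\<close> lowers \<open>x \<bullet> v\<close> by
  exactly \<open>s\<close>, and a point taken into the ball of radius \<open>R\<close> by it lies in
  the ball enlarged by \<open>norm p\<close>. Averaging over \<open>s\<close> therefore separates a
  volume from the integral of \<open>h\<close>.\<close>

lemma nn_integral_slab_le:
  fixes v p :: "'a::euclidean_space"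
  assumes [measurable]: "h \<in> borel_measurable borel" and p: "p \<bullet> v = 1"
  shows "(\<integral>\<^sup>+x. indicator (cball 0 R) x * h (x \<bullet> v) \<partial>lborel) \<le>
    emeasure lborel (cball (0::'a) (R + norm p)) * (\<integral>\<^sup>+s. h s \<partial>lborel)"
proof -
  have "(\<integral>\<^sup>+x. indicator (cball 0 R) x * h (x \<bullet> v) \<partial>lborel) \<le>
     (\<integral>\<^sup>+x. indicator (cball (0::'a) (R + norm p)) x \<partial>lborel) * (\<integral>\<^sup>+s. h s \<partial>lborel)"
  proof (rule nn_integral_le_by_line_average[where p = p and v = v])
    fix x :: 'a and s :: real assume s: "0 \<le> s" "s \<le> 1"
    have "norm x \<le> norm (x - s *\<^sub>R p) + norm (s *\<^sub>R p)"
      using norm_triangle_ineq[of "x - s *\<^sub>R p" "s *\<^sub>R p"] by simp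
    moreover have "norm (s *\<^sub>R p) \<le> norm p" using s by (simp add: mult_left_le_one_le)
    ultimately show "indicator (cball 0 R) (x - s *\<^sub>R p) * h ((x - s *\<^sub>R p) \<bullet> v) \<le>
        indicator (cball 0 (R + norm p)) x * h (x \<bullet> v - s)"
      by (auto simp: inner_diff_left p split: split_indicator)
  qed (auto intro!: borel_measurable_times_ennreal borel_measurable_indicator)
  then show ?thesis by simp
qed

text \<open>Moving along \<open>p\<close> changes \<open>x \<bullet> v\<close> at unit speed and
  leaves \<open>x \<bullet> w\<close> fixed, so the average along \<open>p\<close> removes
  \<open>h\<close> and keeps \<open>k\<close>; the one-slab bound along \<open>q\<close> then
  removes \<open>k\<close>.\<close>

lemma nn_integral_two_slabs_le:
  fixes v w p q :: "'a::euclidean_space"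
  assumes [measurable]: "h \<in> borel_measurable borel" "k \<in> borel_measurable borel"
    and pq: "p \<bullet> v = 1" "p \<bullet> w = 0" "q \<bullet> w = 1"
  shows "(\<integral>\<^sup>+x. indicator (cball 0 R) x * h (x \<bullet> v) * k (x \<bullet> w) \<partial>lborel) \<le>
    emeasure lborel (cball (0::'a) (R + norm p + norm q)) *
      (\<integral>\<^sup>+s. k s \<partial>lborel) * (\<integral>\<^sup>+s. h s \<partial>lborel)"
proof -
  have "(\<integral>\<^sup>+x. indicator (cball 0 R) x * h (x \<bullet> v) * k (x \<bullet> w) \<partial>lborel) \<le>
     (\<integral>\<^sup>+x. indicator (cball (0::'a) (R + norm p)) x * k (x \<bullet> w) \<partial>lborel) * (\<integral>\<^sup>+s. h s \<partial>lborel)"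
  proof (rule nn_integral_le_by_line_average[where p = p and v = v])
    fix x :: 'a and s :: real assume s: "0 \<le> s" "s \<le> 1"
    have "norm x \<le> norm (x - s *\<^sub>R p) + norm (s *\<^sub>R p)"
      using norm_triangle_ineq[of "x - s *\<^sub>R p" "s *\<^sub>R p"] by simp
    moreover have "norm (s *\<^sub>R p) \<le> norm p" using s by (simp add: mult_left_le_one_le)
    ultimately show "indicator (cball 0 R) (x - s *\<^sub>R p) * h ((x - s *\<^sub>R p) \<bullet> v) *
        k ((x - s *\<^sub>R p) \<bullet> w) \<le> indicator (cball 0 (R + norm p)) x * k (x \<bullet> w) * h (x \<bullet> v - s)"
      by (auto simp: inner_diff_left pq mult.commute split: split_indicator)
  qed (auto intro!: borel_measurable_times_ennreal borel_measurable_indicator)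
  also have "\<dots> \<le> (emeasure lborel (cball (0::'a) (R + norm p + norm q)) * (\<integral>\<^sup>+s. k s \<partial>lborel)) *
      (\<integral>\<^sup>+s. h s \<partial>lborel)"
    by (intro mult_right_mono nn_integral_slab_le pq) auto
  finally show ?thesis .
qed

text \<open>On each line parallel to \<open>p\<close> the map is a point reflection, which preserves
  one-dimensional Lebesgue measure. Integrating over all these lines gives the claim without a
  determinant.\<close>

lemma nn_integral_lborel_oblique_reflection:
  fixes F :: "'a::euclidean_space \<Rightarrow> ennreal"
  assumes [measurable]: "F \<in> borel_measurable borel" and p: "p \<bullet> v = 1"
  shows "(\<integral>\<^sup>+x. F (x - (2 * (x \<bullet> v - b)) *\<^sub>R p) \<partial>lborel) = (\<integral>\<^sup>+x. F x \<partial>lborel)"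
proof -
  let ?w = "indicator {0..1::real} :: real \<Rightarrow> ennreal"
  \<comment> \<open>Disintegration along the lines parallel to \<open>p\<close>: each of them spends
    unit parameter length in the slab \<open>0 \<le> x \<bullet> v \<le> 1\<close>, so weighting the
    base points by \<open>?w\<close> counts every line once.\<close>
  have avg: "(\<integral>\<^sup>+x. H x \<partial>lborel) = (\<integral>\<^sup>+x. ?w (x \<bullet> v) * (\<integral>\<^sup>+s. H (x + s *\<^sub>R p) \<partial>lborel) \<partial>lborel)"
    if [measurable]: "H \<in> borel_measurable borel" for H :: "'a \<Rightarrow> ennreal"
  proof -
    have "(\<integral>\<^sup>+x. ?w (x \<bullet> v) * (\<integral>\<^sup>+s. H (x + s *\<^sub>R p) \<partial>lborel) \<partial>lborel) =
       (\<integral>\<^sup>+x. (\<integral>\<^sup>+s. ?w (x \<bullet> v) * H (x + s *\<^sub>R p) \<partial>lborel) \<partial>lborel)"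
      by (subst nn_integral_cmult) auto
    also have "\<dots> = (\<integral>\<^sup>+s. (\<integral>\<^sup>+x. ?w (x \<bullet> v) * H (x + s *\<^sub>R p) \<partial>lborel) \<partial>lborel)"
      by (rule lborel_pair.Fubini') measurable
    also have "\<dots> = (\<integral>\<^sup>+s. (\<integral>\<^sup>+x. ?w (x \<bullet> v - s) * H x \<partial>lborel) \<partial>lborel)"
    proof (rule nn_integral_cong)
      fix s
      show "(\<integral>\<^sup>+x. ?w (x \<bullet> v) * H (x + s *\<^sub>R p) \<partial>lborel) = (\<integral>\<^sup>+x. ?w (x \<bullet> v - s) * H x \<partial>lborel)"
        using nn_integral_lborel_translate[of "\<lambda>x. ?w (x \<bullet> v - s) * H x" "s *\<^sub>R p"]
        by (simp add: inner_add_left p)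
    qed
    also have "\<dots> = (\<integral>\<^sup>+x. (\<integral>\<^sup>+s. ?w (x \<bullet> v - s) * H x \<partial>lborel) \<partial>lborel)"
      by (rule lborel_pair.Fubini') measurable
    also have "\<dots> = (\<integral>\<^sup>+x. H x \<partial>lborel)"
      by (subst nn_integral_multc) (auto simp: nn_integral_lborel_reflect_real)
    finally show ?thesis by simp
  qed
  have "(\<integral>\<^sup>+s. F (x + s *\<^sub>R p - (2 * ((x + s *\<^sub>R p) \<bullet> v - b)) *\<^sub>R p) \<partial>lborel) =
      (\<integral>\<^sup>+s. F (x + s *\<^sub>R p) \<partial>lborel)" for x
  proof -
    have eq: "x + s *\<^sub>R p - (2 * ((x + s *\<^sub>R p) \<bullet> v - b)) *\<^sub>R p =
        x + (2 * (b - x \<bullet> v) - s) *\<^sub>R p" for s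
    proof -
      have *: "2 * (b - x \<bullet> v) - s = s - 2 * ((x + s *\<^sub>R p) \<bullet> v - b)"
        by (simp add: inner_add_left p)
      show ?thesis unfolding * by (simp only: scaleR_left_diff_distrib add_diff_eq)
    qed
    show ?thesis unfolding eq
      by (rule nn_integral_lborel_reflect_real[of "\<lambda>s. F (x + s *\<^sub>R p)"]) measurable
  qed
  then show ?thesis
    by (subst (1 2) avg) (auto)
qed

section \<open>Densities on convex bodies\<close>

lemma nn_integral_exp_tail:
  assumes "0 < c"
  shows "(\<integral>\<^sup>+s. indicator {b..} s * ennreal (exp (- (c * (s - b)))) \<partial>lborel) = ennreal (1 / c)"
proof -
  have "(\<integral>\<^sup>+s. ennreal (exp (- (c * (s - b)))) * indicator {b..} s \<partial>lborel) =
     ennreal (0 - (- exp (- (c * (b - b))) / c))"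
  proof (rule nn_integral_FTC_atLeast[where F = "\<lambda>s. - exp (- (c * (s - b))) / c"])
    show "((\<lambda>s. - exp (- (c * (s - b))) / c) has_real_derivative exp (- (c * (s - b)))) (at s)" for s
      using assms by (auto intro!: derivative_eq_intros)
    show "((\<lambda>s. - exp (- (c * (s - b))) / c) \<longlongrightarrow> 0) at_top"
      using assms by real_asymp
  qed auto
  then show ?thesis by (simp add: mult.commute)
qed

text \<open>With \<open>y = t / e\<close>, half of the exponential decay absorbs the power, since
  \<open>y powr a \<le> 1 + y \<le> 2 * exp (y / 2)\<close>. The price is the doubled scale
  \<open>2 * e\<close> in the exponential that remains.\<close>

lemma powr_mult_exp_le:
  fixes t e a :: real
  assumes "0 \<le> t" "0 < e" "0 < a" "a \<le> 1"
  shows "t powr a * exp (- (t / e)) \<le> 2 * e powr a * exp (- (t / (2 * e)))"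
proof -
  define y where "y = t / e"
  have y: "0 \<le> y" using assms by (simp add: y_def)
  have t: "t = y * e" using assms by (simp add: y_def)
  have "y powr a \<le> 1 + y"
  proof (cases "y \<le> 1")
    case True then show ?thesis using y assms by (smt (verit) powr_le1)
  next
    case False
    then have "y powr a \<le> y powr 1" using assms by (intro powr_mono) auto
    then show ?thesis using False by simp
  qed
  also have "1 + y \<le> 2 * exp (y / 2)" using y exp_ge_add_one_self[of "y/2"] by linarith
  finally have "y powr a * exp (- y) \<le> 2 * exp (y / 2) * exp (- y)" by (simp add: mult_right_mono)
  also have "\<dots> = 2 * exp (- (y / 2))" by (simp add: mult_exp_exp)
  finally have "e powr a * (y powr a * exp (- y)) \<le> e powr a * (2 * exp (- (y / 2)))"
    by (intro mult_left_mono) auto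
  then show ?thesis
    using assms y unfolding t by (simp add: powr_mult mult_ac)
qed

text \<open>\<open>p\<close> is the rescaled component of \<open>v\<close> orthogonal to
  \<open>w\<close>; strict Cauchy-Schwarz for independent vectors makes its product with
  \<open>v\<close> nonzero. \<open>q\<close> is a multiple of \<open>w\<close>.\<close>

lemma ex_dual_pair:
  fixes v w :: "'a::euclidean_space"
  assumes "\<not> collinear {0, v, w}"
  obtains p q where "p \<bullet> v = 1" "p \<bullet> w = 0" "q \<bullet> w = 1"
proof -
  have w: "w \<noteq> 0" using assms by (auto simp: insert_commute)
  have ne: "(v \<bullet> w)\<^sup>2 \<noteq> (v \<bullet> v) * (w \<bullet> w)"
  proof
    assume "(v \<bullet> w)\<^sup>2 = (v \<bullet> v) * (w \<bullet> w)"
    then have "\<bar>v \<bullet> w\<bar>\<^sup>2 = (norm v * norm w)\<^sup>2"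
      by (simp add: power_mult_distrib power2_norm_eq_inner)
    then have "\<bar>v \<bullet> w\<bar> = norm v * norm w" by (rule power2_eq_imp_eq) auto
    then show False using assms by (simp add: norm_cauchy_schwarz_equal)
  qed
  define p0 where "p0 = v - (v \<bullet> w / (w \<bullet> w)) *\<^sub>R w"
  have ww: "w \<bullet> w \<noteq> 0" using w by simp
  have p0w: "p0 \<bullet> w = 0" using ww by (simp add: p0_def inner_diff_left)
  have p0v: "p0 \<bullet> v = (v \<bullet> v * (w \<bullet> w) - (v \<bullet> w)\<^sup>2) / (w \<bullet> w)"
    using ww by (simp add: p0_def inner_diff_left inner_diff_right field_simps power2_eq_square inner_commute)
  have p0v0: "p0 \<bullet> v \<noteq> 0" using ne ww by (simp add: p0v)
  show thesis
    by (rule that[of "(1 / (p0 \<bullet> v)) *\<^sub>R p0" "(1 / (w \<bullet> w)) *\<^sub>R w"]) (use p0v0 p0w ww in auto)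
qed

locale convex_density =
  fixes X :: "'a::euclidean_space set" and P :: "'a measure" and \<rho> :: "'a \<Rightarrow> real"
  assumes compact_X: "compact X" and convex_X: "convex X" and interior_X: "interior X \<noteq> {}"
    and prob_P: "prob_space P" and P_density: "P = density lborel (\<lambda>x. ennreal (\<rho> x))"
    and AE_X: "AE x in P. x \<in> X"
    and \<rho>_meas[measurable]: "\<rho> \<in> borel_measurable borel" and \<rho>_nonneg: "\<And>x. 0 \<le> \<rho> x"
    and \<rho>_pos: "\<And>x. x \<in> X \<Longrightarrow> 0 < \<rho> x" and \<rho>_lipschitz: "\<exists>L. L-lipschitz_on X \<rho>"
begin

lemma X_sets[measurable]: "X \<in> sets borel"
  using compact_X by (simp add: borel_compact)

lemma X_nonempty: "X \<noteq> {}"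
  using interior_X interior_subset by auto

definition rad :: real where "rad = (SOME r. 0 < r \<and> X \<subseteq> cball 0 r)"

lemma rad: "0 < rad" "X \<subseteq> cball 0 rad"
proof -
  have "\<exists>r. 0 < r \<and> X \<subseteq> cball 0 r"
    using compact_imp_bounded[OF compact_X] bounded_subset_ballD[of X 0] ball_subset_cball by blast
  from someI_ex[OF this] show "0 < rad" "X \<subseteq> cball 0 rad" by (auto simp: rad_def)
qed

lemma norm_le_rad: "x \<in> X \<Longrightarrow> norm x \<le> rad"
  using rad by auto

definition \<rho>min :: real where "\<rho>min = Inf (\<rho> ` X)"
definition \<rho>max :: real where "\<rho>max = Sup (\<rho> ` X)"

lemma \<rho>_continuous: "continuous_on X \<rho>"
  using \<rho>_lipschitz lipschitz_on_continuous_on by blast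

lemma \<rho>_bounds:
  shows "0 < \<rho>min" "\<And>x. x \<in> X \<Longrightarrow> \<rho>min \<le> \<rho> x" "\<And>x. x \<in> X \<Longrightarrow> \<rho> x \<le> \<rho>max" "0 < \<rho>max"
proof -
  have c: "compact (\<rho> ` X)" using compact_continuous_image[OF \<rho>_continuous compact_X] .
  have ne: "\<rho> ` X \<noteq> {}" using X_nonempty by simp
  have "\<rho>min \<in> \<rho> ` X" unfolding \<rho>min_def
    by (rule closed_contains_Inf[OF ne]) (use c in \<open>auto intro: compact_imp_closed bounded_imp_bdd_below compact_imp_bounded\<close>)
  then show pos: "0 < \<rho>min" using \<rho>_pos by auto
  show lo: "\<rho>min \<le> \<rho> x" if "x \<in> X" for x unfolding \<rho>min_def
    by (rule cInf_lower) (use that c in \<open>auto intro: bounded_imp_bdd_below compact_imp_bounded\<close>)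
  show hi: "\<rho> x \<le> \<rho>max" if "x \<in> X" for x unfolding \<rho>max_def
    by (rule cSup_upper) (use that c in \<open>auto intro: bounded_imp_bdd_above compact_imp_bounded\<close>)
  obtain x where "x \<in> X" using X_nonempty by auto
  then show "0 < \<rho>max" using lo hi pos by force
qed

lemma sets_P[measurable_cong, simp]: "sets P = sets borel" and space_P[simp]: "space P = UNIV"
  by (auto simp: P_density)

lemma nn_integral_P:
  assumes [measurable]: "f \<in> borel_measurable borel"
  shows "(\<integral>\<^sup>+x. f x \<partial>P) = (\<integral>\<^sup>+x. ennreal (\<rho> x) * (f x * indicator X x) \<partial>lborel)"
proof -
  have "(\<integral>\<^sup>+x. f x \<partial>P) = (\<integral>\<^sup>+x. f x * indicator X x \<partial>P)"
    by (rule nn_integral_cong_AE) (use AE_X in eventually_elim, auto)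
  also have "\<dots> = (\<integral>\<^sup>+x. ennreal (\<rho> x) * (f x * indicator X x) \<partial>lborel)"
    unfolding P_density by (rule nn_integral_density) auto
  finally show ?thesis .
qed

lemma integral_P:
  fixes f :: "'a \<Rightarrow> real"
  assumes [measurable]: "f \<in> borel_measurable borel"
  shows "(\<integral>x. f x \<partial>P) = (\<integral>x. indicator X x * (\<rho> x * f x) \<partial>lborel)"
proof -
  have "(\<integral>x. f x \<partial>P) = (\<integral>x. indicator X x * f x \<partial>P)"
    by (rule integral_cong_AE) (use AE_X in \<open>auto simp: indicator_def\<close>)
  also have "\<dots> = (\<integral>x. \<rho> x *\<^sub>R (indicator X x * f x) \<partial>lborel)"
    unfolding P_density by (rule integral_density) (auto simp: \<rho>_nonneg)
  finally show ?thesis by (simp add: mult_ac)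
qed

lemma emeasure_P_le:
  assumes [measurable]: "A \<in> sets borel"
  shows "emeasure P A \<le> ennreal \<rho>max * emeasure lborel (X \<inter> A)"
proof -
  have "emeasure P A = (\<integral>\<^sup>+x. indicator A x \<partial>P)" by simp
  also have "\<dots> = (\<integral>\<^sup>+x. ennreal (\<rho> x) * (indicator A x * indicator X x) \<partial>lborel)"
    by (rule nn_integral_P) simp
  also have "\<dots> \<le> (\<integral>\<^sup>+x. ennreal \<rho>max * indicator (X \<inter> A) x \<partial>lborel)"
    by (intro nn_integral_mono) (auto simp: \<rho>_bounds ennreal_leI split: split_indicator)
  also have "\<dots> = ennreal \<rho>max * emeasure lborel (X \<inter> A)"
    by (subst nn_integral_cmult) auto
  finally show ?thesis .
qed

lemma emeasure_P_ge:
  assumes [measurable]: "A \<in> sets borel"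
  shows "ennreal \<rho>min * emeasure lborel (X \<inter> A) \<le> emeasure P A"
proof -
  have "ennreal \<rho>min * emeasure lborel (X \<inter> A) = (\<integral>\<^sup>+x. ennreal \<rho>min * indicator (X \<inter> A) x \<partial>lborel)"
    by (subst nn_integral_cmult) auto
  also have "\<dots> \<le> (\<integral>\<^sup>+x. ennreal (\<rho> x) * (indicator A x * indicator X x) \<partial>lborel)"
    by (intro nn_integral_mono) (auto simp: \<rho>_bounds ennreal_leI split: split_indicator)
  also have "\<dots> = (\<integral>\<^sup>+x. indicator A x \<partial>P)"
    by (rule nn_integral_P[symmetric]) simp
  finally show ?thesis by simp
qed

lemma fmeasurable_X_Int: "A \<in> sets borel \<Longrightarrow> emeasure lborel (X \<inter> A) < \<infinity>"
proof -
  assume "A \<in> sets borel"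
  have "emeasure lborel (X \<inter> A) \<le> emeasure lborel (cball (0::'a) rad)"
    by (rule emeasure_mono) (use rad in auto)
  also have "\<dots> < \<infinity>" by (rule emeasure_lborel_cball_finite)
  finally show ?thesis .
qed

lemma measure_P_le:
  assumes [measurable]: "A \<in> sets borel"
  shows "measure P A \<le> \<rho>max * measure lborel (X \<inter> A)"
proof -
  interpret prob_space P by (rule prob_P)
  show ?thesis
    using emeasure_P_le[OF assms] fmeasurable_X_Int[OF assms] \<rho>_bounds
    by (simp add: emeasure_eq_measure emeasure_eq_ennreal_measure ennreal_mult[symmetric] less_top)
qed

lemma measure_P_ge:
  assumes [measurable]: "A \<in> sets borel"
  shows "\<rho>min * measure lborel (X \<inter> A) \<le> measure P A"
proof -
  interpret prob_space P by (rule prob_P)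
  show ?thesis
    using emeasure_P_ge[OF assms] fmeasurable_X_Int[OF assms] \<rho>_bounds
    by (simp add: emeasure_eq_measure emeasure_eq_ennreal_measure ennreal_mult[symmetric] less_top)
qed

text \<open>Volume of the ball around \<open>X\<close> enlarged by \<open>1 / norm v\<close>, the
  length of the shortest shift that raises \<open>x \<bullet> v\<close> by one. It depends on
  \<open>v\<close> only through its norm and not on the position of a slab.\<close>

definition slab_const :: "'a \<Rightarrow> real" where
  "slab_const v = measure lborel (cball (0::'a) (rad + 1 / norm v))"

lemma slab_const_nonneg: "0 \<le> slab_const v"
  by (simp add: slab_const_def)

lemma nn_integral_slab:
  assumes v: "v \<noteq> 0" and [measurable]: "h \<in> borel_measurable borel"
  shows "(\<integral>\<^sup>+x. h (x \<bullet> v) * indicator X x \<partial>lborel) \<le> ennreal (slab_const v) * (\<integral>\<^sup>+s. h s \<partial>lborel)"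
proof -
  define p where "p = (1 / (v \<bullet> v)) *\<^sub>R v"
  have p: "p \<bullet> v = 1" "norm p = 1 / norm v"
    using v by (auto simp: p_def power2_norm_eq_inner[symmetric] power2_eq_square)
  have "(\<integral>\<^sup>+x. h (x \<bullet> v) * indicator X x \<partial>lborel) \<le> (\<integral>\<^sup>+x. indicator (cball 0 rad) x * h (x \<bullet> v) \<partial>lborel)"
    by (intro nn_integral_mono) (use rad in \<open>auto split: split_indicator\<close>)
  also have "\<dots> \<le> emeasure lborel (cball (0::'a) (rad + norm p)) * (\<integral>\<^sup>+s. h s \<partial>lborel)"
    by (rule nn_integral_slab_le[OF _ p(1)]) simp
  also have "emeasure lborel (cball (0::'a) (rad + norm p)) = ennreal (slab_const v)"
    unfolding slab_const_def p(2)
    by (rule emeasure_eq_ennreal_measure) (use emeasure_lborel_cball_finite less_top in auto)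
  finally show ?thesis .
qed

lemma nn_integral_slab_exp:
  assumes v: "v \<noteq> 0" and c: "0 < c"
  shows "(\<integral>\<^sup>+x. ennreal (exp (- (c * (x \<bullet> v - b)))) * indicator {x\<in>X. b \<le> x \<bullet> v} x \<partial>lborel) \<le>
    ennreal (slab_const v / c)"
proof -
  define h :: "real \<Rightarrow> ennreal" where "h s = indicator {b..} s * ennreal (exp (- (c * (s - b))))" for s
  have [measurable]: "h \<in> borel_measurable borel" unfolding h_def by measurable
  have "(\<integral>\<^sup>+x. ennreal (exp (- (c * (x \<bullet> v - b)))) * indicator {x\<in>X. b \<le> x \<bullet> v} x \<partial>lborel) =
      (\<integral>\<^sup>+x. h (x \<bullet> v) * indicator X x \<partial>lborel)"
    by (rule nn_integral_cong) (auto simp: h_def split: split_indicator)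
  also have "\<dots> \<le> ennreal (slab_const v) * (\<integral>\<^sup>+s. h s \<partial>lborel)"
    by (rule nn_integral_slab[OF v]) simp
  also have "(\<integral>\<^sup>+s. h s \<partial>lborel) = ennreal (1 / c)"
    unfolding h_def by (rule nn_integral_exp_tail[OF c])
  finally show ?thesis using c by (simp add: ennreal_mult[symmetric] slab_const_nonneg)
qed

lemma emeasure_slab:
  assumes v: "v \<noteq> 0" and s: "0 \<le> s"
  shows "emeasure lborel {x\<in>X. b \<le> x \<bullet> v \<and> x \<bullet> v \<le> b + s} \<le> ennreal (slab_const v * s)"
proof -
  have "emeasure lborel {x\<in>X. b \<le> x \<bullet> v \<and> x \<bullet> v \<le> b + s} =
     (\<integral>\<^sup>+x. indicator {x\<in>X. b \<le> x \<bullet> v \<and> x \<bullet> v \<le> b + s} x \<partial>lborel)"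
    by (rule nn_integral_indicator[symmetric]) measurable
  also have "\<dots> = (\<integral>\<^sup>+x. indicator {b..b+s} (x \<bullet> v) * indicator X x \<partial>lborel)"
    by (rule nn_integral_cong) (auto split: split_indicator)
  also have "\<dots> \<le> ennreal (slab_const v) * (\<integral>\<^sup>+t. indicator {b..b+s} t \<partial>lborel)"
    by (rule nn_integral_slab[OF v]) simp
  finally show ?thesis using s by (simp add: ennreal_mult slab_const_nonneg)
qed

lemma measure_slab:
  assumes v: "v \<noteq> 0" and s: "0 \<le> s"
  shows "measure lborel {x\<in>X. b \<le> x \<bullet> v \<and> x \<bullet> v \<le> b + s} \<le> slab_const v * s"
  using emeasure_slab[OF v s, of b] s slab_const_nonneg
  by (simp add: measure_def enn2real_leI)

lemma measure_P_slab:
  assumes v: "v \<noteq> 0" and s: "0 \<le> s"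
  shows "measure P {x. b \<le> x \<bullet> v \<and> x \<bullet> v \<le> b + s} \<le> \<rho>max * slab_const v * s"
proof -
  have "measure P {x. b \<le> x \<bullet> v \<and> x \<bullet> v \<le> b + s} \<le>
      \<rho>max * measure lborel (X \<inter> {x. b \<le> x \<bullet> v \<and> x \<bullet> v \<le> b + s})"
    by (rule measure_P_le) measurable
  also have "X \<inter> {x. b \<le> x \<bullet> v \<and> x \<bullet> v \<le> b + s} = {x\<in>X. b \<le> x \<bullet> v \<and> x \<bullet> v \<le> b + s}" by auto
  also have "\<rho>max * measure lborel \<dots> \<le> \<rho>max * (slab_const v * s)"
    by (intro mult_left_mono measure_slab v s less_imp_le[OF \<rho>_bounds(4)])
  finally show ?thesis by (simp add: mult_ac)
qed

text \<open>Each of the two transversal directions contributes a factor \<open>1 / c\<close>. The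
  constant is the volume of an enlarged ball and does not see the offsets \<open>a\<close> and
  \<open>b\<close>, which will be differences of potentials.\<close>

lemma nn_integral_two_slabs_exp:
  assumes vw: "\<not> collinear {0, v, w}"
  obtains C where "0 \<le> C" "\<And>a b c. 0 < c \<Longrightarrow>
     (\<integral>\<^sup>+x. ennreal (exp (- (c * ((x \<bullet> v - a) + (x \<bullet> w - b))))) *
        indicator {x\<in>X. a \<le> x \<bullet> v \<and> b \<le> x \<bullet> w} x \<partial>lborel) \<le> ennreal (C / c\<^sup>2)"
proof -
  obtain p q where pq: "p \<bullet> v = 1" "p \<bullet> w = 0" "q \<bullet> w = 1" by (rule ex_dual_pair[OF vw])
  define C where "C = measure lborel (cball (0::'a) (rad + norm p + norm q))"
  have C: "emeasure lborel (cball (0::'a) (rad + norm p + norm q)) = ennreal C"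
    unfolding C_def
    by (rule emeasure_eq_ennreal_measure) (use emeasure_lborel_cball_finite less_top in auto)
  show thesis
  proof (rule that[of C])
    show "0 \<le> C" by (simp add: C_def)
    fix a b c :: real assume c: "0 < c"
    define h :: "real \<Rightarrow> real \<Rightarrow> ennreal"
      where "h b s = indicator {b..} s * ennreal (exp (- (c * (s - b))))" for b s
    have [measurable]: "h b \<in> borel_measurable borel" for b unfolding h_def by measurable
    have hint: "(\<integral>\<^sup>+s. h b s \<partial>lborel) = ennreal (1 / c)" for b
      unfolding h_def by (rule nn_integral_exp_tail[OF c])
    have "(\<integral>\<^sup>+x. ennreal (exp (- (c * ((x \<bullet> v - a) + (x \<bullet> w - b))))) *
        indicator {x\<in>X. a \<le> x \<bullet> v \<and> b \<le> x \<bullet> w} x \<partial>lborel) \<le>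
      (\<integral>\<^sup>+x. indicator (cball 0 rad) x * h a (x \<bullet> v) * h b (x \<bullet> w) \<partial>lborel)"
      by (intro nn_integral_mono)
        (use norm_le_rad in \<open>auto simp: h_def distrib_left ennreal_mult[symmetric] mult_exp_exp split: split_indicator\<close>)
    also have "\<dots> \<le> emeasure lborel (cball (0::'a) (rad + norm p + norm q)) *
       (\<integral>\<^sup>+s. h b s \<partial>lborel) * (\<integral>\<^sup>+s. h a s \<partial>lborel)"
      by (rule nn_integral_two_slabs_le[OF _ _ pq]) auto
    also have "\<dots> = ennreal (C / c\<^sup>2)"
      unfolding hint C using c \<open>0 \<le> C\<close> by (simp add: ennreal_mult[symmetric] power2_eq_square)
    finally show "(\<integral>\<^sup>+x. ennreal (exp (- (c * ((x \<bullet> v - a) + (x \<bullet> w - b))))) *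
        indicator {x\<in>X. a \<le> x \<bullet> v \<and> b \<le> x \<bullet> w} x \<partial>lborel) \<le> ennreal (C / c\<^sup>2)" .
  qed
qed

end

section \<open>Slabs, boundary layers and isoperimetry\<close>

lemma nn_integral_lborel_affine:
  fixes f :: "'a::euclidean_space \<Rightarrow> ennreal"
  assumes [measurable]: "f \<in> borel_measurable borel" and c: "c \<noteq> 0"
  shows "(\<integral>\<^sup>+x. f x \<partial>lborel) = ennreal (\<bar>c\<bar> ^ DIM('a)) * (\<integral>\<^sup>+x. f (t + c *\<^sub>R x) \<partial>lborel)"
proof -
  have "(\<integral>\<^sup>+x. f x \<partial>lborel) =
      (\<integral>\<^sup>+x. f x \<partial>density (distr lborel borel (\<lambda>x. t + c *\<^sub>R x)) (\<lambda>_. ennreal (\<bar>c\<bar> ^ DIM('a))))"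
    by (subst lborel_affine[OF c, of t]) simp
  also have "\<dots> = (\<integral>\<^sup>+x. ennreal (\<bar>c\<bar> ^ DIM('a)) * f (t + c *\<^sub>R x) \<partial>lborel)"
    by (subst nn_integral_density) (auto simp: nn_integral_distr)
  also have "\<dots> = ennreal (\<bar>c\<bar> ^ DIM('a)) * (\<integral>\<^sup>+x. f (t + c *\<^sub>R x) \<partial>lborel)"
    by (subst nn_integral_cmult) auto
  finally show ?thesis .
qed

lemma emeasure_lborel_shrink:
  fixes A B :: "'a::euclidean_space set"
  assumes A[measurable]: "A \<in> sets borel" and B[measurable]: "B \<in> sets borel" and c: "0 < c"
    and sub: "\<And>x. x \<in> A \<Longrightarrow> p + c *\<^sub>R (x - p) \<in> B"
  shows "ennreal (c ^ DIM('a)) * emeasure lborel A \<le> emeasure lborel B"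
proof -
  have "emeasure lborel B = (\<integral>\<^sup>+x. indicator B x \<partial>lborel)" by simp
  also have "\<dots> = ennreal (\<bar>c\<bar> ^ DIM('a)) * (\<integral>\<^sup>+x. indicator B ((p - c *\<^sub>R p) + c *\<^sub>R x) \<partial>lborel)"
    by (rule nn_integral_lborel_affine) (use c in auto)
  also have "\<dots> \<ge> ennreal (\<bar>c\<bar> ^ DIM('a)) * (\<integral>\<^sup>+x. indicator A x \<partial>lborel)"
  proof (intro mult_left_mono nn_integral_mono)
    fix x
    have "(p - c *\<^sub>R p) + c *\<^sub>R x = p + c *\<^sub>R (x - p)" by (simp add: scaleR_diff_right)
    then show "indicator A x \<le> (indicator B ((p - c *\<^sub>R p) + c *\<^sub>R x) :: ennreal)"
      using sub[of x] by (simp only: split: split_indicator) auto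
  qed simp
  finally show ?thesis using c by simp
qed

text \<open>Writing \<open>exp (- (c * g x))\<close> as the integral of
  \<open>c * exp (- (c * s))\<close> over \<open>s \<ge> g x\<close> and exchanging integrals leaves
  only the volumes of sublevel sets. The factor \<open>s\<^sup>2\<close> is absorbed by half of the
  exponential, which gives 16 in place of the sharp constant 2.\<close>

lemma nn_integral_exp_layer_cake:
  fixes g :: "'a::euclidean_space \<Rightarrow> real"
  assumes [measurable]: "A \<in> sets borel" "g \<in> borel_measurable borel"
    and g: "\<And>x. x \<in> A \<Longrightarrow> 0 \<le> g x" and c: "0 < c" and C: "0 \<le> C"
    and vol: "\<And>s. 0 \<le> s \<Longrightarrow> emeasure lborel {x\<in>A. g x \<le> s} \<le> ennreal (C * s\<^sup>2)"
  shows "(\<integral>\<^sup>+x. ennreal (exp (- (c * g x))) * indicator A x \<partial>lborel) \<le> ennreal (16 * C / c\<^sup>2)"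
proof -
  have tail: "ennreal (exp (- (c * b))) =
      (\<integral>\<^sup>+s. ennreal c * (indicator {b..} s * ennreal (exp (- (c * s)))) \<partial>lborel)" for b
  proof -
    have "(\<integral>\<^sup>+s. indicator {b..} s * ennreal (exp (- (c * s))) \<partial>lborel) =
        (\<integral>\<^sup>+s. ennreal (exp (- (c * b))) * (indicator {b..} s * ennreal (exp (- (c * (s - b))))) \<partial>lborel)"
      by (intro nn_integral_cong)
        (auto simp: ennreal_mult[symmetric] mult_exp_exp algebra_simps split: split_indicator)
    also have "\<dots> = ennreal (exp (- (c * b))) * ennreal (1 / c)"
      by (subst nn_integral_cmult) (auto simp: nn_integral_exp_tail[OF c])
    finally show ?thesis
      using c by (subst nn_integral_cmult) (auto simp: ennreal_mult[symmetric])
  qed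
  have "(\<integral>\<^sup>+x. ennreal (exp (- (c * g x))) * indicator A x \<partial>lborel) =
     (\<integral>\<^sup>+x. (\<integral>\<^sup>+s. ennreal c * (indicator {g x..} s * ennreal (exp (- (c * s)))) * indicator A x \<partial>lborel) \<partial>lborel)"
    by (subst tail, subst nn_integral_multc) auto
  also have "\<dots> = (\<integral>\<^sup>+x. (\<integral>\<^sup>+s. ennreal (c * exp (- (c * s))) *
      (if x \<in> A \<and> g x \<le> s then 1 else 0) \<partial>lborel) \<partial>lborel)"
    using c by (intro nn_integral_cong) (auto simp: ennreal_mult split: split_indicator)
  also have "\<dots> = (\<integral>\<^sup>+s. (\<integral>\<^sup>+x. ennreal (c * exp (- (c * s))) *
      (if x \<in> A \<and> g x \<le> s then 1 else 0) \<partial>lborel) \<partial>lborel)"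
    by (rule lborel_pair.Fubini') measurable
  also have "\<dots> = (\<integral>\<^sup>+s. ennreal (c * exp (- (c * s))) * emeasure lborel {x\<in>A. g x \<le> s} \<partial>lborel)"
  proof (intro nn_integral_cong)
    fix s
    have "(\<integral>\<^sup>+x. ennreal (c * exp (- (c * s))) * (if x \<in> A \<and> g x \<le> s then 1 else 0) \<partial>lborel) =
      (\<integral>\<^sup>+x. ennreal (c * exp (- (c * s))) * indicator {x\<in>A. g x \<le> s} x \<partial>lborel)"
      by (intro nn_integral_cong) (auto split: split_indicator)
    also have "\<dots> = ennreal (c * exp (- (c * s))) * emeasure lborel {x\<in>A. g x \<le> s}"
      by (subst nn_integral_cmult) auto
    finally show "(\<integral>\<^sup>+x. ennreal (c * exp (- (c * s))) * (if x \<in> A \<and> g x \<le> s then 1 else 0) \<partial>lborel) =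
      ennreal (c * exp (- (c * s))) * emeasure lborel {x\<in>A. g x \<le> s}" .
  qed
  also have "\<dots> \<le> (\<integral>\<^sup>+s. ennreal (8 * C / c) * (indicator {0..} s * ennreal (exp (- ((c/2) * (s - 0))))) \<partial>lborel)"
  proof (intro nn_integral_mono)
    fix s
    show "ennreal (c * exp (- (c * s))) * emeasure lborel {x\<in>A. g x \<le> s} \<le>
      ennreal (8 * C / c) * (indicator {0..} s * ennreal (exp (- ((c/2) * (s - 0)))))"
    proof (cases "0 \<le> s")
      case False
      then have *: "{x\<in>A. g x \<le> s} = {}" using g by force
      show ?thesis unfolding * by simp
    next
      case True
      have "(c * s / 2)\<^sup>2 / 2 \<le> exp (c * s / 2)"
        using exp_lower_Taylor_quadratic[of "c * s / 2"] c True
        by (smt (verit) divide_nonneg_pos mult_nonneg_nonneg)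
      then have q: "s\<^sup>2 \<le> 8 / c\<^sup>2 * exp (c * s / 2)" using c by (simp add: field_simps power2_eq_square)
      have "c * exp (- (c * s)) * (C * s\<^sup>2) \<le> c * exp (- (c * s)) * (C * (8 / c\<^sup>2 * exp (c * s / 2)))"
        using c C q by (intro mult_left_mono) auto
      also have "\<dots> = (8 * C / c) * (exp (- (c * s)) * exp (c * s / 2))"
        using c by (simp add: power2_eq_square)
      also have "exp (- (c * s)) * exp (c * s / 2) = exp (- ((c/2) * (s - 0)))"
        by (simp add: mult_exp_exp)
      finally have *: "c * exp (- (c * s)) * (C * s\<^sup>2) \<le> (8 * C / c) * exp (- ((c/2) * (s - 0)))" .
      have "ennreal (c * exp (- (c * s))) * emeasure lborel {x\<in>A. g x \<le> s} \<le>
          ennreal (c * exp (- (c * s))) * ennreal (C * s\<^sup>2)"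
        by (intro mult_left_mono vol True) simp
      also have "\<dots> \<le> ennreal ((8 * C / c) * exp (- ((c/2) * (s - 0))))"
        using * c C by (simp add: ennreal_mult[symmetric] ennreal_leI)
      also have "\<dots> = ennreal (8 * C / c) * ennreal (exp (- ((c/2) * (s - 0))))"
        using c C by (intro ennreal_mult) auto
      finally show ?thesis using True by simp
    qed
  qed
  also have "\<dots> = ennreal (8 * C / c) * ennreal (1 / (c / 2))"
    by (subst nn_integral_cmult) (use c nn_integral_exp_tail[of "c/2" 0] in auto)
  also have "\<dots> = ennreal (16 * C / c\<^sup>2)"
    using c C by (simp add: ennreal_mult[symmetric] power2_eq_square)
  finally show ?thesis .
qed

text \<open>Section of the cone with apex \<open>x\<close> over the inner ball: contraction towards
  \<open>x\<close> by the factor \<open>t\<close> scales the radius by \<open>t\<close>.\<close>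

lemma cball_subset_convex_combination:
  fixes X :: "'a::euclidean_space set"
  assumes "convex X" "cball q r \<subseteq> X" "x \<in> X" "0 < t" "t \<le> 1"
  shows "cball ((1 - t) *\<^sub>R x + t *\<^sub>R q) (t * r) \<subseteq> X"
proof
  fix y assume y: "y \<in> cball ((1 - t) *\<^sub>R x + t *\<^sub>R q) (t * r)"
  define e where "e = (1 / t) *\<^sub>R (y - ((1 - t) *\<^sub>R x + t *\<^sub>R q))"
  have "norm e \<le> r"
  proof -
    have "norm e = norm (y - ((1 - t) *\<^sub>R x + t *\<^sub>R q)) / t" using assms(4) by (simp add: e_def)
    also have "\<dots> \<le> t * r / t"
      using y assms(4) by (intro divide_right_mono) (auto simp: dist_norm norm_minus_commute)
    finally show ?thesis using assms(4) by simp
  qed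
  then have "q + e \<in> X" using assms(2) by (auto simp: dist_norm)
  moreover have "y = (1 - t) *\<^sub>R x + t *\<^sub>R (q + e)"
    using assms(4) by (simp add: e_def scaleR_add_right)
  ultimately show "y \<in> X"
    using assms(1,3,4,5) by (simp add: convexD)
qed

section \<open>Hyperplanes that leave substantial mass on both sides\<close>

context convex_density
begin

lemma ex_inner_ball:
  obtains q r where "0 < r" "cball q r \<subseteq> X"
  using interior_X mem_interior_cball by (metis ex_in_conv)

text \<open>A thickness at which a slab normal to \<open>v\<close> has mass strictly less than
  \<open>c\<close>. The summand 1 keeps the denominator positive.\<close>

definition width :: "real \<Rightarrow> 'a \<Rightarrow> real" where
  "width c v = c / (2 * (\<rho>max * slab_const v + 1))"

lemma width_pos: "0 < c \<Longrightarrow> 0 < width c v"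
  unfolding width_def using \<rho>_bounds(4) slab_const_nonneg[of v]
  by (intro divide_pos_pos mult_pos_pos add_nonneg_pos) auto

lemma width_mass:
  assumes "0 < c"
  shows "\<rho>max * slab_const v * width c v < c"
proof -
  define D where "D = \<rho>max * slab_const v + 1"
  have "0 < D" using \<rho>_bounds(4) slab_const_nonneg[of v] by (simp add: D_def add_nonneg_pos)
  then have "D * width c v = c / 2" by (simp add: width_def D_def[symmetric])
  moreover have "\<rho>max * slab_const v * width c v \<le> D * width c v"
    using width_pos[OF assms, of v] by (simp add: D_def)
  ultimately show ?thesis using assms by simp
qed

text \<open>If all points of \<open>A\<close> in \<open>X\<close> were within
  \<open>width c v\<close> of the hyperplane, then \<open>A\<close> would be covered by a slab of
  mass less than \<open>c\<close>, up to a null set.\<close>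

lemma ex_deep_point:
  assumes v: "v \<noteq> 0" and c: "0 < c" and mass: "c \<le> measure P A"
    and A: "\<And>x. x \<in> A \<Longrightarrow> b \<le> x \<bullet> v"
  obtains x where "x \<in> X" "x \<in> A" "b + width c v < x \<bullet> v"
proof -
  interpret prob_space P by (rule prob_P)
  have "\<exists>x\<in>X. x \<in> A \<and> b + width c v < x \<bullet> v"
  proof (rule ccontr)
    assume "\<not> ?thesis"
    then have n: "\<And>x. x \<in> X \<Longrightarrow> x \<in> A \<Longrightarrow> x \<bullet> v \<le> b + width c v" by force
    have "prob A \<le> prob {x. b \<le> x \<bullet> v \<and> x \<bullet> v \<le> b + width c v}"
      by (rule finite_measure_mono_AE) (use AE_X n A in \<open>auto elim!: eventually_mono\<close>)
    also have "\<dots> \<le> \<rho>max * slab_const v * width c v"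
      by (rule measure_P_slab[OF v]) (use width_pos[OF c, of v] in simp)
    finally show False using width_mass[OF c, of v] mass by simp
  qed
  then show thesis using that by blast
qed

text \<open>Quantitative non-tangency, with \<open>\<delta>\<close> independent of the offset
  \<open>b\<close>. The segment from a deep point on one side to the centre of a fixed inner ball on
  the other side crosses the hyperplane, and the cone over the ball has a definite radius at the
  crossing point.\<close>

lemma hyperplane_inner_ball:
  assumes v: "v \<noteq> 0" and c: "0 < c"
  obtains \<delta> where "0 < \<delta>"
    "\<And>b. c \<le> measure P {x. b \<le> x \<bullet> v} \<Longrightarrow> c \<le> measure P {x. x \<bullet> v \<le> b} \<Longrightarrow>
       \<exists>p. p \<bullet> v = b \<and> cball p \<delta> \<subseteq> X"
proof -
  obtain q r where q: "0 < r" "cball q r \<subseteq> X" by (rule ex_inner_ball)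
  have qX: "q \<in> X" using q by auto
  define w where "w = width c v"
  have w0: "0 < w" unfolding w_def by (rule width_pos[OF c])
  define \<delta> where "\<delta> = w / (2 * rad * norm v) * r"
  \<comment> \<open>Both orientations \<open>u = v\<close> and \<open>u = - v\<close> are treated at
    once, so that \<open>q\<close> may be taken to lie on the lower side.\<close>
  have key: "\<exists>p. p \<bullet> u = b \<and> cball p \<delta> \<subseteq> X"
    if u: "u = v \<or> u = - v" and qu: "q \<bullet> u \<le> b" and mass: "c \<le> measure P {x. b \<le> x \<bullet> u}" for u b
  proof -
    have u0: "u \<noteq> 0" and nu: "norm u = norm v" and wu: "width c u = w"
      using u v by (auto simp: slab_const_def width_def w_def)
    obtain x where x: "x \<in> X" "b + w < x \<bullet> u"
      using ex_deep_point[OF u0 c mass, of b] wu by auto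
    \<comment> \<open>The weight of \<open>q\<close> at the crossing point. It is at least the depth
      \<open>w\<close> divided by the bound \<open>2 * rad * norm v\<close> for the variation of
      \<open>x \<bullet> u\<close> over \<open>X\<close>.\<close>
    define l where "l = (x \<bullet> u - b) / (x \<bullet> u - q \<bullet> u)"
    have pos: "0 < x \<bullet> u - q \<bullet> u" using x qu w0 by simp
    have l: "0 < l" "l \<le> 1" using pos x qu w0 by (auto simp: l_def)
    have "x \<bullet> u - q \<bullet> u = (x - q) \<bullet> u" by (simp add: inner_diff_left)
    also have "\<dots> \<le> norm (x - q) * norm u" by (rule norm_cauchy_schwarz)
    also have "\<dots> \<le> (2 * rad) * norm v"
      using norm_triangle_ineq4[of x q] norm_le_rad[OF x(1)] norm_le_rad[OF qX] rad(1)
      by (intro mult_mono) (auto simp: nu)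
    finally have "w / (2 * rad * norm v) \<le> l"
      unfolding l_def using x w0 pos by (intro frac_le) auto
    then have \<delta>: "\<delta> \<le> l * r" using q unfolding \<delta>_def by (intro mult_right_mono) auto
    define p where "p = (1 - l) *\<^sub>R x + l *\<^sub>R q"
    have "p \<bullet> u = x \<bullet> u - l * (x \<bullet> u - q \<bullet> u)" by (simp add: p_def inner_add_left algebra_simps)
    also have "\<dots> = b" using pos by (simp add: l_def)
    finally have "p \<bullet> u = b" .
    moreover have "cball p (l * r) \<subseteq> X"
      unfolding p_def by (rule cball_subset_convex_combination[OF convex_X q(2) x(1) l])
    moreover have "cball p \<delta> \<subseteq> cball p (l * r)" using \<delta> by auto
    ultimately show ?thesis by blast
  qed
  show thesis
  proof (rule that[of \<delta>])
    show "0 < \<delta>" using w0 rad q v by (simp add: \<delta>_def)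
    fix b assume m1: "c \<le> measure P {x. b \<le> x \<bullet> v}" and m2: "c \<le> measure P {x. x \<bullet> v \<le> b}"
    show "\<exists>p. p \<bullet> v = b \<and> cball p \<delta> \<subseteq> X"
    proof (cases "q \<bullet> v \<le> b")
      case True then show ?thesis using key[of v b] m1 by simp
    next
      case False then show ?thesis using key[of "-v" "-b"] m2 by simp
    qed
  qed
qed

text \<open>
  Dilating \<open>X\<close> about a point \<open>p\<close> of the hyperplane maps slabs into slabs, so the part of a slab close
  to the boundary of \<open>X\<close> has a volume of second order.
\<close>

lemma emeasure_slab_boundary:
  fixes k s :: real
  assumes v: "v \<noteq> 0" and \<delta>: "0 < \<delta>" and p: "p \<bullet> v = b" "cball p \<delta> \<subseteq> X"
    and k: "0 < k" and s: "0 \<le> s"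
    and A: "A \<in> sets borel" "A \<subseteq> {x\<in>X. b \<le> x \<bullet> v \<and> x \<bullet> v \<le> b + s \<and> \<not> cball x (k * s) \<subseteq> X}"
  shows "emeasure lborel A \<le> ennreal (real DIM('a) * k / \<delta> * slab_const v * s\<^sup>2)"
proof -
  define B where "B = {x\<in>X. b \<le> x \<bullet> v \<and> x \<bullet> v \<le> b + s}"
  have Bm[measurable]: "B \<in> sets borel" unfolding B_def by measurable
  have B: "emeasure lborel B \<le> ennreal (slab_const v * s)"
    unfolding B_def by (rule emeasure_slab[OF v s])
  have AB: "A \<subseteq> B" using A by (auto simp: B_def)
  \<comment> \<open>The dilation ratio is chosen so that
    \<open>(1 - \<mu>) * \<delta> = k * s\<close>: the ball around \<open>p\<close> then provides a
    ball of radius \<open>k * s\<close> around every dilated point, which keeps the dilated slab out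
    of \<open>A\<close>.\<close>
  define \<mu> where "\<mu> = 1 - k * s / \<delta>"
  show ?thesis
  proof (cases "0 < \<mu>")
    \<comment> \<open>Here \<open>s\<close> is so large that the first-order volume of the whole
      slab is already below the second-order bound.\<close>
    case False
    then have "1 \<le> k * s / \<delta>" by (simp add: \<mu>_def)
    also have "k * s / \<delta> \<le> real DIM('a) * (k * s / \<delta>)"
    proof -
      have "1 * (k * s / \<delta>) \<le> real DIM('a) * (k * s / \<delta>)"
        using k s \<delta> DIM_positive[where 'a = 'a] by (intro mult_right_mono) (auto simp: Suc_leI)
      then show ?thesis by simp
    qed
    finally have "slab_const v * s * 1 \<le> slab_const v * s * (real DIM('a) * (k * s / \<delta>))"
      using s slab_const_nonneg by (intro mult_left_mono) auto
    then have *: "slab_const v * s \<le> real DIM('a) * k / \<delta> * slab_const v * s\<^sup>2"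
      by (simp add: power2_eq_square mult_ac)
    have "emeasure lborel A \<le> emeasure lborel B" using AB by (intro emeasure_mono) auto
    also have "\<dots> \<le> ennreal (slab_const v * s)" by (rule B)
    finally show ?thesis using * order_trans ennreal_leI by blast
  next
    case True
    have \<mu>1: "\<mu> \<le> 1" using k s \<delta> by (simp add: \<mu>_def)
    have pX: "p \<in> X" using p \<delta> by auto
    have dil: "p + \<mu> *\<^sub>R (x - p) \<in> B - A" if x: "x \<in> B" for x
    proof -
      let ?y = "p + \<mu> *\<^sub>R (x - p)"
      have eq: "?y = (1 - (1 - \<mu>)) *\<^sub>R x + (1 - \<mu>) *\<^sub>R p" by (simp add: algebra_simps)
      have xX: "x \<in> X" using x by (simp add: B_def)
      have "?y \<in> X" unfolding eq using xX pX convex_X True \<mu>1 by (simp add: convexD)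
      moreover have yv: "?y \<bullet> v = b + \<mu> * (x \<bullet> v - b)" using p by (simp add: inner_add_left inner_diff_left)
      moreover have "0 \<le> \<mu> * (x \<bullet> v - b)" using x True by (simp add: B_def)
      moreover have "\<mu> * (x \<bullet> v - b) \<le> 1 * s" using x True \<mu>1 by (intro mult_mono) (auto simp: B_def)
      ultimately have "?y \<in> B" by (simp add: B_def)
      moreover have "cball ?y (k * s) \<subseteq> X"
      proof (cases "s = 0")
        case True then show ?thesis using \<open>?y \<in> X\<close> by simp
      next
        case False
        then have "0 < 1 - \<mu>" using k s \<delta> by (simp add: \<mu>_def)
        moreover have "(1 - \<mu>) * \<delta> = k * s" using \<delta> by (simp add: \<mu>_def)
        ultimately show ?thesis
          using cball_subset_convex_combination[OF convex_X p(2) xX, of "1 - \<mu>"] True unfolding eq by simp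
      qed
      ultimately show ?thesis using A by auto
    qed
    have Am[measurable]: "A \<in> sets borel" by (rule A)
    have BA: "B - A \<in> sets borel" by measurable
    have le: "ennreal (\<mu> ^ DIM('a)) * emeasure lborel B \<le> emeasure lborel (B - A)"
      by (rule emeasure_lborel_shrink[OF Bm BA True dil])
    have finB: "emeasure lborel B \<noteq> \<infinity>" using B ennreal_less_top le_less_trans by (metis infinity_ennreal_def less_irrefl)
    have finA: "emeasure lborel A \<noteq> \<infinity>" using emeasure_mono[OF AB, of lborel] finB by (auto simp: top_unique)
    define VB VA where "VB = measure lborel B" and "VA = measure lborel A"
    have eB: "emeasure lborel B = ennreal VB" unfolding VB_def using finB by (simp add: emeasure_eq_ennreal_measure)
    have eA: "emeasure lborel A = ennreal VA" unfolding VA_def using finA by (simp add: emeasure_eq_ennreal_measure)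
    have "emeasure lborel (B - A) = ennreal (VB - VA)"
      using emeasure_Diff[of lborel A B] finA AB by (simp add: eA eB ennreal_minus VA_def)
    then have "ennreal (\<mu> ^ DIM('a) * VB) \<le> ennreal (VB - VA)"
      using le True by (simp add: eB ennreal_mult VB_def)
    moreover have "VA \<le> VB"
      using emeasure_mono[OF AB, of lborel] by (simp add: eA eB VB_def)
    \<comment> \<open>What remains for \<open>A\<close> is the volume the dilation loses; the
      Bernoulli inequality makes it linear in \<open>s\<close>, and the volume of the slab supplies
      the second factor \<open>s\<close>.\<close>
    ultimately have "VA \<le> VB * (1 - \<mu> ^ DIM('a))"
      by (simp add: algebra_simps)
    also have "\<dots> \<le> VB * (real DIM('a) * (k * s / \<delta>))"
      using Bernoulli_inequality[of "- (k * s / \<delta>)" "DIM('a)"] True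
      by (intro mult_left_mono) (simp_all add: \<mu>_def VB_def)
    also have "\<dots> \<le> slab_const v * s * (real DIM('a) * (k * s / \<delta>))"
      using B s slab_const_nonneg k \<delta> by (intro mult_right_mono) (simp_all add: eB)
    finally have "VA \<le> slab_const v * s * (real DIM('a) * (k * s / \<delta>))" .
    then show ?thesis unfolding eA
      by (intro ennreal_leI) (simp add: power2_eq_square mult_ac)
  qed
qed

end

section \<open>Isoperimetry by integration over segments\<close>

lemma crossing_length:
  fixes \<gamma> :: "real \<Rightarrow> real"
  assumes lip: "\<And>s t. s \<in> {0..1} \<Longrightarrow> t \<in> {0..1} \<Longrightarrow> \<bar>\<gamma> s - \<gamma> t\<bar> \<le> K * \<bar>s - t\<bar>"
    and K: "0 < K" and \<eta>: "0 < \<eta>" and ends: "\<gamma> 0 < 0" "\<eta> \<le> \<gamma> 1"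
    and m: "{s\<in>{0..1}. 0 \<le> \<gamma> s \<and> \<gamma> s < \<eta>} \<in> sets borel"
  shows "ennreal (\<eta> / K) \<le> emeasure lborel {s\<in>{0..1}. 0 \<le> \<gamma> s \<and> \<gamma> s < \<eta>}"
proof -
  have cont: "continuous_on {0..1} \<gamma>"
  proof (rule lipschitz_on_continuous_on[of K])
    show "K-lipschitz_on {0..1} \<gamma>"
      using lip K by (auto simp: lipschitz_on_def dist_real_def)
  qed
  define U where "U = {s\<in>{0..1}. \<eta> \<le> \<gamma> s}"
  have "U = {0..1} \<inter> \<gamma> -` {\<eta>..}" by (auto simp: U_def)
  then have U: "closed U" using continuous_closed_preimage[OF cont, of "{\<eta>..}"] by simp
  have U1: "1 \<in> U" "bdd_below U" using ends by (auto simp: U_def intro!: bdd_belowI[of _ 0])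
  \<comment> \<open>First time at which the level \<open>\<eta>\<close> is reached;
    \<open>s1\<close> below is the last earlier time with a value at most 0. Strictly between them
    all values lie between 0 and \<open>\<eta>\<close>, and the Lipschitz bound makes this interval
    long.\<close>
  define s2 where "s2 = Inf U"
  have s2: "s2 \<in> U" unfolding s2_def using closed_contains_Inf[OF _ U1(2) U] U1(1) by blast
  have s2min: "s2 \<le> s" if "s \<in> U" for s unfolding s2_def using that U1(2) by (rule cInf_lower)
  define V where "V = {s\<in>{0..s2}. \<gamma> s \<le> 0}"
  have s2b: "0 \<le> s2" "s2 \<le> 1" "\<eta> \<le> \<gamma> s2" using s2 by (auto simp: U_def)
  have "V = {0..s2} \<inter> \<gamma> -` {..0}" by (auto simp: V_def)
  moreover have "continuous_on {0..s2} \<gamma>" by (rule continuous_on_subset[OF cont]) (use s2b in auto)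
  ultimately have V: "closed V" using continuous_closed_preimage[of "{0..s2}" \<gamma> "{..0}"] by simp
  have V0: "0 \<in> V" "bdd_above V" using ends s2b by (auto simp: V_def intro!: bdd_aboveI[of _ s2])
  define s1 where "s1 = Sup V"
  have s1: "s1 \<in> V" unfolding s1_def using closed_contains_Sup[OF _ V0(2) V] V0(1) by blast
  have s1max: "s \<le> s1" if "s \<in> V" for s unfolding s1_def using that V0(2) by (rule cSup_upper)
  have s1b: "0 \<le> s1" "s1 \<le> s2" "\<gamma> s1 \<le> 0" using s1 by (auto simp: V_def)
  have "\<eta> \<le> \<gamma> s2 - \<gamma> s1" using s1b s2b by linarith
  also have "\<dots> \<le> K * (s2 - s1)" using lip[of s2 s1] s1b s2b by auto
  finally have "\<eta> / K \<le> s2 - s1" using K by (simp add: field_simps)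
  then have "ennreal (\<eta> / K) \<le> ennreal (s2 - s1)" by (rule ennreal_leI)
  also have "\<dots> = emeasure lborel {s1<..<s2}" using s1b by simp
  also have "\<dots> \<le> emeasure lborel {s\<in>{0..1}. 0 \<le> \<gamma> s \<and> \<gamma> s < \<eta>}"
  proof (rule emeasure_mono)
    show "{s1<..<s2} \<subseteq> {s\<in>{0..1}. 0 \<le> \<gamma> s \<and> \<gamma> s < \<eta>}"
    proof
      fix s assume s: "s \<in> {s1<..<s2}"
      then have "s \<notin> V" "s \<notin> U" using s1max[of s] s2min[of s] by auto
      then show "s \<in> {s\<in>{0..1}. 0 \<le> \<gamma> s \<and> \<gamma> s < \<eta>}" using s s1b s2b by (auto simp: U_def V_def)
    qed
  qed (use m in simp)
  finally show ?thesis .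
qed

text \<open>The change of variables has Jacobian \<open>s\<close> to the power minus
  \<open>DIM('a)\<close>, at most \<open>2 ^ DIM('a)\<close>; this is the origin of that factor in
  the isoperimetric inequality.\<close>

lemma nn_integral_indicator_affine_le:
  fixes S :: "'a::euclidean_space set"
  assumes [measurable]: "S \<in> sets borel" and s: "1/2 \<le> s"
  shows "(\<integral>\<^sup>+y. indicator S (a + s *\<^sub>R y) \<partial>lborel) \<le> ennreal (2 ^ DIM('a)) * emeasure lborel S"
proof -
  let ?I = "\<integral>\<^sup>+y. indicator S (a + s *\<^sub>R y) \<partial>lborel"
  have "?I = ennreal (2 ^ DIM('a)) * (ennreal ((1/2) ^ DIM('a)) * ?I)"
    by (simp add: mult.assoc[symmetric] ennreal_mult[symmetric] power_mult_distrib[symmetric])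
  also have "\<dots> \<le> ennreal (2 ^ DIM('a)) * (ennreal (\<bar>s\<bar> ^ DIM('a)) * ?I)"
    using s by (intro mult_left_mono mult_right_mono ennreal_leI power_mono) auto
  also have "ennreal (\<bar>s\<bar> ^ DIM('a)) * ?I = (\<integral>\<^sup>+y. indicator S y \<partial>lborel)"
    by (rule nn_integral_lborel_affine[symmetric]) (use s in auto)
  finally show ?thesis by simp
qed

context convex_density
begin

lemma finite_volume: "A \<subseteq> X \<Longrightarrow> emeasure lborel A = ennreal (measure lborel A)"
proof (rule emeasure_eq_ennreal_measure)
  assume "A \<subseteq> X"
  then have "emeasure lborel A \<le> emeasure lborel X" by (intro emeasure_mono) auto
  also have "\<dots> < \<infinity>" using fmeasurable_X_Int[of UNIV] by simp
  finally show "emeasure lborel A \<noteq> \<top>" by simp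
qed

text \<open>
  Every segment from \<open>{G < 0}\<close> to \<open>{G \<ge> \<eta>}\<close> spends time at least \<open>\<eta> / (2 L rad)\<close> in between;
  integrating over all segments, the point at time \<open>s\<close> is spread out by the endpoint that carries
  weight at least \<open>1/2\<close>.
\<close>

lemma isoperimetric:
  assumes [measurable]: "G \<in> borel_measurable borel"
    and lip: "\<And>x y. \<bar>G x - G y\<bar> \<le> L * norm (x - y)" and L: "0 < L" and \<eta>: "0 < \<eta>"
  shows "measure lborel {x\<in>X. G x < 0} * measure lborel {x\<in>X. \<eta> \<le> G x} * (\<eta> / (L * (2 * rad))) \<le>
     2 ^ DIM('a) * measure lborel X * measure lborel {x\<in>X. 0 \<le> G x \<and> G x < \<eta>}"
proof -
  define D E S where "D = {x\<in>X. G x < 0}" and "E = {x\<in>X. \<eta> \<le> G x}"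
    and "S = {x\<in>X. 0 \<le> G x \<and> G x < \<eta>}"
  have [measurable]: "D \<in> sets borel" "E \<in> sets borel" "S \<in> sets borel"
    unfolding D_def E_def S_def by measurable
  define K where "K = L * (2 * rad)"
  have K: "0 < K" using L rad by (simp add: K_def)
  \<comment> \<open>Records when a segment is inside \<open>S\<close>. Integrating over the time
    first gives the lower bound \<open>low\<close>, integrating over the endpoints first gives the
    upper bound \<open>up\<close>.\<close>
  define \<phi> :: "'a \<Rightarrow> 'a \<Rightarrow> real \<Rightarrow> ennreal" where
    "\<phi> x y s = indicator {0..1} s * (indicator X x * indicator X y * indicator S ((1 - s) *\<^sub>R x + s *\<^sub>R y))" for x y s
  have \<phi>m[measurable]: "(\<lambda>(x, y, s). \<phi> x y s) \<in> borel_measurable (borel \<Otimes>\<^sub>M borel \<Otimes>\<^sub>M borel)"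
    unfolding \<phi>_def by measurable
  have low: "indicator D x * indicator E y * ennreal (\<eta> / K) \<le> (\<integral>\<^sup>+s. \<phi> x y s \<partial>lborel)" for x y
  proof (cases "x \<in> D \<and> y \<in> E")
    case True
    then have x: "x \<in> X" "G x < 0" and y: "y \<in> X" "\<eta> \<le> G y" by (auto simp: D_def E_def)
    define \<gamma> where "\<gamma> s = G ((1 - s) *\<^sub>R x + s *\<^sub>R y)" for s
    have [measurable]: "\<gamma> \<in> borel_measurable borel" unfolding \<gamma>_def by measurable
    have nxy: "norm (x - y) \<le> 2 * rad"
      using norm_triangle_ineq4[of x y] norm_le_rad[OF x(1)] norm_le_rad[OF y(1)] by simp
    have "ennreal (\<eta> / K) \<le> emeasure lborel {s\<in>{0..1}. 0 \<le> \<gamma> s \<and> \<gamma> s < \<eta>}"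
    proof (rule crossing_length[OF _ K \<eta>])
      fix s t :: real
      have "((1 - s) *\<^sub>R x + s *\<^sub>R y) - ((1 - t) *\<^sub>R x + t *\<^sub>R y) = (t - s) *\<^sub>R (x - y)"
        by (simp add: algebra_simps)
      then have "norm (((1 - s) *\<^sub>R x + s *\<^sub>R y) - ((1 - t) *\<^sub>R x + t *\<^sub>R y)) = \<bar>s - t\<bar> * norm (x - y)"
        by (simp add: abs_minus_commute)
      then have "\<bar>\<gamma> s - \<gamma> t\<bar> \<le> L * (\<bar>s - t\<bar> * norm (x - y))"
        using lip[of "(1 - s) *\<^sub>R x + s *\<^sub>R y" "(1 - t) *\<^sub>R x + t *\<^sub>R y"] by (simp add: \<gamma>_def)
      also have "\<dots> \<le> L * (\<bar>s - t\<bar> * (2 * rad))"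
        using L nxy by (intro mult_left_mono) auto
      finally show "\<bar>\<gamma> s - \<gamma> t\<bar> \<le> K * \<bar>s - t\<bar>" by (simp add: K_def mult_ac)
    qed (use x y in \<open>auto simp: \<gamma>_def\<close>)
    also have "\<dots> = (\<integral>\<^sup>+s. indicator {s\<in>{0..1}. 0 \<le> \<gamma> s \<and> \<gamma> s < \<eta>} s \<partial>lborel)"
      by (rule nn_integral_indicator[symmetric]) measurable
    also have "\<dots> \<le> (\<integral>\<^sup>+s. \<phi> x y s \<partial>lborel)"
    proof (intro nn_integral_mono)
      fix s
      have "(1 - s) *\<^sub>R x + s *\<^sub>R y \<in> X" if "s \<in> {0..1}"
        using convexD[OF convex_X x(1) y(1), of "1 - s" s] that by auto
      then show "indicator {s\<in>{0..1}. 0 \<le> \<gamma> s \<and> \<gamma> s < \<eta>} s \<le> \<phi> x y s"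
        using x y by (auto simp: \<phi>_def S_def \<gamma>_def split: split_indicator)
    qed
    finally show ?thesis using True by simp
  qed auto
  have up: "(\<integral>\<^sup>+x. (\<integral>\<^sup>+y. \<phi> x y s \<partial>lborel) \<partial>lborel) \<le>
      ennreal (2 ^ DIM('a)) * emeasure lborel S * emeasure lborel X * indicator {0..1} s" for s
  proof (cases "s \<in> {0..1}")
    case False then show ?thesis by (simp add: \<phi>_def)
  next
    case s: True
    have bound: "(\<integral>\<^sup>+x. (\<integral>\<^sup>+y. indicator X x * indicator S ((1 - t) *\<^sub>R x + t *\<^sub>R y) \<partial>lborel) \<partial>lborel) \<le>
        ennreal (2 ^ DIM('a)) * emeasure lborel S * emeasure lborel X" if t: "1/2 \<le> t" for t
    proof -
      have "(\<integral>\<^sup>+x. (\<integral>\<^sup>+y. indicator X x * indicator S ((1 - t) *\<^sub>R x + t *\<^sub>R y) \<partial>lborel) \<partial>lborel) \<le>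
          (\<integral>\<^sup>+x. (ennreal (2 ^ DIM('a)) * emeasure lborel S) * indicator X x \<partial>lborel)"
      proof (intro nn_integral_mono)
        fix x
        have "(\<integral>\<^sup>+y. indicator X x * indicator S ((1 - t) *\<^sub>R x + t *\<^sub>R y) \<partial>lborel) =
            indicator X x * (\<integral>\<^sup>+y. indicator S ((1 - t) *\<^sub>R x + t *\<^sub>R y) \<partial>lborel)"
          by (rule nn_integral_cmult) measurable
        also have "\<dots> \<le> indicator X x * (ennreal (2 ^ DIM('a)) * emeasure lborel S)"
          by (intro mult_left_mono nn_integral_indicator_affine_le t) auto
        finally show "(\<integral>\<^sup>+y. indicator X x * indicator S ((1 - t) *\<^sub>R x + t *\<^sub>R y) \<partial>lborel) \<le>
            (ennreal (2 ^ DIM('a)) * emeasure lborel S) * indicator X x" by (simp add: mult.commute)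
      qed
      also have "\<dots> = ennreal (2 ^ DIM('a)) * emeasure lborel S * emeasure lborel X"
        by (subst nn_integral_cmult) auto
      finally show ?thesis .
    qed
    show ?thesis
    proof (cases "1/2 \<le> s")
      case True
      have "(\<integral>\<^sup>+x. (\<integral>\<^sup>+y. \<phi> x y s \<partial>lborel) \<partial>lborel) \<le>
          (\<integral>\<^sup>+x. (\<integral>\<^sup>+y. indicator X x * indicator S ((1 - s) *\<^sub>R x + s *\<^sub>R y) \<partial>lborel) \<partial>lborel)"
        by (intro nn_integral_mono) (simp add: \<phi>_def split: split_indicator)
      also have "\<dots> \<le> ennreal (2 ^ DIM('a)) * emeasure lborel S * emeasure lborel X"
        by (rule bound[OF True])
      finally show ?thesis using s by simp
    next
      case False
      have "(\<integral>\<^sup>+x. (\<integral>\<^sup>+y. \<phi> x y s \<partial>lborel) \<partial>lborel) = (\<integral>\<^sup>+y. (\<integral>\<^sup>+x. \<phi> x y s \<partial>lborel) \<partial>lborel)"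
        by (rule lborel_pair.Fubini') (simp add: \<phi>_def)
      also have "\<dots> \<le>
          (\<integral>\<^sup>+x. (\<integral>\<^sup>+y. indicator X x * indicator S ((1 - (1 - s)) *\<^sub>R x + (1 - s) *\<^sub>R y) \<partial>lborel) \<partial>lborel)"
        by (intro nn_integral_mono) (simp add: \<phi>_def add.commute split: split_indicator)
      also have "\<dots> \<le> ennreal (2 ^ DIM('a)) * emeasure lborel S * emeasure lborel X"
        by (rule bound) (use False in simp)
      finally show ?thesis using s by simp
    qed
  qed
  have "emeasure lborel D * emeasure lborel E * ennreal (\<eta> / K) =
      (\<integral>\<^sup>+x. (\<integral>\<^sup>+y. indicator D x * indicator E y * ennreal (\<eta> / K) \<partial>lborel) \<partial>lborel)"
    by (simp add: nn_integral_multc nn_integral_cmult)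
  also have "\<dots> \<le> (\<integral>\<^sup>+x. (\<integral>\<^sup>+y. (\<integral>\<^sup>+s. \<phi> x y s \<partial>lborel) \<partial>lborel) \<partial>lborel)"
    by (intro nn_integral_mono low)
  also have "\<dots> = (\<integral>\<^sup>+x. (\<integral>\<^sup>+s. (\<integral>\<^sup>+y. \<phi> x y s \<partial>lborel) \<partial>lborel) \<partial>lborel)"
    by (intro nn_integral_cong lborel_pair.Fubini') (simp add: \<phi>_def)
  also have "\<dots> = (\<integral>\<^sup>+s. (\<integral>\<^sup>+x. (\<integral>\<^sup>+y. \<phi> x y s \<partial>lborel) \<partial>lborel) \<partial>lborel)"
    by (rule lborel_pair.Fubini') (simp add: \<phi>_def)
  also have "\<dots> \<le> (\<integral>\<^sup>+s. ennreal (2 ^ DIM('a)) * emeasure lborel S * emeasure lborel X * indicator {0..1::real} s \<partial>lborel)"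
    by (intro nn_integral_mono up)
  also have "\<dots> = ennreal (2 ^ DIM('a)) * emeasure lborel S * emeasure lborel X"
    by (subst nn_integral_cmult) auto
  finally have "emeasure lborel D * emeasure lborel E * ennreal (\<eta> / K) \<le>
     ennreal (2 ^ DIM('a)) * emeasure lborel S * emeasure lborel X" .
  moreover have "D \<subseteq> X" "E \<subseteq> X" "S \<subseteq> X" by (auto simp: D_def E_def S_def)
  ultimately have "ennreal (measure lborel D * measure lborel E * (\<eta> / K)) \<le>
     ennreal (2 ^ DIM('a) * measure lborel S * measure lborel X)"
    using K \<eta> by (simp add: finite_volume ennreal_mult[symmetric] del: ennreal_le_iff)
  then show ?thesis
    by (simp add: D_def E_def S_def K_def mult_ac)
qed

end

section \<open>Laguerre cells and softmax weights\<close>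

lemma distr_lborel_oblique_reflection:
  fixes v :: "'a::euclidean_space"
  assumes p: "p \<bullet> v = 1"
  shows "distr lborel borel (\<lambda>x. x - (2 * (x \<bullet> v - b)) *\<^sub>R p) = lborel"
proof (rule measure_eqI)
  fix A assume "A \<in> sets (distr lborel borel (\<lambda>x. x - (2 * (x \<bullet> v - b)) *\<^sub>R p))"
  then have A[measurable]: "A \<in> sets borel" by simp
  let ?t = "\<lambda>x. x - (2 * (x \<bullet> v - b)) *\<^sub>R p"
  have "emeasure (distr lborel borel ?t) A = (\<integral>\<^sup>+x. indicator A x \<partial>distr lborel borel ?t)"
    by simp
  also have "\<dots> = (\<integral>\<^sup>+x. indicator A (?t x) \<partial>lborel)"
    by (rule nn_integral_distr) auto
  also have "\<dots> = emeasure lborel A"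
    using nn_integral_lborel_oblique_reflection[OF _ p, of "indicator A" b] by simp
  finally show "emeasure (distr lborel borel ?t) A = emeasure lborel A" .
qed simp

text \<open>Allows an exponentially small weight to be counted as an error of second order.\<close>

lemma exp_minus_le_square:
  fixes a e :: real
  assumes "0 < a" "0 < e"
  shows "exp (- (a / e)) \<le> 2 * e\<^sup>2 / a\<^sup>2"
proof -
  have "(a / e)\<^sup>2 / 2 \<le> exp (a / e)"
    using exp_lower_Taylor_quadratic[of "a / e"] assms by (smt (verit) divide_nonneg_pos)
  then have "1 / exp (a / e) \<le> 1 / ((a / e)\<^sup>2 / 2)"
    using assms by (intro divide_left_mono) auto
  then show ?thesis using assms by (simp add: exp_minus power_divide field_simps)
qed

text \<open>Meant for a point and its mirror image: \<open>a\<close> is the relative weight of the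
  neighbouring cell, shared by both points, while \<open>g\<close> and \<open>h\<close> collect the
  relative weights of all third cells at the two points. Both denominators are at least 1.\<close>

lemma fraction_diff_le:
  fixes a g h :: real
  assumes "0 \<le> a" "0 \<le> g" "0 \<le> h"
  shows "\<bar>a / (1 + a + g) - a / (1 + a + h)\<bar> \<le> a * (g + h)"
proof -
  have "a / (1 + a + g) - a / (1 + a + h) = a * (h - g) / ((1 + a + g) * (1 + a + h))"
    using assms by (simp add: field_simps)
  also have "\<bar>\<dots>\<bar> = a * \<bar>h - g\<bar> / ((1 + a + g) * (1 + a + h))"
    using assms by (simp add: abs_mult)
  also have "\<dots> \<le> a * (g + h) / 1"
  proof (rule frac_le)
    have "1 * 1 \<le> (1 + a + g) * (1 + a + h)" using assms by (intro mult_mono) auto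
    then show "1 \<le> (1 + a + g) * (1 + a + h)" by simp
  qed (use assms in \<open>auto intro!: mult_left_mono\<close>)
  finally show ?thesis by simp
qed

definition score :: "('a::euclidean_space \<Rightarrow> real) \<Rightarrow> 'a \<Rightarrow> 'a \<Rightarrow> real" where
  "score z y x = x \<bullet> y - z y"

lemma score_measurable[measurable]: "score z y \<in> borel_measurable borel"
  unfolding score_def by measurable

abbreviation gap :: "('a::euclidean_space \<Rightarrow> real) \<Rightarrow> 'a \<Rightarrow> 'a \<Rightarrow> 'a \<Rightarrow> real" where
  "gap z k i x \<equiv> score z k x - score z i x"

lemma score_diff: "gap z k i x = x \<bullet> (k - i) - (z k - z i)"
  by (simp add: score_def inner_diff_right)

locale semidiscrete = convex_density +
  fixes S :: "'a set"
  assumes finite_S: "finite S" and S_nonempty: "S \<noteq> {}"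
begin

text \<open>Closed polyhedra in the whole space that overlap in common faces; the restriction to
  \<open>X\<close> is left to the estimates.\<close>

definition cell :: "('a \<Rightarrow> real) \<Rightarrow> 'a \<Rightarrow> 'a set" where
  "cell z k = {x. \<forall>j\<in>S. score z j x \<le> score z k x}"

definition soft :: "real \<Rightarrow> ('a \<Rightarrow> real) \<Rightarrow> 'a \<Rightarrow> 'a \<Rightarrow> real" where
  "soft \<epsilon> z i x = exp (score z i x / \<epsilon>) / (\<Sum>j\<in>S. exp (score z j x / \<epsilon>))"

text \<open>The nondegeneracy in terms of which all second-order estimates are uniform. It bounds
  the potentials only through the masses of their cells, which is what first-order conditions
  provide.\<close>

definition good :: "real \<Rightarrow> ('a \<Rightarrow> real) \<Rightarrow> bool" where
  "good c z \<longleftrightarrow> (\<forall>k\<in>S. c \<le> measure P (cell z k))"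

lemma cell_measurable[measurable]: "cell z k \<in> sets borel"
  unfolding cell_def using finite_S by measurable

lemma cellD: "x \<in> cell z k \<Longrightarrow> j \<in> S \<Longrightarrow> score z j x \<le> score z k x"
  by (simp add: cell_def)

lemma soft_measurable[measurable]: "soft \<epsilon> z i \<in> borel_measurable borel"
  unfolding soft_def by measurable

lemma soft_denominator_pos: "0 < (\<Sum>j\<in>S. exp (score z j x / \<epsilon>))"
  using finite_S S_nonempty by (intro sum_pos) auto

lemma soft_nonneg: "0 \<le> soft \<epsilon> z i x"
  unfolding soft_def using soft_denominator_pos[of z x \<epsilon>] by simp

lemma sum_soft: "(\<Sum>i\<in>S. soft \<epsilon> z i x) = 1"
  unfolding soft_def sum_divide_distrib[symmetric] using soft_denominator_pos[of z x \<epsilon>] by simp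

lemma soft_le_1: "i \<in> S \<Longrightarrow> soft \<epsilon> z i x \<le> 1"
  using sum_soft[of \<epsilon> z x] member_le_sum[of i S "\<lambda>i. soft \<epsilon> z i x"] soft_nonneg finite_S by auto

lemma soft_le_exp:
  assumes "k \<in> S" "0 < \<epsilon>"
  shows "soft \<epsilon> z i x \<le> exp (- (gap z k i x / \<epsilon>))"
proof -
  have "soft \<epsilon> z i x \<le> exp (score z i x / \<epsilon>) / exp (score z k x / \<epsilon>)"
    unfolding soft_def using soft_denominator_pos[of z x \<epsilon>] assms finite_S
    by (intro divide_left_mono member_le_sum mult_pos_pos) auto
  also have "\<dots> = exp (- (gap z k i x / \<epsilon>))"
    by (simp add: exp_diff[symmetric] diff_divide_distrib)
  finally show ?thesis .
qed

text \<open>Cancelling the exponential of score \<open>k\<close> isolates the pair: at the mirror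
  image, with \<open>i\<close> and \<open>k\<close> exchanged, the first exponential is unchanged
  and only the sum over third points differs.\<close>

lemma soft_eq_fraction:
  assumes "i \<in> S" "k \<in> S" "i \<noteq> k"
  shows "soft \<epsilon> z i x = exp (- (gap z k i x / \<epsilon>)) /
    (1 + exp (- (gap z k i x / \<epsilon>)) +
      (\<Sum>l\<in>S - {i, k}. exp (- (gap z k l x / \<epsilon>))))"
proof -
  define e where "e = exp (score z k x / \<epsilon>)"
  have e: "exp (score z j x / \<epsilon>) = e * exp (- (gap z k j x / \<epsilon>))" for j
    by (simp add: e_def mult_exp_exp diff_divide_distrib)
  have "(\<Sum>j\<in>S. exp (- (gap z k j x / \<epsilon>))) =
     (\<Sum>j\<in>{i, k}. exp (- (gap z k j x / \<epsilon>))) +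
     (\<Sum>l\<in>S - {i, k}. exp (- (gap z k l x / \<epsilon>)))"
    by (subst sum.subset_diff[of "{i, k}"]) (use assms finite_S in auto)
  also have "(\<Sum>j\<in>{i, k}. exp (- (gap z k j x / \<epsilon>))) =
     1 + exp (- (gap z k i x / \<epsilon>))"
    using assms by simp
  finally have s: "(\<Sum>j\<in>S. exp (- (gap z k j x / \<epsilon>))) =
    1 + exp (- (gap z k i x / \<epsilon>)) +
      (\<Sum>l\<in>S - {i, k}. exp (- (gap z k l x / \<epsilon>)))" .
  have "e \<noteq> 0" by (simp add: e_def)
  then have "soft \<epsilon> z i x = exp (- (gap z k i x / \<epsilon>)) /
     (\<Sum>j\<in>S. exp (- (gap z k j x / \<epsilon>)))"
    unfolding soft_def e sum_distrib_left[symmetric] by simp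
  then show ?thesis unfolding s .
qed

lemma in_some_cell: "\<exists>k\<in>S. x \<in> cell z k"
proof -
  have "Max ((\<lambda>k. score z k x) ` S) \<in> (\<lambda>k. score z k x) ` S"
    using finite_S S_nonempty by (intro Max_in) auto
  then obtain k where k: "k \<in> S" "score z k x = Max ((\<lambda>k. score z k x) ` S)" by auto
  then have "x \<in> cell z k" using finite_S by (auto simp: cell_def)
  then show ?thesis using k by blast
qed

section \<open>Reflection in the hyperplane where two scores agree\<close>

definition reflect :: "('a \<Rightarrow> real) \<Rightarrow> 'a \<Rightarrow> 'a \<Rightarrow> 'a \<Rightarrow> 'a" where
  "reflect z k i x = x - (2 * (x \<bullet> (k - i) - (z k - z i))) *\<^sub>R ((1 / ((k - i) \<bullet> (k - i))) *\<^sub>R (k - i))"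

lemma reflect_measurable[measurable]: "reflect z k i \<in> borel_measurable borel"
  unfolding reflect_def by measurable

lemma distr_reflect: "k \<noteq> i \<Longrightarrow> distr lborel borel (reflect z k i) = lborel"
  unfolding reflect_def by (rule distr_lborel_oblique_reflection) simp

lemma score_diff_reflect:
  assumes "k \<noteq> i"
  shows "gap z k i (reflect z k i x) = - gap z k i x"
proof -
  define p where "p = (1 / ((k - i) \<bullet> (k - i))) *\<^sub>R (k - i)"
  have p: "p \<bullet> (k - i) = 1" using assms by (simp add: p_def)
  have "reflect z k i x \<bullet> (k - i) = x \<bullet> (k - i) - 2 * (x \<bullet> (k - i) - (z k - z i)) * (p \<bullet> (k - i))"
    unfolding reflect_def p_def[symmetric] by (simp only: inner_diff_left inner_scaleR_left)
  then show ?thesis unfolding score_diff p by simp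
qed

lemma reflect_eq: "reflect z k i x =
    x - (2 * gap z k i x / ((k - i) \<bullet> (k - i))) *\<^sub>R (k - i)"
  unfolding reflect_def score_diff by simp

lemma reflect_swap: "reflect z i k = reflect z k i"
proof
  fix x
  have "2 * gap z i k x / ((i - k) \<bullet> (i - k)) =
      - (2 * gap z k i x / ((k - i) \<bullet> (k - i)))"
  proof -
    have "(i - k) \<bullet> (i - k) = (k - i) \<bullet> (k - i)"
      by (simp add: inner_diff_left inner_diff_right inner_commute)
    moreover have "2 * (gap z i k x) = - (2 * (gap z k i x))" by simp
    ultimately show ?thesis by (simp only: minus_divide_left)
  qed
  moreover have "i - k = - (k - i)" by simp
  ultimately show "reflect z i k x = reflect z k i x"
    unfolding reflect_eq by (simp only: scaleR_minus_left scaleR_minus_right minus_minus)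
qed

lemma reflect_reflect:
  assumes "k \<noteq> i"
  shows "reflect z k i (reflect z k i x) = x"
proof -
  define s where "s = 2 * gap z k i x / ((k - i) \<bullet> (k - i))"
  have "2 * (gap z k i (reflect z k i x)) / ((k - i) \<bullet> (k - i)) = - s"
    unfolding score_diff_reflect[OF assms] s_def by (simp only: minus_divide_left mult_minus_right)
  then have "reflect z k i (reflect z k i x) = reflect z k i x - (- s) *\<^sub>R (k - i)"
    by (subst reflect_eq) simp
  moreover have "reflect z k i x = x - s *\<^sub>R (k - i)" by (subst reflect_eq) (simp add: s_def)
  ultimately show ?thesis by simp
qed

lemma norm_reflect_diff:
  assumes "k \<noteq> i"
  shows "norm (x - reflect z k i x) = 2 * \<bar>score z k x - score z i x\<bar> / norm (k - i)"
proof -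
  define t where "t = gap z k i x"
  have "x - reflect z k i x = (2 * t / ((k - i) \<bullet> (k - i))) *\<^sub>R (k - i)"
    by (simp add: reflect_eq t_def)
  then have "norm (x - reflect z k i x) = \<bar>2 * t\<bar> / (norm (k - i))\<^sup>2 * norm (k - i)"
    by (simp add: power2_norm_eq_inner)
  also have "\<dots> = 2 * \<bar>t\<bar> / norm (k - i)" by (simp add: abs_mult power2_eq_square)
  finally show ?thesis by (simp add: t_def)
qed

text \<open>
  The constant is chosen such that \<open>kap * (t + u) \<le> t\<close> for \<open>t = gap z k i x\<close> and \<open>u = gap z k l x\<close>
  whenever the score of \<open>l\<close> overtakes that of \<open>i\<close> at the reflection of \<open>x\<close>.
\<close>

definition kap :: real where
  "kap = 1 / (2 + (\<Sum>i\<in>S. \<Sum>k\<in>S. \<Sum>l\<in>S. 2 * norm (l - i) / norm (k - i)))"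

lemma kap: "0 < kap" "kap \<le> 1"
  "i \<in> S \<Longrightarrow> k \<in> S \<Longrightarrow> l \<in> S \<Longrightarrow> kap * (2 + 2 * norm (l - i) / norm (k - i)) \<le> 1"
proof -
  let ?s = "\<Sum>i\<in>S. \<Sum>k\<in>S. \<Sum>l\<in>S. 2 * norm (l - i) / norm (k - i)"
  have s: "0 \<le> ?s" by (intro sum_nonneg) auto
  then show p: "0 < kap" "kap \<le> 1" by (auto simp: kap_def)
  assume m: "i \<in> S" "k \<in> S" "l \<in> S"
  have "2 * norm (l - i) / norm (k - i) \<le> (\<Sum>l\<in>S. 2 * norm (l - i) / norm (k - i))"
    using m finite_S by (intro member_le_sum) auto
  also have "\<dots> \<le> (\<Sum>k\<in>S. \<Sum>l\<in>S. 2 * norm (l - i) / norm (k - i))"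
    using m finite_S by (intro member_le_sum[of k S "\<lambda>k. \<Sum>l\<in>S. 2 * norm (l - i) / norm (k - i)"] sum_nonneg) auto
  also have "\<dots> \<le> ?s"
    using m finite_S by (intro member_le_sum[of i S "\<lambda>i. \<Sum>k\<in>S. \<Sum>l\<in>S. 2 * norm (l - i) / norm (k - i)"] sum_nonneg) auto
  finally have "kap * (2 + 2 * norm (l - i) / norm (k - i)) \<le> kap * (2 + ?s)"
    using p by (intro mult_left_mono) auto
  also have "\<dots> = 1" using s by (simp add: kap_def)
  finally show "kap * (2 + 2 * norm (l - i) / norm (k - i)) \<le> 1" .
qed

text \<open>Concentrated where the scores of \<open>k\<close>, \<open>i\<close> and \<open>l\<close>
  nearly agree. The factor \<open>kap\<close> weakens the decay enough to dominate both third-cell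
  errors: products of two relative weights, and weights at points whose mirror image falls into a
  third cell.\<close>

abbreviation pen :: "real \<Rightarrow> ('a \<Rightarrow> real) \<Rightarrow> 'a \<Rightarrow> 'a \<Rightarrow> 'a \<Rightarrow> 'a \<Rightarrow> real" where
  "pen \<epsilon> z k i l x \<equiv> exp (- (kap / \<epsilon> * (gap z k i x + gap z k l x)))"

text \<open>The two ways in which a point of cell \<open>k\<close> can lack a suitable mirror image:
  the image leaves \<open>X\<close>, or a third score is close to the top.\<close>

definition err :: "real \<Rightarrow> ('a \<Rightarrow> real) \<Rightarrow> 'a \<Rightarrow> 'a \<Rightarrow> 'a \<Rightarrow> real" where
  "err \<epsilon> z k i x = indicator (X \<inter> cell z k) x *
     (exp (- (gap z k i x / \<epsilon>)) * indicator (- X) (reflect z k i x) +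
      (\<Sum>l\<in>S - {i, k}. pen \<epsilon> z k i l x))"

lemma err_nonneg: "0 \<le> err \<epsilon> z k i x"
  unfolding err_def by (intro mult_nonneg_nonneg add_nonneg_nonneg sum_nonneg) auto

lemma err_measurable[measurable]: "err \<epsilon> z k i \<in> borel_measurable borel"
  unfolding err_def by measurable

text \<open>With \<open>t\<close> the gap between \<open>k\<close> and \<open>i\<close> at
  \<open>x\<close>: if the mirror image stays in \<open>X\<close>, some third score \<open>l\<close>
  overtakes \<open>i\<close> there; it cannot be \<open>k\<close>, whose gap to \<open>i\<close> has
  changed sign. Reflection moves \<open>x\<close> by \<open>2 * t / norm (k - i)\<close>, so the gap
  of \<open>l\<close> at \<open>x\<close> is already at most a fixed multiple of \<open>t\<close>,
  and the choice of \<open>kap\<close> puts \<open>exp (- (t / \<epsilon>))\<close> below the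
  penalty of \<open>l\<close>.\<close>

lemma soft_le_err:
  assumes i: "i \<in> S" and k: "k \<in> S" and ne: "k \<noteq> i" and \<epsilon>: "0 < \<epsilon>"
    and x: "x \<in> X" "x \<in> cell z k" and r: "\<not> (reflect z k i x \<in> X \<and> reflect z k i x \<in> cell z i)"
  shows "soft \<epsilon> z i x \<le> err \<epsilon> z k i x"
proof (cases "reflect z k i x \<in> X")
  case False
  have "soft \<epsilon> z i x \<le> exp (- (gap z k i x / \<epsilon>))" by (rule soft_le_exp[OF k \<epsilon>])
  also have "\<dots> \<le> err \<epsilon> z k i x" using False x by (simp add: err_def sum_nonneg)
  finally show ?thesis .
next
  case True
  define t where "t = gap z k i x"
  let ?y = "reflect z k i x"
  have t: "0 \<le> t" using cellD[OF x(2) i] by (simp add: t_def)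
  obtain l where l: "l \<in> S" "score z i ?y < score z l ?y" using r True by (auto simp: cell_def not_le)
  have "l \<noteq> i" using l by auto
  moreover have "l \<noteq> k" using l score_diff_reflect[OF ne, of z x] t unfolding t_def by force
  ultimately have l': "l \<in> S - {i, k}" using l by simp
  define u where "u = gap z k l x"
  have u: "0 \<le> u" using cellD[OF x(2) l(1)] by (simp add: u_def)
  have "gap z l i ?y = gap z l i x - (x - ?y) \<bullet> (l - i)"
    unfolding score_diff by (simp add: inner_diff_left)
  also have "\<dots> \<le> (t - u) + norm (x - ?y) * norm (l - i)"
    using Cauchy_Schwarz_ineq2[of "x - ?y" "l - i"] by (simp add: t_def u_def)
  finally have "u < t + norm (x - ?y) * norm (l - i)" using l by simp
  also have "norm (x - ?y) = 2 * t / norm (k - i)"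
    unfolding norm_reflect_diff[OF ne] using t by (simp add: t_def)
  finally have "t + u \<le> t * (2 + 2 * norm (l - i) / norm (k - i))" by (simp add: algebra_simps)
  then have "kap * (t + u) \<le> kap * (t * (2 + 2 * norm (l - i) / norm (k - i)))"
    using kap(1) by (intro mult_left_mono) auto
  also have "\<dots> = t * (kap * (2 + 2 * norm (l - i) / norm (k - i)))" by simp
  also have "\<dots> \<le> t * 1" using kap(3)[OF i k l(1)] t by (intro mult_left_mono) auto
  finally have "kap * (t + u) \<le> t" by simp
  from divide_right_mono[OF this less_imp_le[OF \<epsilon>]]
  have "kap / \<epsilon> * (t + u) \<le> t / \<epsilon>" by simp
  then have "exp (- (t / \<epsilon>)) \<le> exp (- (kap / \<epsilon> * (t + u)))" by simp
  also have "\<dots> \<le> (\<Sum>l\<in>S - {i, k}. pen \<epsilon> z k i l x)"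
    unfolding t_def u_def using l' finite_S
    by (intro member_le_sum[of l _ "\<lambda>l. pen \<epsilon> z k i l x"]) auto
  also have "\<dots> \<le> err \<epsilon> z k i x" using x by (simp add: err_def)
  finally show ?thesis using soft_le_exp[OF k \<epsilon>, of z i x] by (simp add: t_def)
qed

lemma soft_sum_le_err:
  assumes \<epsilon>: "0 < \<epsilon>" and i: "i \<in> S" and x: "x \<in> X" "x \<in> cell z k"
  shows "exp (- (gap z k i x / \<epsilon>)) *
    (\<Sum>l\<in>S - {i, k}. exp (- (gap z k l x / \<epsilon>))) \<le> err \<epsilon> z k i x"
proof -
  have e: "exp (- (a / \<epsilon>)) * exp (- (b / \<epsilon>)) = exp (- (1 / \<epsilon> * (a + b)))" for a b
    by (simp add: mult_exp_exp add_divide_distrib)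
  have "exp (- (gap z k i x / \<epsilon>)) *
    (\<Sum>l\<in>S - {i, k}. exp (- (gap z k l x / \<epsilon>))) =
    (\<Sum>l\<in>S - {i, k}. exp (- (1 / \<epsilon> * (gap z k i x + gap z k l x))))"
    unfolding sum_distrib_left e ..
  also have "\<dots> \<le> (\<Sum>l\<in>S - {i, k}. pen \<epsilon> z k i l x)"
  proof (intro sum_mono)
    fix l assume l: "l \<in> S - {i, k}"
    have "kap / \<epsilon> * (gap z k i x + gap z k l x) \<le>
       1 / \<epsilon> * (gap z k i x + gap z k l x)"
      using kap \<epsilon> cellD[OF x(2) i] cellD[OF x(2), of l] l
      by (intro mult_right_mono divide_right_mono) auto
    then show "exp (- (1 / \<epsilon> * (gap z k i x + gap z k l x))) \<le>
      pen \<epsilon> z k i l x" by simp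
  qed
  also have "\<dots> \<le> err \<epsilon> z k i x" using x by (simp add: err_def)
  finally show ?thesis .
qed

lemma pair_pointwise:
  fixes f z :: "'a \<Rightarrow> real"
  assumes i: "i \<in> S" and k: "k \<in> S" and ne: "k \<noteq> i" and \<epsilon>: "0 < \<epsilon>" and K: "0 \<le> K"
    and f: "\<And>x. x \<in> X \<Longrightarrow> \<bar>f x\<bar> \<le> K"
    and f_holder: "\<And>x y. x \<in> X \<Longrightarrow> y \<in> X \<Longrightarrow> \<bar>f x - f y\<bar> \<le> K * norm (x - y) powr \<alpha>"
  defines "\<tau> \<equiv> reflect z k i"
  shows "\<bar>indicator (X \<inter> cell z k) x * (soft \<epsilon> z i x * f x) -
      indicator (X \<inter> cell z i) (\<tau> x) * (soft \<epsilon> z k (\<tau> x) * f (\<tau> x))\<bar> \<le>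
    K * (indicator {x\<in>X. z k - z i \<le> x \<bullet> (k - i)} x *
           (exp (- (gap z k i x / \<epsilon>)) *
             (2 * gap z k i x / norm (k - i)) powr \<alpha>)
         + err \<epsilon> z k i x + err \<epsilon> z i k (\<tau> x))"
    (is "\<bar>?A x - ?B (\<tau> x)\<bar> \<le> K * (?bulk x + _ + _)")
proof -
  have bulk: "0 \<le> ?bulk x" by (auto split: split_indicator)
  note nn = bulk err_nonneg[of \<epsilon> z k i x] err_nonneg[of \<epsilon> z i k "\<tau> x"]
  consider (both) "x \<in> X \<inter> cell z k" "\<tau> x \<in> X \<inter> cell z i"
    | (left) "x \<in> X \<inter> cell z k" "\<tau> x \<notin> X \<inter> cell z i"
    | (right) "x \<notin> X \<inter> cell z k" "\<tau> x \<in> X \<inter> cell z i"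
    | (none) "x \<notin> X \<inter> cell z k" "\<tau> x \<notin> X \<inter> cell z i" by blast
  then show ?thesis
  proof cases
    case none
    then show ?thesis using nn K by simp
  next
    case left
    have "soft \<epsilon> z i x \<le> err \<epsilon> z k i x"
      by (rule soft_le_err[OF i k ne \<epsilon>]) (use left in \<open>auto simp: \<tau>_def\<close>)
    then have "soft \<epsilon> z i x * \<bar>f x\<bar> \<le> err \<epsilon> z k i x * K"
      using f[of x] left soft_nonneg nn by (intro mult_mono) auto
    also have "\<dots> \<le> K * (?bulk x + err \<epsilon> z k i x + err \<epsilon> z i k (\<tau> x))"
      using nn K by (simp add: mult.commute mult_left_mono)
    finally show ?thesis using left soft_nonneg[of \<epsilon> z i x] by (simp add: abs_mult)
  next
    case right
    have "reflect z i k (\<tau> x) = x" unfolding \<tau>_def reflect_swap[of z i k] by (rule reflect_reflect[OF ne])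
    then have "soft \<epsilon> z k (\<tau> x) \<le> err \<epsilon> z i k (\<tau> x)"
      by (intro soft_le_err[OF k i ne[symmetric] \<epsilon>]) (use right in auto)
    then have "soft \<epsilon> z k (\<tau> x) * \<bar>f (\<tau> x)\<bar> \<le> err \<epsilon> z i k (\<tau> x) * K"
      using f[of "\<tau> x"] right soft_nonneg nn by (intro mult_mono) auto
    also have "\<dots> \<le> K * (?bulk x + err \<epsilon> z k i x + err \<epsilon> z i k (\<tau> x))"
      using nn K by (simp add: mult.commute mult_left_mono)
    finally show ?thesis using right soft_nonneg[of \<epsilon> z k "\<tau> x"] by (simp add: abs_mult)
  next
    case both
    define t where "t = gap z k i x"
    have tt: "gap z i k (\<tau> x) = t"
      using score_diff_reflect[OF ne, of z x] by (simp add: t_def \<tau>_def)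
    have t: "0 \<le> t" using both cellD[of x z k i] i by (auto simp: t_def)
    define a where "a = exp (- (t / \<epsilon>))"
    define g where "g = (\<Sum>l\<in>S - {i, k}. exp (- (gap z k l x / \<epsilon>)))"
    define h where "h = (\<Sum>l\<in>S - {i, k}. exp (- ((gap z i l (\<tau> x)) / \<epsilon>)))"
    have si: "soft \<epsilon> z i x = a / (1 + a + g)"
      using soft_eq_fraction[OF i k ne[symmetric]] by (simp add: a_def g_def t_def)
    have sk: "soft \<epsilon> z k (\<tau> x) = a / (1 + a + h)"
      using soft_eq_fraction[OF k i ne] tt by (simp add: a_def h_def insert_commute)
    have ag: "a * g \<le> err \<epsilon> z k i x"
      using soft_sum_le_err[OF \<epsilon> i, of x z k] both by (simp add: a_def g_def t_def)
    have ah: "a * h \<le> err \<epsilon> z i k (\<tau> x)"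
      using soft_sum_le_err[OF \<epsilon> k, of "\<tau> x" z i] both tt by (simp add: a_def h_def insert_commute)
    have pos: "0 \<le> a" "0 \<le> g" "0 \<le> h" by (auto simp: a_def g_def h_def intro: sum_nonneg)
    have d1: "\<bar>soft \<epsilon> z i x - soft \<epsilon> z k (\<tau> x)\<bar> \<le> err \<epsilon> z k i x + err \<epsilon> z i k (\<tau> x)"
      using fraction_diff_le[OF pos] ag ah unfolding si sk by (simp add: distrib_left)
    have "norm (x - \<tau> x) = 2 * t / norm (k - i)"
      unfolding \<tau>_def norm_reflect_diff[OF ne] using t by (simp add: t_def)
    then have d2: "\<bar>f x - f (\<tau> x)\<bar> \<le> K * (2 * t / norm (k - i)) powr \<alpha>"
      using f_holder[of x "\<tau> x"] both by simp
    have sa: "soft \<epsilon> z i x \<le> a" using soft_le_exp[OF k \<epsilon>, of z i x] by (simp add: a_def t_def)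
    have bulk_eq: "?bulk x = a * (2 * t / norm (k - i)) powr \<alpha>"
      using both t by (simp add: a_def t_def score_diff)
    \<comment> \<open>Product rule: the variation of \<open>f\<close> is multiplied by a softmax
      weight, the variation of the weight by the bound \<open>K\<close>.\<close>
    have "\<bar>?A x - ?B (\<tau> x)\<bar> = \<bar>soft \<epsilon> z i x * (f x - f (\<tau> x)) + (soft \<epsilon> z i x - soft \<epsilon> z k (\<tau> x)) * f (\<tau> x)\<bar>"
      using both by (simp add: algebra_simps)
    also have "\<dots> \<le> soft \<epsilon> z i x * \<bar>f x - f (\<tau> x)\<bar> + \<bar>soft \<epsilon> z i x - soft \<epsilon> z k (\<tau> x)\<bar> * \<bar>f (\<tau> x)\<bar>"
      using soft_nonneg[of \<epsilon> z i x] abs_triangle_ineq by (metis abs_mult abs_of_nonneg)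
    also have "\<dots> \<le> a * (K * (2 * t / norm (k - i)) powr \<alpha>) +
        (err \<epsilon> z k i x + err \<epsilon> z i k (\<tau> x)) * K"
      using sa d1 d2 f[of "\<tau> x"] both pos nn soft_nonneg K by (intro add_mono mult_mono) auto
    also have "\<dots> = K * (?bulk x + err \<epsilon> z k i x + err \<epsilon> z i k (\<tau> x))"
      unfolding bulk_eq by (simp add: algebra_simps)
    finally show ?thesis .
  qed
qed

section \<open>Second-order error terms\<close>

text \<open>Cell \<open>k\<close> lies in the half-space where \<open>k\<close> beats
  \<open>i\<close>. Used for both orders of the pair, this puts mass \<open>c\<close> on each side
  of the separating hyperplane.\<close>

lemma goodD:
  assumes "good c z" "k \<in> S" "i \<in> S"
  shows "c \<le> measure P (cell z k)" "c \<le> measure P {x. z k - z i \<le> x \<bullet> (k - i)}"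
    "c \<le> measure P {x. x \<bullet> (i - k) \<le> z i - z k}"
proof -
  interpret prob_space P by (rule prob_P)
  show c: "c \<le> prob (cell z k)" using assms by (simp add: good_def)
  have *: "0 \<le> x \<bullet> (k - i) - (z k - z i)" if "x \<in> cell z k" for x
    using cellD[OF that assms(3)] unfolding score_diff[symmetric] by simp
  have "prob (cell z k) \<le> prob {x. z k - z i \<le> x \<bullet> (k - i)}"
    by (rule finite_measure_mono) (use * in auto)
  with c show "c \<le> prob {x. z k - z i \<le> x \<bullet> (k - i)}" by simp
  moreover have "{x. z k - z i \<le> x \<bullet> (k - i)} = {x. x \<bullet> (i - k) \<le> z i - z k}"
    by (auto simp: inner_diff_right)
  ultimately show "c \<le> prob {x. x \<bullet> (i - k) \<le> z i - z k}" by simp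
qed

text \<open>A point at gap \<open>t\<close> moves by \<open>2 * t / norm v\<close> under reflection.
  If it leaves \<open>X\<close>, the ball of that radius around it is not contained in
  \<open>X\<close>, so the points with \<open>t \<le> s\<close> form the boundary part of a slab, of
  volume \<open>O(s\<^sup>2)\<close>; the layer-cake bound with \<open>c = 1 / \<epsilon>\<close>
  concludes.\<close>

lemma nn_integral_boundary:
  assumes k: "k \<in> S" and i: "i \<in> S" and ne: "k \<noteq> i" and c: "0 < c"
  obtains C where "0 \<le> C" "\<And>z \<epsilon>. good c z \<Longrightarrow> 0 < \<epsilon> \<Longrightarrow>
    (\<integral>\<^sup>+x. ennreal (exp (- (gap z k i x / \<epsilon>))) *
       indicator {x\<in>X \<inter> cell z k. reflect z k i x \<notin> X} x \<partial>lborel) \<le> ennreal (C * \<epsilon>\<^sup>2)"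
proof -
  define v where "v = k - i"
  have v: "v \<noteq> 0" using ne by (simp add: v_def)
  obtain \<delta> where \<delta>: "0 < \<delta>" and ball: "\<And>b. c \<le> measure P {x. b \<le> x \<bullet> v} \<Longrightarrow>
      c \<le> measure P {x. x \<bullet> v \<le> b} \<Longrightarrow> \<exists>p. p \<bullet> v = b \<and> cball p \<delta> \<subseteq> X"
    by (rule hyperplane_inner_ball[OF v c]) (rule that)
  define D where "D = real DIM('a) * (2 / norm v) / \<delta> * slab_const v"
  have D: "0 \<le> D" using \<delta> slab_const_nonneg[of v] by (simp add: D_def)
  show thesis
  proof (rule that[of "16 * D"])
    show "0 \<le> 16 * D" using D by simp
    fix z \<epsilon> assume z: "good c z" and \<epsilon>: "0 < (\<epsilon>::real)"
    define b where "b = z k - z i"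
    obtain p where p: "p \<bullet> v = b" "cball p \<delta> \<subseteq> X"
      using ball[of b] goodD(2)[OF z k i] goodD(3)[OF z i k] by (auto simp: v_def b_def)
    define t where "t x = gap z k i x" for x
    have t: "t x = x \<bullet> v - b" for x by (simp add: t_def v_def b_def score_diff)
    have [measurable]: "t \<in> borel_measurable borel" unfolding t_def by measurable
    define A where "A = {x\<in>X \<inter> cell z k. reflect z k i x \<notin> X}"
    have [measurable]: "A \<in> sets borel" unfolding A_def by measurable
    have "(\<integral>\<^sup>+x. ennreal (exp (- ((1 / \<epsilon>) * t x))) * indicator A x \<partial>lborel) \<le>
        ennreal (16 * D / (1 / \<epsilon>)\<^sup>2)"
    proof (rule nn_integral_exp_layer_cake)
      show "0 \<le> t x" if "x \<in> A" for x
        using that cellD[of x z k i] i by (auto simp: A_def t_def)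
      fix s :: real assume s: "0 \<le> s"
      show "emeasure lborel {x\<in>A. t x \<le> s} \<le> ennreal (D * s\<^sup>2)"
        unfolding D_def
      proof (rule emeasure_slab_boundary[OF v \<delta> p _ s])
        show "0 < 2 / norm v" using v by simp
        show "{x\<in>A. t x \<le> s} \<in> sets borel" by measurable
        show "{x\<in>A. t x \<le> s} \<subseteq> {x\<in>X. b \<le> x \<bullet> v \<and> x \<bullet> v \<le> b + s \<and> \<not> cball x (2 / norm v * s) \<subseteq> X}"
        proof
          fix x assume x: "x \<in> {x\<in>A. t x \<le> s}"
          then have t0: "0 \<le> t x" "t x \<le> s" using cellD[of x z k i] i by (auto simp: A_def t_def)
          have "dist x (reflect z k i x) = 2 * t x / norm v"
            using norm_reflect_diff[OF ne, of x z] t0 by (simp add: dist_norm t_def v_def)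
          also have "\<dots> \<le> 2 / norm v * s" using t0 v by (simp add: divide_right_mono)
          finally have "reflect z k i x \<in> cball x (2 / norm v * s)" by simp
          then show "x \<in> {x\<in>X. b \<le> x \<bullet> v \<and> x \<bullet> v \<le> b + s \<and> \<not> cball x (2 / norm v * s) \<subseteq> X}"
            using x t0 by (auto simp: A_def t)
        qed
      qed
    qed (use \<epsilon> D in auto)
    then show "(\<integral>\<^sup>+x. ennreal (exp (- (gap z k i x / \<epsilon>))) *
       indicator {x\<in>X \<inter> cell z k. reflect z k i x \<notin> X} x \<partial>lborel) \<le> ennreal (16 * D * \<epsilon>\<^sup>2)"
      by (simp add: A_def t_def power_divide)
  qed
qed

section \<open>Third cells: transversal and collinear triples\<close>

lemma score_affine:
  assumes "m = (1 - \<theta>) *\<^sub>R a + \<theta> *\<^sub>R b"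
  shows "score z m x = (1 - \<theta>) * score z a x + \<theta> * score z b x + ((1 - \<theta>) * z a + \<theta> * z b - z m)"
  unfolding score_def assms by (simp add: inner_add_right algebra_simps)

text \<open>The scores of three collinear points are affinely dependent up to a constant free of
  \<open>x\<close>, so the constant may be evaluated at any point. At a deep point of the middle
  cell the gap to \<open>a\<close> is at least the width and the gap to \<open>b\<close> is
  nonnegative.\<close>

lemma middle_cell_offset:
  assumes m: "m \<in> S" and a: "a \<in> S" and b: "b \<in> S" and ne: "m \<noteq> a"
    and eq: "m = (1 - \<theta>) *\<^sub>R a + \<theta> *\<^sub>R b" and \<theta>: "0 \<le> \<theta>" "\<theta> < 1" and c: "0 < c" and z: "good c z"
  shows "(1 - \<theta>) * width c (m - a) \<le> (1 - \<theta>) * z a + \<theta> * z b - z m"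
proof -
  have v: "m - a \<noteq> 0" using ne by simp
  obtain x where x: "x \<in> cell z m" "z m - z a + width c (m - a) < x \<bullet> (m - a)"
  proof (rule ex_deep_point[OF v c goodD(1)[OF z m a]])
    show "z m - z a \<le> x \<bullet> (m - a)" if "x \<in> cell z m" for x
      using cellD[OF that a] score_diff[of z m x a] by simp
  qed (use that in blast)
  have "width c (m - a) \<le> gap z m a x" using x(2) unfolding score_diff by simp
  then have "(1 - \<theta>) * width c (m - a) \<le> (1 - \<theta>) * gap z m a x"
    using \<theta> by (intro mult_left_mono) auto
  also have "\<dots> \<le> (1 - \<theta>) * gap z m a x + \<theta> * gap z m b x"
    using \<theta> cellD[OF x(1) b] by simp
  also have "\<dots> = (1 - \<theta>) * z a + \<theta> * z b - z m"
    using score_affine[OF eq, of z x] by (simp add: algebra_simps)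
  finally show ?thesis .
qed

text \<open>
  For collinear supporting points the cell of the middle one separates the other two, so near a point
  of \<open>cell z k\<close> at most one of the other two scores is close to the maximum.
\<close>

lemma collinear_gap:
  assumes k: "k \<in> S" and i: "i \<in> S" and l: "l \<in> S" and ne: "k \<noteq> i" "k \<noteq> l" "i \<noteq> l"
    and col: "collinear {0, k - i, k - l}" and c: "0 < c"
  obtains D where "0 < D" "\<And>z x. good c z \<Longrightarrow> x \<in> cell z k \<Longrightarrow>
     D \<le> gap z k i x + gap z k l x"
proof -
  have "collinear {k, i, l}"
  proof -
    have "collinear {0, i - k, l - k}"
      using col collinear_scaleR_iff[of "-1" "k - i" "-1" "k - l"] by simp
    then have "collinear {i, k, l}" by (subst collinear_3) simp
    then show ?thesis by (simp add: insert_commute)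
  qed
  then consider "between (i, l) k" | "between (l, k) i" | "between (k, i) l"
    using collinear_between_cases by blast
  then show thesis
  proof cases
    case 1
    then obtain \<theta> where \<theta>: "0 \<le> \<theta>" "\<theta> \<le> 1" "k = (1 - \<theta>) *\<^sub>R i + \<theta> *\<^sub>R l"
      by (auto simp: between_mem_segment closed_segment_def)
    have t1: "\<theta> < 1" using \<theta> ne by (cases "\<theta> = 1") auto
    show thesis
    proof (rule that[of "(1 - \<theta>) * width c (k - i)"])
      show "0 < (1 - \<theta>) * width c (k - i)" using t1 width_pos[OF c] by simp
      fix z x assume z: "good c z" and x: "x \<in> cell z k"
      let ?t = "gap z k i x" and ?u = "gap z k l x"
      have tu: "0 \<le> ?t" "0 \<le> ?u" using cellD[OF x i] cellD[OF x l] by auto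
      have "(1 - \<theta>) * width c (k - i) \<le> (1 - \<theta>) * z i + \<theta> * z l - z k"
        by (rule middle_cell_offset[OF k i l ne(1) \<theta>(3,1) t1 c z])
      also have "\<dots> = (1 - \<theta>) * ?t + \<theta> * ?u"
        using score_affine[OF \<theta>(3), of z x] by (simp add: algebra_simps)
      also have "\<dots> \<le> 1 * ?t + 1 * ?u" using tu \<theta> by (intro add_mono mult_right_mono) auto
      finally show "(1 - \<theta>) * width c (k - i) \<le> ?t + ?u" by simp
    qed
  next
    case 2
    then obtain \<theta> where \<theta>: "0 \<le> \<theta>" "\<theta> \<le> 1" "i = (1 - \<theta>) *\<^sub>R l + \<theta> *\<^sub>R k"
      by (auto simp: between_mem_segment closed_segment_def)
    have t1: "\<theta> < 1" using \<theta> ne by (cases "\<theta> = 1") auto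
    show thesis
    proof (rule that[of "(1 - \<theta>) * width c (i - l)"])
      show "0 < (1 - \<theta>) * width c (i - l)" using t1 width_pos[OF c] by simp
      fix z x assume z: "good c z" and x: "x \<in> cell z k"
      let ?t = "gap z k i x" and ?u = "gap z k l x"
      have tu: "0 \<le> ?t" "0 \<le> ?u" using cellD[OF x i] cellD[OF x l] by auto
      have "(1 - \<theta>) * width c (i - l) \<le> (1 - \<theta>) * z l + \<theta> * z k - z i"
        by (rule middle_cell_offset[OF i l k ne(3) \<theta>(3,1) t1 c z])
      \<comment> \<open>With \<open>i\<close> in the middle the positive offset is a multiple of
        \<open>?u\<close> minus \<open>?t\<close>, so \<open>?u\<close> by itself is bounded away
        from 0.\<close>
      also have "\<dots> = (1 - \<theta>) * ?u - ?t"
        using score_affine[OF \<theta>(3), of z x] by (simp add: algebra_simps)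
      also have "\<dots> \<le> 1 * ?u + ?t" using mult_right_mono[of "1 - \<theta>" 1 ?u] tu \<theta> by linarith
      finally show "(1 - \<theta>) * width c (i - l) \<le> ?t + ?u" by simp
    qed
  next
    case 3
    then obtain \<theta> where \<theta>: "0 \<le> \<theta>" "\<theta> \<le> 1" "l = (1 - \<theta>) *\<^sub>R i + \<theta> *\<^sub>R k"
      by (auto simp: between_mem_segment closed_segment_def insert_commute)
        (metis add.commute diff_add_cancel add_diff_cancel_left' diff_ge_0_iff_ge)
    have t1: "\<theta> < 1" using \<theta> ne by (cases "\<theta> = 1") auto
    show thesis
    proof (rule that[of "(1 - \<theta>) * width c (l - i)"])
      show "0 < (1 - \<theta>) * width c (l - i)" using t1 width_pos[OF c] by simp
      fix z x assume z: "good c z" and x: "x \<in> cell z k"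
      let ?t = "gap z k i x" and ?u = "gap z k l x"
      have tu: "0 \<le> ?t" "0 \<le> ?u" using cellD[OF x i] cellD[OF x l] by auto
      have "(1 - \<theta>) * width c (l - i) \<le> (1 - \<theta>) * z i + \<theta> * z k - z l"
        by (rule middle_cell_offset[OF l i k ne(3)[symmetric] \<theta>(3,1) t1 c z])
      also have "\<dots> = (1 - \<theta>) * ?t - ?u"
        using score_affine[OF \<theta>(3), of z x] by (simp add: algebra_simps)
      also have "\<dots> \<le> 1 * ?t + ?u" using mult_right_mono[of "1 - \<theta>" 1 ?t] tu \<theta> by linarith
      finally show "(1 - \<theta>) * width c (l - i) \<le> ?t + ?u" by simp
    qed
  qed
qed

text \<open>For non-collinear points the penalty decays in two independent directions, each worth
  one factor \<open>\<epsilon>\<close>. For collinear points the sum of the gaps stays away from 0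
  on the whole cell, so the penalty is exponentially small.\<close>

lemma nn_integral_triple:
  assumes k: "k \<in> S" and i: "i \<in> S" and l: "l \<in> S" and ne: "k \<noteq> i" "k \<noteq> l" "i \<noteq> l"
    and c: "0 < c"
  obtains C where "0 \<le> C" "\<And>z \<epsilon>. good c z \<Longrightarrow> 0 < \<epsilon> \<Longrightarrow>
    (\<integral>\<^sup>+x. ennreal (pen \<epsilon> z k i l x) *
       indicator (X \<inter> cell z k) x \<partial>lborel) \<le> ennreal (C * \<epsilon>\<^sup>2)"
proof (cases "collinear {0, k - i, k - l}")
  case False
  obtain C where C: "0 \<le> C" "\<And>a b c. 0 < c \<Longrightarrow>
     (\<integral>\<^sup>+x. ennreal (exp (- (c * ((x \<bullet> (k - i) - a) + (x \<bullet> (k - l) - b))))) *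
        indicator {x\<in>X. a \<le> x \<bullet> (k - i) \<and> b \<le> x \<bullet> (k - l)} x \<partial>lborel) \<le> ennreal (C / c\<^sup>2)"
    by (rule nn_integral_two_slabs_exp[OF False]) (rule that)
  show thesis
  proof (rule that[of "C / kap\<^sup>2"])
    show "0 \<le> C / kap\<^sup>2" using C by simp
    fix z \<epsilon> assume z: "good c z" and \<epsilon>: "0 < (\<epsilon>::real)"
    have sub: "X \<inter> cell z k \<subseteq> {x\<in>X. z k - z i \<le> x \<bullet> (k - i) \<and> z k - z l \<le> x \<bullet> (k - l)}"
    proof
      fix x assume x: "x \<in> X \<inter> cell z k"
      have "0 \<le> gap z k i x" "0 \<le> gap z k l x"
        using cellD[of x z k] x i l by auto
      then show "x \<in> {x\<in>X. z k - z i \<le> x \<bullet> (k - i) \<and> z k - z l \<le> x \<bullet> (k - l)}"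
        using x unfolding score_diff by auto
    qed
    have "(\<integral>\<^sup>+x. ennreal (pen \<epsilon> z k i l x) *
       indicator (X \<inter> cell z k) x \<partial>lborel) \<le>
      (\<integral>\<^sup>+x. ennreal (exp (- (kap / \<epsilon> * ((x \<bullet> (k - i) - (z k - z i)) + (x \<bullet> (k - l) - (z k - z l)))))) *
        indicator {x\<in>X. z k - z i \<le> x \<bullet> (k - i) \<and> z k - z l \<le> x \<bullet> (k - l)} x \<partial>lborel)"
      unfolding score_diff using sub by (intro nn_integral_mono mult_left_mono) (auto split: split_indicator)
    also have "\<dots> \<le> ennreal (C / (kap / \<epsilon>)\<^sup>2)" by (rule C(2)) (use kap \<epsilon> in auto)
    finally show "(\<integral>\<^sup>+x. ennreal (pen \<epsilon> z k i l x) *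
       indicator (X \<inter> cell z k) x \<partial>lborel) \<le> ennreal (C / kap\<^sup>2 * \<epsilon>\<^sup>2)" by (simp add: power_divide)
  qed
next
  case True
  obtain D where D: "0 < D" "\<And>z x. good c z \<Longrightarrow> x \<in> cell z k \<Longrightarrow>
     D \<le> gap z k i x + gap z k l x"
    by (rule collinear_gap[OF k i l ne True c]) (rule that)
  let ?C = "2 / (kap * D)\<^sup>2 * measure lborel X"
  show thesis
  proof (rule that[of ?C])
    show "0 \<le> ?C" by simp
    fix z \<epsilon> assume z: "good c z" and \<epsilon>: "0 < (\<epsilon>::real)"
    have "(\<integral>\<^sup>+x. ennreal (pen \<epsilon> z k i l x) *
       indicator (X \<inter> cell z k) x \<partial>lborel) \<le>
      (\<integral>\<^sup>+x. ennreal (2 * \<epsilon>\<^sup>2 / (kap * D)\<^sup>2) * indicator X x \<partial>lborel)"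
    proof (intro nn_integral_mono)
      fix x
      show "ennreal (pen \<epsilon> z k i l x) *
        indicator (X \<inter> cell z k) x \<le> ennreal (2 * \<epsilon>\<^sup>2 / (kap * D)\<^sup>2) * indicator X x"
      proof (cases "x \<in> X \<inter> cell z k")
        case x: True
        have "kap / \<epsilon> * D \<le> kap / \<epsilon> * (gap z k i x + gap z k l x)"
          using D(2)[OF z] x kap \<epsilon> by (intro mult_left_mono) auto
        then have "pen \<epsilon> z k i l x \<le>
            exp (- ((kap * D) / \<epsilon>))" by simp
        also have "\<dots> \<le> 2 * \<epsilon>\<^sup>2 / (kap * D)\<^sup>2"
          by (rule exp_minus_le_square) (use kap D \<epsilon> in auto)
        finally show ?thesis using x by (simp add: ennreal_leI)
      qed simp
    qed
    also have "\<dots> = ennreal (2 * \<epsilon>\<^sup>2 / (kap * D)\<^sup>2) * emeasure lborel X"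
      by (rule nn_integral_cmult_indicator) simp
    also have "\<dots> = ennreal (?C * \<epsilon>\<^sup>2)"
      unfolding finite_volume[OF order_refl] by (simp add: ennreal_mult[symmetric] mult_ac)
    finally show "(\<integral>\<^sup>+x. ennreal (pen \<epsilon> z k i l x) *
       indicator (X \<inter> cell z k) x \<partial>lborel) \<le> ennreal (?C * \<epsilon>\<^sup>2)" .
  qed
qed

lemma nn_integral_err:
  assumes k: "k \<in> S" and i: "i \<in> S" and ne: "k \<noteq> i" and c: "0 < c"
  obtains C where "0 \<le> C" "\<And>z \<epsilon>. good c z \<Longrightarrow> 0 < \<epsilon> \<Longrightarrow>
    (\<integral>\<^sup>+x. ennreal (err \<epsilon> z k i x) \<partial>lborel) \<le> ennreal (C * \<epsilon>\<^sup>2)"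
proof -
  obtain B where B: "0 \<le> B" "\<And>z \<epsilon>. good c z \<Longrightarrow> 0 < \<epsilon> \<Longrightarrow>
    (\<integral>\<^sup>+x. ennreal (exp (- (gap z k i x / \<epsilon>))) *
       indicator {x\<in>X \<inter> cell z k. reflect z k i x \<notin> X} x \<partial>lborel) \<le> ennreal (B * \<epsilon>\<^sup>2)"
    by (rule nn_integral_boundary[OF k i ne c]) (rule that)
  define bound where "bound l C \<longleftrightarrow> 0 \<le> C \<and> (\<forall>z \<epsilon>. good c z \<longrightarrow> 0 < \<epsilon> \<longrightarrow>
    (\<integral>\<^sup>+x. ennreal (pen \<epsilon> z k i l x) *
       indicator (X \<inter> cell z k) x \<partial>lborel) \<le> ennreal (C * \<epsilon>\<^sup>2))" for l C
  have "\<exists>C. bound l C" if l: "l \<in> S - {i, k}" for l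
  proof -
    have l': "l \<in> S" "k \<noteq> l" "i \<noteq> l" using l by auto
    show ?thesis unfolding bound_def by (rule nn_integral_triple[OF k i l'(1) ne l'(2,3) c]) blast
  qed
  then obtain C where "\<forall>l\<in>S - {i, k}. bound l (C l)" using bchoice[of "S - {i, k}" bound] by blast
  then have C: "\<And>l. l \<in> S - {i, k} \<Longrightarrow> 0 \<le> C l"
    "\<And>l z \<epsilon>. l \<in> S - {i, k} \<Longrightarrow> good c z \<Longrightarrow> 0 < \<epsilon> \<Longrightarrow>
    (\<integral>\<^sup>+x. ennreal (pen \<epsilon> z k i l x) *
       indicator (X \<inter> cell z k) x \<partial>lborel) \<le> ennreal (C l * \<epsilon>\<^sup>2)" by (auto simp: bound_def)
  show thesis
  proof (rule that[of "B + (\<Sum>l\<in>S - {i, k}. C l)"])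
    show "0 \<le> B + (\<Sum>l\<in>S - {i, k}. C l)" using B(1) by (intro add_nonneg_nonneg sum_nonneg C(1))
    fix z \<epsilon> assume z: "good c z" and \<epsilon>: "0 < (\<epsilon>::real)"
    have "(\<integral>\<^sup>+x. ennreal (err \<epsilon> z k i x) \<partial>lborel) =
      (\<integral>\<^sup>+x. ennreal (exp (- (gap z k i x / \<epsilon>))) *
         indicator {x\<in>X \<inter> cell z k. reflect z k i x \<notin> X} x +
        (\<Sum>l\<in>S - {i, k}. ennreal (pen \<epsilon> z k i l x) *
       indicator (X \<inter> cell z k) x) \<partial>lborel)"
    proof (intro nn_integral_cong)
      fix x
      show "ennreal (err \<epsilon> z k i x) = ennreal (exp (- (gap z k i x / \<epsilon>))) *
         indicator {x\<in>X \<inter> cell z k. reflect z k i x \<notin> X} x +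
        (\<Sum>l\<in>S - {i, k}. ennreal (pen \<epsilon> z k i l x) *
       indicator (X \<inter> cell z k) x)"
      proof (cases "x \<in> X \<inter> cell z k")
        case True
        then have "ennreal (err \<epsilon> z k i x) = ennreal (exp (- (gap z k i x / \<epsilon>)) * indicator (- X) (reflect z k i x)) +
          ennreal (\<Sum>l\<in>S - {i, k}. pen \<epsilon> z k i l x)"
          unfolding err_def by (simp add: ennreal_plus sum_nonneg)
        also have "ennreal (\<Sum>l\<in>S - {i, k}. pen \<epsilon> z k i l x) =
          (\<Sum>l\<in>S - {i, k}. ennreal (pen \<epsilon> z k i l x) *
             indicator (X \<inter> cell z k) x)"
          using True by (simp add: sum_ennreal)
        finally show ?thesis using True by (simp add: indicator_def)
      qed (auto simp: err_def)
    qed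
    also have "\<dots> = (\<integral>\<^sup>+x. ennreal (exp (- (gap z k i x / \<epsilon>))) *
         indicator {x\<in>X \<inter> cell z k. reflect z k i x \<notin> X} x \<partial>lborel) +
        (\<Sum>l\<in>S - {i, k}. \<integral>\<^sup>+x. ennreal (pen \<epsilon> z k i l x) *
       indicator (X \<inter> cell z k) x \<partial>lborel)"
      by (subst nn_integral_add, measurable, subst nn_integral_sum, measurable)
    also have "\<dots> \<le> ennreal (B * \<epsilon>\<^sup>2) + (\<Sum>l\<in>S - {i, k}. ennreal (C l * \<epsilon>\<^sup>2))"
      by (intro add_mono sum_mono B C z \<epsilon>)
    also have "(\<Sum>l\<in>S - {i, k}. ennreal (C l * \<epsilon>\<^sup>2)) = ennreal ((\<Sum>l\<in>S - {i, k}. C l) * \<epsilon>\<^sup>2)"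
      using C(1) by (subst sum_ennreal) (auto simp: sum_distrib_right)
    also have "ennreal (B * \<epsilon>\<^sup>2) + \<dots> = ennreal ((B + (\<Sum>l\<in>S - {i, k}. C l)) * \<epsilon>\<^sup>2)"
      using B(1) sum_nonneg[OF C(1), of "S - {i, k}"]
      by (subst ennreal_plus[symmetric]) (auto simp: algebra_simps)
    finally show "(\<integral>\<^sup>+x. ennreal (err \<epsilon> z k i x) \<partial>lborel) \<le> ennreal ((B + (\<Sum>l\<in>S - {i, k}. C l)) * \<epsilon>\<^sup>2)" .
  qed
qed

text \<open>The slab integral of \<open>exp (- (t / \<epsilon>))\<close> gives one power of
  \<open>\<epsilon>\<close> and the Hoelder factor gives \<open>\<alpha>\<close> more. The constant
  4 is 2 from absorbing the power and 2 from the halved decay rate.\<close>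

lemma nn_integral_bulk:
  assumes ne: "k \<noteq> i" and \<epsilon>: "0 < \<epsilon>" and \<alpha>: "0 < \<alpha>" "\<alpha> \<le> 1"
  shows "(\<integral>\<^sup>+x. ennreal (indicator {x\<in>X. z k - z i \<le> x \<bullet> (k - i)} x *
           (exp (- (gap z k i x / \<epsilon>)) *
             (2 * gap z k i x / norm (k - i)) powr \<alpha>)) \<partial>lborel) \<le>
     ennreal ((2 / norm (k - i)) powr \<alpha> * 4 * slab_const (k - i) * \<epsilon> powr (1 + \<alpha>))"
proof -
  define v where "v = k - i"
  define b where "b = z k - z i"
  have v: "v \<noteq> 0" using ne by (simp add: v_def)
  let ?N = "2 * (2 / norm v) powr \<alpha> * \<epsilon> powr \<alpha>"
  have "(\<integral>\<^sup>+x. ennreal (indicator {x\<in>X. b \<le> x \<bullet> v} x *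
           (exp (- ((x \<bullet> v - b) / \<epsilon>)) * (2 * (x \<bullet> v - b) / norm v) powr \<alpha>)) \<partial>lborel) \<le>
     (\<integral>\<^sup>+x. ennreal ?N * (ennreal (exp (- ((1 / (2 * \<epsilon>)) * (x \<bullet> v - b)))) * indicator {x\<in>X. b \<le> x \<bullet> v} x) \<partial>lborel)"
  proof (intro nn_integral_mono)
    fix x
    show "ennreal (indicator {x\<in>X. b \<le> x \<bullet> v} x *
           (exp (- ((x \<bullet> v - b) / \<epsilon>)) * (2 * (x \<bullet> v - b) / norm v) powr \<alpha>)) \<le>
      ennreal ?N * (ennreal (exp (- ((1 / (2 * \<epsilon>)) * (x \<bullet> v - b)))) * indicator {x\<in>X. b \<le> x \<bullet> v} x)"
    proof (cases "x \<in> {x\<in>X. b \<le> x \<bullet> v}")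
      case True
      define t where "t = x \<bullet> v - b"
      have t: "0 \<le> t" using True by (simp add: t_def)
      have "exp (- (t / \<epsilon>)) * (2 * t / norm v) powr \<alpha> = (2 / norm v) powr \<alpha> * (t powr \<alpha> * exp (- (t / \<epsilon>)))"
        using t powr_mult[of "2 / norm v" t \<alpha>] by simp
      also have "\<dots> \<le> (2 / norm v) powr \<alpha> * (2 * \<epsilon> powr \<alpha> * exp (- (t / (2 * \<epsilon>))))"
        by (intro mult_left_mono powr_mult_exp_le t \<epsilon> \<alpha>) auto
      finally have "exp (- (t / \<epsilon>)) * (2 * t / norm v) powr \<alpha> \<le> ?N * exp (- ((1 / (2 * \<epsilon>)) * t))" by simp
      then show ?thesis using True
        by (simp only: t_def[symmetric] indicator_simps mult_1 mult_1_right)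
          (subst ennreal_mult[symmetric], auto intro: ennreal_leI)
    qed simp
  qed
  also have "\<dots> = ennreal ?N * (\<integral>\<^sup>+x. ennreal (exp (- ((1 / (2 * \<epsilon>)) * (x \<bullet> v - b)))) * indicator {x\<in>X. b \<le> x \<bullet> v} x \<partial>lborel)"
    by (rule nn_integral_cmult) measurable
  also have "\<dots> \<le> ennreal ?N * ennreal (slab_const v / (1 / (2 * \<epsilon>)))"
    by (intro mult_left_mono nn_integral_slab_exp v) (use \<epsilon> in auto)
  also have "\<dots> = ennreal ((2 / norm v) powr \<alpha> * 4 * slab_const v * \<epsilon> powr (1 + \<alpha>))"
    using \<epsilon> slab_const_nonneg[of v] by (simp add: ennreal_mult[symmetric] powr_add mult_ac)
  finally show ?thesis by (simp add: v_def b_def score_diff)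
qed

section \<open>Softmax weights against cells\<close>

lemma integrable_on_X:
  fixes f :: "'a \<Rightarrow> real"
  assumes [measurable]: "f \<in> borel_measurable borel" and K: "\<And>x. \<bar>f x\<bar> \<le> K * indicator X x"
  shows "integrable lborel f"
proof (rule Bochner_Integration.integrable_bound)
  show "integrable lborel (\<lambda>x. K * indicator X x :: real)"
    using fmeasurable_X_Int[of UNIV] by simp
  show "AE x in lborel. norm (f x) \<le> norm (K * indicator X x :: real)"
    using K by (intro AE_I2) (smt (verit) real_norm_def)
qed simp

lemma integrable_P:
  fixes f :: "'a \<Rightarrow> real"
  assumes [measurable]: "f \<in> borel_measurable borel" and K: "\<And>x. x \<in> X \<Longrightarrow> \<bar>f x\<bar> \<le> K"
  shows "integrable P f"
proof -
  interpret prob_space P by (rule prob_P)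
  show ?thesis
    by (rule integrable_const_bound[of _ K]) (use AE_X K in \<open>auto elim!: eventually_mono\<close>)
qed

text \<open>One number \<open>K\<close> serves as bound and as Hoelder constant, so that later
  estimates are linear in \<open>K\<close>. The intended instances are the density and its products
  with the components of a test map along support points.\<close>

definition test_function :: "real \<Rightarrow> real \<Rightarrow> ('a \<Rightarrow> real) \<Rightarrow> bool" where
  "test_function \<alpha> K f \<longleftrightarrow> f \<in> borel_measurable borel \<and> (\<forall>x\<in>X. \<bar>f x\<bar> \<le> K) \<and>
     (\<forall>x\<in>X. \<forall>y\<in>X. \<bar>f x - f y\<bar> \<le> K * norm (x - y) powr \<alpha>)"

lemma test_functionD:
  assumes "test_function \<alpha> K f"
  shows "f \<in> borel_measurable borel" "x \<in> X \<Longrightarrow> \<bar>f x\<bar> \<le> K"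
    "x \<in> X \<Longrightarrow> y \<in> X \<Longrightarrow> \<bar>f x - f y\<bar> \<le> K * norm (x - y) powr \<alpha>" "0 \<le> K"
  using assms X_nonempty unfolding test_function_def by (auto intro: order_trans[OF abs_ge_zero])

text \<open>Net exchange between two cells, taken with respect to Lebesgue measure because that is
  what reflections preserve; the density is meant to be a factor of \<open>f\<close>.\<close>

abbreviation transfer_defect :: "real \<Rightarrow> ('a \<Rightarrow> real) \<Rightarrow> 'a \<Rightarrow> 'a \<Rightarrow> ('a \<Rightarrow> real) \<Rightarrow> real" where
  "transfer_defect \<epsilon> z k i f \<equiv> (\<integral>x. indicator (X \<inter> cell z k) x * (soft \<epsilon> z i x * f x) \<partial>lborel) -
     (\<integral>x. indicator (X \<inter> cell z i) x * (soft \<epsilon> z k x * f x) \<partial>lborel)"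

abbreviation soft_defect :: "real \<Rightarrow> ('a \<Rightarrow> real) \<Rightarrow> 'a \<Rightarrow> ('a \<Rightarrow> real) \<Rightarrow> real" where
  "soft_defect \<epsilon> z i f \<equiv>
     \<bar>\<integral>x. indicator X x * ((soft \<epsilon> z i x - indicator (cell z i) x) * f x) \<partial>lborel\<bar>"

lemma pair_integral:
  assumes i: "i \<in> S" and k: "k \<in> S" and ne: "k \<noteq> i" and c: "0 < c" and \<alpha>: "0 < \<alpha>" "\<alpha> \<le> 1"
  obtains C where "0 \<le> C" "\<And>z \<epsilon> K f. good c z \<Longrightarrow> 0 < \<epsilon> \<Longrightarrow> \<epsilon> \<le> 1 \<Longrightarrow> test_function \<alpha> K f \<Longrightarrow>
     \<bar>transfer_defect \<epsilon> z k i f\<bar> \<le> C * K * \<epsilon> powr (1 + \<alpha>)"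
proof -
  obtain C1 where C1: "0 \<le> C1" "\<And>z \<epsilon>. good c z \<Longrightarrow> 0 < \<epsilon> \<Longrightarrow>
    (\<integral>\<^sup>+x. ennreal (err \<epsilon> z k i x) \<partial>lborel) \<le> ennreal (C1 * \<epsilon>\<^sup>2)"
    by (rule nn_integral_err[OF k i ne c]) (rule that)
  obtain C2 where C2: "0 \<le> C2" "\<And>z \<epsilon>. good c z \<Longrightarrow> 0 < \<epsilon> \<Longrightarrow>
    (\<integral>\<^sup>+x. ennreal (err \<epsilon> z i k x) \<partial>lborel) \<le> ennreal (C2 * \<epsilon>\<^sup>2)"
    by (rule nn_integral_err[OF i k ne[symmetric] c]) (rule that)
  define C0 where "C0 = (2 / norm (k - i)) powr \<alpha> * 4 * slab_const (k - i)"
  have C0: "0 \<le> C0" using slab_const_nonneg by (simp add: C0_def)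
  show thesis
  proof (rule that[of "C0 + C1 + C2"])
    show "0 \<le> C0 + C1 + C2" using C0 C1 C2 by simp
    fix z f :: "'a \<Rightarrow> real" and \<epsilon> K :: real
    assume z: "good c z" and \<epsilon>: "0 < \<epsilon>" "\<epsilon> \<le> 1" and tf: "test_function \<alpha> K f"
    note [measurable] = test_functionD(1)[OF tf]
    note f = test_functionD(2)[OF tf] and holder = test_functionD(3)[OF tf] and K = test_functionD(4)[OF tf]
    define A where "A x = indicator (X \<inter> cell z k) x * (soft \<epsilon> z i x * f x)" for x
    define B where "B x = indicator (X \<inter> cell z i) x * (soft \<epsilon> z k x * f x)" for x
    define \<tau> where "\<tau> = reflect z k i"
    have [measurable]: "A \<in> borel_measurable borel" "B \<in> borel_measurable borel" "\<tau> \<in> borel_measurable borel"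
      unfolding A_def B_def \<tau>_def by measurable
    have bound: "\<bar>soft \<epsilon> z j x * f x\<bar> \<le> K" if "j \<in> S" "x \<in> X" for j x
      using mult_mono[OF soft_le_1[OF that(1), of \<epsilon> z x] f[OF that(2)]] soft_nonneg[of \<epsilon> z j x] K
      by (simp add: abs_mult)
    have intA: "integrable lborel A"
      by (rule integrable_on_X[of _ K]) (use bound[OF i] K in \<open>auto simp: A_def split: split_indicator\<close>)
    have intB: "integrable lborel B"
      by (rule integrable_on_X[of _ K]) (use bound[OF k] K in \<open>auto simp: B_def split: split_indicator\<close>)
    have d: "distr lborel borel \<tau> = lborel" unfolding \<tau>_def by (rule distr_reflect[OF ne])
    \<comment> \<open>Reflecting the second integral brings both integrands to the same side of the
      hyperplane, where they cancel pointwise up to the error terms.\<close>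
    have B\<tau>: "(\<integral>x. B x \<partial>lborel) = (\<integral>x. B (\<tau> x) \<partial>lborel)"
      by (subst d[symmetric], rule integral_distr) auto
    have intB\<tau>: "integrable lborel (\<lambda>x. B (\<tau> x))"
      using integrable_distr_eq[of \<tau> lborel borel B] intB by (simp add: d)
    let ?bulk = "\<lambda>x. indicator {x\<in>X. z k - z i \<le> x \<bullet> (k - i)} x *
           (exp (- (gap z k i x / \<epsilon>)) *
             (2 * gap z k i x / norm (k - i)) powr \<alpha>) :: real"
    have "ennreal \<bar>(\<integral>x. A x \<partial>lborel) - (\<integral>x. B x \<partial>lborel)\<bar> = ennreal (norm (\<integral>x. A x - B (\<tau> x) \<partial>lborel))"
      unfolding B\<tau> using intA intB\<tau> by simp
    also have "\<dots> \<le> (\<integral>\<^sup>+x. norm (A x - B (\<tau> x)) \<partial>lborel)"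
      using intA intB\<tau> by (intro integral_norm_bound_ennreal) simp
    also have "\<dots> \<le> (\<integral>\<^sup>+x. ennreal K * (ennreal (?bulk x) + ennreal (err \<epsilon> z k i x) + ennreal (err \<epsilon> z i k (\<tau> x))) \<partial>lborel)"
    proof (intro nn_integral_mono)
      fix x
      have b: "0 \<le> ?bulk x" by (auto split: split_indicator)
      have "norm (A x - B (\<tau> x)) \<le> K * (?bulk x + err \<epsilon> z k i x + err \<epsilon> z i k (\<tau> x))"
        unfolding A_def B_def \<tau>_def real_norm_def by (rule pair_pointwise[OF i k ne \<epsilon>(1) K f holder])
      then have "ennreal (norm (A x - B (\<tau> x))) \<le> ennreal (K * (?bulk x + err \<epsilon> z k i x + err \<epsilon> z i k (\<tau> x)))"
        by (rule ennreal_leI)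
      also have "\<dots> = ennreal K * ennreal (?bulk x + err \<epsilon> z k i x + err \<epsilon> z i k (\<tau> x))"
        using K b err_nonneg by (intro ennreal_mult add_nonneg_nonneg) auto
      also have "ennreal (?bulk x + err \<epsilon> z k i x + err \<epsilon> z i k (\<tau> x)) =
          ennreal (?bulk x) + ennreal (err \<epsilon> z k i x) + ennreal (err \<epsilon> z i k (\<tau> x))"
        using b err_nonneg by (simp only: ennreal_plus add_nonneg_nonneg)
      finally show "ennreal (norm (A x - B (\<tau> x))) \<le>
        ennreal K * (ennreal (?bulk x) + ennreal (err \<epsilon> z k i x) + ennreal (err \<epsilon> z i k (\<tau> x)))" .
    qed
    also have "\<dots> = ennreal K * ((\<integral>\<^sup>+x. ennreal (?bulk x) \<partial>lborel) + (\<integral>\<^sup>+x. ennreal (err \<epsilon> z k i x) \<partial>lborel) +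
        (\<integral>\<^sup>+x. ennreal (err \<epsilon> z i k (\<tau> x)) \<partial>lborel))"
      by (subst nn_integral_cmult, measurable, subst nn_integral_add, measurable, subst nn_integral_add, measurable)
    also have "(\<integral>\<^sup>+x. ennreal (err \<epsilon> z i k (\<tau> x)) \<partial>lborel) = (\<integral>\<^sup>+x. ennreal (err \<epsilon> z i k x) \<partial>distr lborel borel \<tau>)"
      by (subst nn_integral_distr) auto
    also have "\<dots> = (\<integral>\<^sup>+x. ennreal (err \<epsilon> z i k x) \<partial>lborel)" unfolding d ..
    also have "ennreal K * ((\<integral>\<^sup>+x. ennreal (?bulk x) \<partial>lborel) + (\<integral>\<^sup>+x. ennreal (err \<epsilon> z k i x) \<partial>lborel) +
        (\<integral>\<^sup>+x. ennreal (err \<epsilon> z i k x) \<partial>lborel)) \<le>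
      ennreal K * (ennreal (C0 * \<epsilon> powr (1 + \<alpha>)) + ennreal (C1 * \<epsilon>\<^sup>2) + ennreal (C2 * \<epsilon>\<^sup>2))"
      unfolding C0_def
      by (intro mult_left_mono add_mono nn_integral_bulk[OF ne \<epsilon>(1) \<alpha>] C1(2)[OF z \<epsilon>(1)] C2(2)[OF z \<epsilon>(1)]) simp
    also have "\<dots> = ennreal (K * (C0 * \<epsilon> powr (1 + \<alpha>) + C1 * \<epsilon>\<^sup>2 + C2 * \<epsilon>\<^sup>2))"
      using K C0 C1 C2 by (simp add: ennreal_mult)
    also have "\<dots> \<le> ennreal ((C0 + C1 + C2) * K * \<epsilon> powr (1 + \<alpha>))"
    proof (intro ennreal_leI)
      \<comment> \<open>The second-order terms are absorbed into
        \<open>\<epsilon> powr (1 + \<alpha>)\<close> because \<open>\<epsilon>\<close> and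
        \<open>\<alpha>\<close> are at most 1.\<close>
      have "\<epsilon>\<^sup>2 = \<epsilon> powr 2" using \<epsilon> by simp
      also have "\<dots> \<le> \<epsilon> powr (1 + \<alpha>)" using \<epsilon> \<alpha> by (intro powr_mono') auto
      finally have "C0 * \<epsilon> powr (1 + \<alpha>) + C1 * \<epsilon>\<^sup>2 + C2 * \<epsilon>\<^sup>2 \<le>
          C0 * \<epsilon> powr (1 + \<alpha>) + C1 * \<epsilon> powr (1 + \<alpha>) + C2 * \<epsilon> powr (1 + \<alpha>)"
        using C0 C1(1) C2(1) by (intro add_mono mult_left_mono) auto
      from mult_left_mono[OF this K]
      show "K * (C0 * \<epsilon> powr (1 + \<alpha>) + C1 * \<epsilon>\<^sup>2 + C2 * \<epsilon>\<^sup>2) \<le> (C0 + C1 + C2) * K * \<epsilon> powr (1 + \<alpha>)"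
        by (simp add: algebra_simps)
    qed
    finally have "\<bar>(\<integral>x. A x \<partial>lborel) - (\<integral>x. B x \<partial>lborel)\<bar> \<le> (C0 + C1 + C2) * K * \<epsilon> powr (1 + \<alpha>)"
      using C0 C1 C2 K by (subst (asm) ennreal_le_iff) auto
    then show "\<bar>transfer_defect \<epsilon> z k i f\<bar> \<le> (C0 + C1 + C2) * K * \<epsilon> powr (1 + \<alpha>)"
      unfolding A_def B_def .
  qed
qed

section \<open>From exchanges between pairs to single cells\<close>

lemma AE_unique_cell_lborel:
  "AE x in lborel. x \<in> X \<longrightarrow> (\<forall>i\<in>S. \<forall>j\<in>S. x \<in> cell z i \<longrightarrow> x \<in> cell z j \<longrightarrow> i = j)"
proof -
  have "AE x in lborel. x \<in> X \<longrightarrow> x \<in> cell z i \<longrightarrow> x \<in> cell z j \<longrightarrow> i = j" if ij: "i \<in> S" "j \<in> S" for i j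
  proof (cases "i = j")
    case False
    \<comment> \<open>Points where two scores are both maximal lie in a slab of thickness 0.\<close>
    have "emeasure lborel {x\<in>X. z i - z j \<le> x \<bullet> (i - j) \<and> x \<bullet> (i - j) \<le> z i - z j + 0} \<le> ennreal (slab_const (i - j) * 0)"
      by (rule emeasure_slab) (use False in auto)
    then have "{x\<in>X. z i - z j \<le> x \<bullet> (i - j) \<and> x \<bullet> (i - j) \<le> z i - z j} \<in> null_sets lborel"
      by (intro null_setsI) auto
    then show ?thesis
    proof (rule AE_I')
      show "{x \<in> space lborel. \<not> (x \<in> X \<longrightarrow> x \<in> cell z i \<longrightarrow> x \<in> cell z j \<longrightarrow> i = j)} \<subseteq>
        {x\<in>X. z i - z j \<le> x \<bullet> (i - j) \<and> x \<bullet> (i - j) \<le> z i - z j}"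
      proof
        fix x assume x: "x \<in> {x \<in> space lborel. \<not> (x \<in> X \<longrightarrow> x \<in> cell z i \<longrightarrow> x \<in> cell z j \<longrightarrow> i = j)}"
        then have "score z i x = score z j x" using cellD[of x z i j] cellD[of x z j i] ij by auto
        then show "x \<in> {x\<in>X. z i - z j \<le> x \<bullet> (i - j) \<and> x \<bullet> (i - j) \<le> z i - z j}"
          using score_diff[of z i x j] x by auto
      qed
    qed
  qed simp
  then have "AE x in lborel. \<forall>i\<in>S. \<forall>j\<in>S. x \<in> X \<longrightarrow> x \<in> cell z i \<longrightarrow> x \<in> cell z j \<longrightarrow> i = j"
    using finite_S by (intro AE_finite_allI) auto
  then show ?thesis by (rule eventually_mono) blast
qed

lemma AE_unique_cell: "AE x in P. \<forall>i\<in>S. \<forall>j\<in>S. x \<in> cell z i \<longrightarrow> x \<in> cell z j \<longrightarrow> i = j"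
proof -
  have "AE x in P. x \<in> X \<longrightarrow> (\<forall>i\<in>S. \<forall>j\<in>S. x \<in> cell z i \<longrightarrow> x \<in> cell z j \<longrightarrow> i = j)"
    unfolding P_density using AE_unique_cell_lborel[of z] by (subst AE_density) (auto elim!: eventually_mono)
  with AE_X show ?thesis by eventually_elim blast
qed

lemma sum_indicator_cell:
  fixes h :: "'a \<Rightarrow> real"
  assumes "\<forall>i\<in>S. \<forall>j\<in>S. x \<in> cell z i \<longrightarrow> x \<in> cell z j \<longrightarrow> i = j" "k \<in> S" "x \<in> cell z k"
  shows "(\<Sum>i\<in>S. h i * indicator (cell z i) x) = h k"
proof -
  have "(\<Sum>i\<in>S. h i * indicator (cell z i) x) = (\<Sum>i\<in>S. if i = k then h i else 0)"
    using assms by (intro sum.cong) (auto split: split_indicator)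
  then show ?thesis using assms finite_S by simp
qed

text \<open>Softmax weights sum to one and, away from ties, so do cell indicators. Multiplying each
  term on the left by the other sum and cancelling \<open>k = i\<close> turns the difference into
  antisymmetric exchanges between pairs, to which reflection applies.\<close>

lemma soft_minus_cell:
  assumes u: "\<forall>i\<in>S. \<forall>j\<in>S. x \<in> cell z i \<longrightarrow> x \<in> cell z j \<longrightarrow> i = j" and i: "i \<in> S"
  shows "soft \<epsilon> z i x - indicator (cell z i) x =
    (\<Sum>k\<in>S - {i}. indicator (cell z k) x * soft \<epsilon> z i x - indicator (cell z i) x * soft \<epsilon> z k x)"
proof -
  obtain m where m: "m \<in> S" "x \<in> cell z m" using in_some_cell by blast
  have ind: "indicator (cell z k) x = (if k = m then 1 else 0 :: real)" if "k \<in> S" for k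
    using u m that by (auto split: split_indicator)
  have s: "(\<Sum>k\<in>S - {i}. soft \<epsilon> z k x) = 1 - soft \<epsilon> z i x"
    using sum_soft[of \<epsilon> z x] i finite_S by (simp add: sum_diff1)
  have "(\<Sum>k\<in>S - {i}. indicator (cell z k) x * soft \<epsilon> z i x) = (if m = i then 0 else soft \<epsilon> z i x)"
  proof -
    have "(\<Sum>k\<in>S - {i}. indicator (cell z k) x * soft \<epsilon> z i x) = (\<Sum>k\<in>S - {i}. if k = m then soft \<epsilon> z i x else 0)"
      by (intro sum.cong) (auto simp: ind)
    then show ?thesis using m finite_S by (auto simp: sum.delta)
  qed
  then show ?thesis
    by (simp add: sum_subtractf sum_distrib_left[symmetric] s ind[OF i])
qed

lemma soft_hard_estimate:
  assumes i: "i \<in> S" and c: "0 < c" and \<alpha>: "0 < \<alpha>" "\<alpha> \<le> 1"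
  obtains C where "0 \<le> C" "\<And>z \<epsilon> K f. good c z \<Longrightarrow> 0 < \<epsilon> \<Longrightarrow> \<epsilon> \<le> 1 \<Longrightarrow> test_function \<alpha> K f \<Longrightarrow>
     soft_defect \<epsilon> z i f \<le> C * K * \<epsilon> powr (1 + \<alpha>)"
proof -
  define bound where "bound k C \<longleftrightarrow> 0 \<le> C \<and> (\<forall>z \<epsilon> K f. good c z \<longrightarrow> 0 < \<epsilon> \<longrightarrow> \<epsilon> \<le> 1 \<longrightarrow> test_function \<alpha> K f \<longrightarrow>
     \<bar>transfer_defect \<epsilon> z k i f\<bar> \<le> C * K * \<epsilon> powr (1 + \<alpha>))" for k C
  have "\<exists>C. bound k C" if k: "k \<in> S - {i}" for k
  proof -
    have k': "k \<in> S" "k \<noteq> i" using k by auto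
    show ?thesis unfolding bound_def by (rule pair_integral[OF i k' c \<alpha>]) blast
  qed
  then obtain C where C: "\<forall>k\<in>S - {i}. bound k (C k)" using bchoice[of "S - {i}" bound] by blast
  show thesis
  proof (rule that[of "\<Sum>k\<in>S - {i}. C k"])
    show "0 \<le> (\<Sum>k\<in>S - {i}. C k)" using C by (intro sum_nonneg) (auto simp: bound_def)
    fix z f :: "'a \<Rightarrow> real" and \<epsilon> K :: real
    assume z: "good c z" and \<epsilon>: "0 < \<epsilon>" "\<epsilon> \<le> 1" and tf: "test_function \<alpha> K f"
    note [measurable] = test_functionD(1)[OF tf]
    note f = test_functionD(2)[OF tf] and holder = test_functionD(3)[OF tf] and K = test_functionD(4)[OF tf]
    define A where "A k j x = indicator (X \<inter> cell z k) x * (soft \<epsilon> z j x * f x)" for k j x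
    have [measurable]: "A k j \<in> borel_measurable borel" for k j unfolding A_def by measurable
    have int: "integrable lborel (A k j)" if "j \<in> S" for k j
    proof (rule integrable_on_X[of _ K])
      show "\<bar>A k j x\<bar> \<le> K * indicator X x" for x
        using mult_mono[OF soft_le_1[OF that, of \<epsilon> z x] f[of x]] soft_nonneg[of \<epsilon> z j x] K
        by (auto simp: A_def abs_mult split: split_indicator)
    qed simp
    have "(\<integral>x. indicator X x * ((soft \<epsilon> z i x - indicator (cell z i) x) * f x) \<partial>lborel) =
      (\<integral>x. (\<Sum>k\<in>S - {i}. A k i x - A i k x) \<partial>lborel)"
    proof (rule integral_cong_AE)
      show "AE x in lborel. indicator X x * ((soft \<epsilon> z i x - indicator (cell z i) x) * f x) =
        (\<Sum>k\<in>S - {i}. A k i x - A i k x)"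
        using AE_unique_cell_lborel[of z]
      proof eventually_elim
        case (elim x)
        show ?case
        proof (cases "x \<in> X")
          case True
          have "(soft \<epsilon> z i x - indicator (cell z i) x) * f x =
            (\<Sum>k\<in>S - {i}. (indicator (cell z k) x * soft \<epsilon> z i x - indicator (cell z i) x * soft \<epsilon> z k x) * f x)"
            unfolding sum_distrib_right[symmetric]
            by (rule arg_cong[where f = "\<lambda>t. t * f x"], rule soft_minus_cell[OF _ i]) (use elim True in blast)
          also have "\<dots> = (\<Sum>k\<in>S - {i}. A k i x - A i k x)"
            using True by (intro sum.cong) (auto simp: A_def left_diff_distrib split: split_indicator)
          finally show ?thesis using True by simp
        qed (simp add: A_def)
      qed
    qed measurable
    also have "\<dots> = (\<Sum>k\<in>S - {i}. (\<integral>x. A k i x \<partial>lborel) - (\<integral>x. A i k x \<partial>lborel))"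
      using int i by (subst Bochner_Integration.integral_sum) auto
    also have "\<bar>\<dots>\<bar> \<le> (\<Sum>k\<in>S - {i}. \<bar>(\<integral>x. A k i x \<partial>lborel) - (\<integral>x. A i k x \<partial>lborel)\<bar>)"
      by (rule sum_abs)
    also have "\<dots> \<le> (\<Sum>k\<in>S - {i}. C k * K * \<epsilon> powr (1 + \<alpha>))"
    proof (intro sum_mono)
      fix k assume "k \<in> S - {i}"
      then have "bound k (C k)" using C by blast
      then show "\<bar>(\<integral>x. A k i x \<partial>lborel) - (\<integral>x. A i k x \<partial>lborel)\<bar> \<le> C k * K * \<epsilon> powr (1 + \<alpha>)"
        using z \<epsilon> tf unfolding bound_def A_def by simp
    qed
    also have "\<dots> = (\<Sum>k\<in>S - {i}. C k) * K * \<epsilon> powr (1 + \<alpha>)"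
      by (simp add: sum_distrib_right)
    finally show "soft_defect \<epsilon> z i f \<le>
      (\<Sum>k\<in>S - {i}. C k) * K * \<epsilon> powr (1 + \<alpha>)" .
  qed
qed

text \<open>Taking absolute values of the pairwise exchanges gives up the cancellation and one order
  in \<open>\<epsilon>\<close>, but the bound holds for arbitrary potentials. It serves to show that
  cells of an entropic potential retain mass.\<close>

lemma soft_hard_crude:
  assumes i: "i \<in> S"
  obtains C where "0 \<le> C" "\<And>z \<epsilon>. 0 < \<epsilon> \<Longrightarrow>
     \<bar>(\<integral>x. soft \<epsilon> z i x \<partial>P) - measure P (cell z i)\<bar> \<le> C * \<epsilon>"
proof -
  interpret prob_space P by (rule prob_P)
  define C where "C = \<rho>max * (\<Sum>k\<in>S - {i}. slab_const (k - i) + slab_const (i - k))"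
  have C: "0 \<le> C" unfolding C_def using \<rho>_bounds(4) slab_const_nonneg by (intro mult_nonneg_nonneg sum_nonneg add_nonneg_nonneg) auto
  show thesis
  proof (rule that[OF C])
    fix z :: "'a \<Rightarrow> real" and \<epsilon> :: real assume \<epsilon>: "0 < \<epsilon>"
    define E where "E k j x = ennreal (exp (- ((1 / \<epsilon>) * (x \<bullet> (k - j) - (z k - z j))))) *
        indicator {x\<in>X. z k - z j \<le> x \<bullet> (k - j)} x" for k j x
    have [measurable]: "E k j \<in> borel_measurable borel" for k j unfolding E_def by measurable
    have E: "(\<integral>\<^sup>+x. E k j x \<partial>P) \<le> ennreal (\<rho>max * slab_const (k - j) * \<epsilon>)" if "k \<noteq> j" for k j
    proof -
      have "(\<integral>\<^sup>+x. E k j x \<partial>P) = (\<integral>\<^sup>+x. ennreal (\<rho> x) * (E k j x * indicator X x) \<partial>lborel)"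
        by (rule nn_integral_P) simp
      also have "\<dots> \<le> (\<integral>\<^sup>+x. ennreal \<rho>max * E k j x \<partial>lborel)"
        using \<rho>_bounds by (intro nn_integral_mono) (auto simp: E_def intro!: mult_right_mono ennreal_leI split: split_indicator)
      also have "\<dots> = ennreal \<rho>max * (\<integral>\<^sup>+x. E k j x \<partial>lborel)" by (rule nn_integral_cmult) simp
      also have "\<dots> \<le> ennreal \<rho>max * ennreal (slab_const (k - j) / (1 / \<epsilon>))"
        unfolding E_def by (intro mult_left_mono nn_integral_slab_exp) (use that \<epsilon> in auto)
      also have "\<dots> = ennreal (\<rho>max * slab_const (k - j) * \<epsilon>)"
        using \<rho>_bounds(4) \<epsilon> slab_const_nonneg by (simp add: ennreal_mult[symmetric] mult_ac)
      finally show ?thesis .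
    qed
    have E': "ennreal (indicator (cell z k) x * soft \<epsilon> z j x) \<le> E k j x" if "x \<in> X" "k \<in> S" "j \<in> S" for k j x
    proof (cases "x \<in> cell z k")
      case True
      then have "0 \<le> gap z k j x" using cellD that by fastforce
      moreover have "soft \<epsilon> z j x \<le> exp (- (gap z k j x / \<epsilon>))" by (rule soft_le_exp[OF that(2) \<epsilon>])
      ultimately show ?thesis using True that(1)
        by (auto simp: E_def score_diff intro!: ennreal_leI)
    qed simp
    have int: "integrable P (\<lambda>x. soft \<epsilon> z i x - indicator (cell z i) x)"
    proof (rule integrable_P[of _ 1])
      show "\<bar>soft \<epsilon> z i x - indicator (cell z i) x\<bar> \<le> 1" for x
        using soft_le_1[OF i, of \<epsilon> z x] soft_nonneg[of \<epsilon> z i x] by (simp split: split_indicator)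
    qed measurable
    have "(\<integral>x. soft \<epsilon> z i x \<partial>P) - measure P (cell z i) = (\<integral>x. soft \<epsilon> z i x - indicator (cell z i) x \<partial>P)"
    proof -
      have "integrable P (soft \<epsilon> z i)" by (rule integrable_P[of _ 1]) (use soft_le_1[OF i, of \<epsilon> z] soft_nonneg[of \<epsilon> z i] in auto)
      moreover have "integrable P (indicat_real (cell z i))"
        by (rule integrable_P[of _ 1]) (auto split: split_indicator)
      ultimately show ?thesis by simp
    qed
    then have "ennreal \<bar>(\<integral>x. soft \<epsilon> z i x \<partial>P) - measure P (cell z i)\<bar> \<le>
        (\<integral>\<^sup>+x. norm (soft \<epsilon> z i x - indicator (cell z i) x) \<partial>P)"
      using integral_norm_bound_ennreal[OF int] by simp
    also have "\<dots> \<le> (\<integral>\<^sup>+x. (\<Sum>k\<in>S - {i}. E k i x + E i k x) \<partial>P)"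
    proof (rule nn_integral_mono_AE)
      show "AE x in P. ennreal (norm (soft \<epsilon> z i x - indicator (cell z i) x)) \<le> (\<Sum>k\<in>S - {i}. E k i x + E i k x)"
        using AE_unique_cell[of z] AE_X
      proof eventually_elim
        case (elim x)
        have "norm (soft \<epsilon> z i x - indicator (cell z i) x) \<le>
          (\<Sum>k\<in>S - {i}. indicator (cell z k) x * soft \<epsilon> z i x + indicator (cell z i) x * soft \<epsilon> z k x)"
          unfolding soft_minus_cell[OF elim(1) i] real_norm_def
          by (rule order_trans[OF sum_abs]) (intro sum_mono order_trans[OF abs_triangle_ineq4], simp add: abs_mult soft_nonneg)
        then have "ennreal (norm (soft \<epsilon> z i x - indicator (cell z i) x)) \<le>
          ennreal (\<Sum>k\<in>S - {i}. indicator (cell z k) x * soft \<epsilon> z i x + indicator (cell z i) x * soft \<epsilon> z k x)"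
          by (rule ennreal_leI)
        also have "\<dots> = (\<Sum>k\<in>S - {i}. ennreal (indicator (cell z k) x * soft \<epsilon> z i x) + ennreal (indicator (cell z i) x * soft \<epsilon> z k x))"
          using soft_nonneg by (subst sum_ennreal[symmetric]) (auto intro!: sum.cong ennreal_plus)
        also have "\<dots> \<le> (\<Sum>k\<in>S - {i}. E k i x + E i k x)"
          using elim i by (intro sum_mono add_mono E') auto
        finally show ?case .
      qed
    qed
    also have "\<dots> = (\<Sum>k\<in>S - {i}. (\<integral>\<^sup>+x. E k i x \<partial>P) + (\<integral>\<^sup>+x. E i k x \<partial>P))"
      by (subst nn_integral_sum, measurable) (auto intro!: sum.cong nn_integral_add)
    also have "\<dots> \<le> (\<Sum>k\<in>S - {i}. ennreal (\<rho>max * slab_const (k - i) * \<epsilon>) + ennreal (\<rho>max * slab_const (i - k) * \<epsilon>))"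
      by (intro sum_mono add_mono E) auto
    also have "\<dots> = (\<Sum>k\<in>S - {i}. ennreal (\<rho>max * (slab_const (k - i) + slab_const (i - k)) * \<epsilon>))"
      using \<rho>_bounds(4) \<epsilon> slab_const_nonneg
      by (intro sum.cong refl, subst ennreal_plus[symmetric]) (auto simp: algebra_simps)
    also have "\<dots> = ennreal (C * \<epsilon>)"
      unfolding C_def using \<rho>_bounds(4) \<epsilon> slab_const_nonneg
      by (subst sum_ennreal) (auto simp: sum_distrib_left sum_distrib_right)
    finally show "\<bar>(\<integral>x. soft \<epsilon> z i x \<partial>P) - measure P (cell z i)\<bar> \<le> C * \<epsilon>"
      using C \<epsilon> by (subst (asm) ennreal_le_iff) auto
  qed
qed

end

section \<open>Stability of potentials\<close>

lemma Max_diff_le: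
  fixes f g :: "'b \<Rightarrow> real"
  assumes "finite A" "A \<noteq> {}" "\<And>a. a \<in> A \<Longrightarrow> \<bar>f a - g a\<bar> \<le> M"
  shows "\<bar>Max (f ` A) - Max (g ` A)\<bar> \<le> M"
proof -
  have "Max (f ` A) \<le> Max (g ` A) + M" if "\<And>a. a \<in> A \<Longrightarrow> \<bar>f a - g a\<bar> \<le> M" for f g :: "'b \<Rightarrow> real"
  proof -
    note le = that
    have "f a \<le> Max (g ` A) + M" if a: "a \<in> A" for a
    proof -
      have "g a \<le> Max (g ` A)" using a assms(1) by (intro Max_ge) auto
      with le[OF a] show ?thesis by linarith
    qed
    then show ?thesis using assms(1,2) by (subst Max_le_iff) auto
  qed
  from this[of f g] this[of g f] assms(3) show ?thesis by (simp add: abs_le_iff abs_minus_commute)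
qed

text \<open>Pigeonhole: the range between \<open>h a\<close> and \<open>h b\<close> is cut into
  \<open>card A\<close> disjoint open intervals of equal length. The value \<open>h a\<close> is in
  none of them, so the other \<open>card A - 1\<close> values cannot meet them all.\<close>

lemma ex_value_gap:
  fixes h :: "'b \<Rightarrow> real"
  assumes fin: "finite A" and a: "a \<in> A" and b: "b \<in> A"
    and min: "\<And>y. y \<in> A \<Longrightarrow> h a \<le> h y" and lt: "h a < h b"
  obtains t \<eta> where "\<eta> = (h b - h a) / card A" "h a \<le> t" "t + \<eta> \<le> h b"
    "\<And>y. y \<in> A \<Longrightarrow> h y \<le> t \<or> t + \<eta> \<le> h y"
proof -
  define n where "n = card A"
  define \<eta> where "\<eta> = (h b - h a) / n"
  have n: "0 < n" using fin a by (auto simp: n_def card_gt_0_iff)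
  have \<eta>: "0 < \<eta>" using lt n by (simp add: \<eta>_def)
  have "\<exists>j<n. \<forall>y\<in>A. h y \<le> h a + j * \<eta> \<or> h a + (real j + 1) * \<eta> \<le> h y"
  proof (rule ccontr)
    assume "\<not> ?thesis"
    then have "\<forall>j\<in>{..<n}. \<exists>y\<in>A. h a + j * \<eta> < h y \<and> h y < h a + (real j + 1) * \<eta>"
      by (simp add: not_le)
    then obtain y where y: "\<forall>j\<in>{..<n}. y j \<in> A \<and> h a + j * \<eta> < h (y j) \<and> h (y j) < h a + (real j + 1) * \<eta>"
      using bchoice[of "{..<n}" "\<lambda>j y. y \<in> A \<and> h a + j * \<eta> < h y \<and> h y < h a + (real j + 1) * \<eta>"] by blast
    have "inj_on y {..<n}"
    proof (rule inj_onI)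
      fix i j assume ij: "i \<in> {..<n}" "j \<in> {..<n}" "y i = y j"
      have "real i * \<eta> < (real j + 1) * \<eta>" "real j * \<eta> < (real i + 1) * \<eta>"
        using y[rule_format, OF ij(1)] y[rule_format, OF ij(2)] ij(3) by auto
      then have "real i < real j + 1" "real j < real i + 1" using \<eta> by (simp_all only: mult_less_cancel_right_pos)
      then show "i = j" by linarith
    qed
    then have "card (y ` {..<n}) = n" by (simp add: card_image)
    moreover have "y ` {..<n} \<subseteq> A - {a}"
    proof
      fix x assume "x \<in> y ` {..<n}"
      then obtain j where j: "j \<in> {..<n}" "x = y j" by blast
      have "0 \<le> real j * \<eta>" using \<eta> by simp
      then have "h a < h (y j)" using y[rule_format, OF j(1)] by linarith
      then show "x \<in> A - {a}" using y[rule_format, OF j(1)] j by auto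
    qed
    ultimately have "n \<le> card (A - {a})" using card_mono[of "A - {a}" "y ` {..<n}"] fin by simp
    then show False using n a fin by (simp add: n_def)
  qed
  then obtain j where j: "j < n" "\<forall>y\<in>A. h y \<le> h a + j * \<eta> \<or> h a + (real j + 1) * \<eta> \<le> h y" by blast
  show thesis
  proof (rule that[of \<eta> "h a + j * \<eta>"])
    show "\<eta> = (h b - h a) / card A" by (simp add: \<eta>_def n_def)
    show "h a \<le> h a + j * \<eta>" using \<eta> by simp
    have "(real j + 1) * \<eta> \<le> n * \<eta>" using j \<eta> by (intro mult_right_mono) auto
    also have "\<dots> = h b - h a" using n by (simp add: \<eta>_def)
    finally show "h a + j * \<eta> + \<eta> \<le> h b" by (simp add: algebra_simps)
    show "h y \<le> h a + j * \<eta> \<or> h a + j * \<eta> + \<eta> \<le> h y" if "y \<in> A" for y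
      using j(2) that by (auto simp: algebra_simps)
  qed
qed

section \<open>Mass of strips between groups of cells\<close>

context semidiscrete
begin

definition topscore :: "('a \<Rightarrow> real) \<Rightarrow> 'a set \<Rightarrow> 'a \<Rightarrow> real" where
  "topscore z A x = Max ((\<lambda>y. score z y x) ` A)"

lemma topscore_measurable[measurable]: "finite A \<Longrightarrow> topscore z A \<in> borel_measurable borel"
  unfolding topscore_def by (rule borel_measurable_Max) auto

text \<open>The sum of the norms bounds the Lipschitz constant of each \<open>topscore\<close>; it
  is doubled for a difference of two, and 1 is added to have a positive number even if
  \<open>S\<close> contains only the origin.\<close>

definition Lip :: real where "Lip = 2 * (\<Sum>y\<in>S. norm y) + 1"

lemma topscore_lipschitz:
  assumes "A \<subseteq> S" "A \<noteq> {}"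
  shows "\<bar>topscore z A x - topscore z A x'\<bar> \<le> (\<Sum>y\<in>S. norm y) * norm (x - x')"
  unfolding topscore_def
proof (rule Max_diff_le)
  show "finite A" using assms finite_S finite_subset by blast
  fix y assume y: "y \<in> A"
  have "score z y x - score z y x' = (x - x') \<bullet> y" by (simp add: score_def inner_diff_left)
  also have "\<bar>\<dots>\<bar> \<le> norm (x - x') * norm y" by (rule Cauchy_Schwarz_ineq2)
  also have "\<dots> \<le> norm (x - x') * (\<Sum>y\<in>S. norm y)"
    using y assms finite_S by (intro mult_left_mono member_le_sum) auto
  finally show "\<bar>score z y x - score z y x'\<bar> \<le> (\<Sum>y\<in>S. norm y) * norm (x - x')"
    by (simp add: mult.commute)
qed (use assms in auto)

text \<open>With \<open>B = S - A\<close>, the points won by the group \<open>A\<close> with a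
  margin below \<open>\<eta>\<close>: they change hands when the potentials of \<open>A\<close> rise
  by \<open>\<eta>\<close> relative to the others.\<close>

abbreviation strip :: "('a \<Rightarrow> real) \<Rightarrow> 'a set \<Rightarrow> 'a set \<Rightarrow> real \<Rightarrow> 'a set" where
  "strip z A B \<eta> \<equiv> {x. 0 \<le> topscore z A x - topscore z B x \<and> topscore z A x - topscore z B x < \<eta>}"

text \<open>A cell of each group has mass at least \<open>c\<close>, hence a definite volume. If the
  region won by \<open>A\<close> with margin at least \<open>\<eta>\<close> is still large, the
  strip separates two large sets and isoperimetry gives it volume proportional to
  \<open>\<eta>\<close>; otherwise the strip itself takes up at least half of the volume won by
  \<open>A\<close>.\<close>

lemma level_strip_mass:
  assumes c: "0 < c"
  obtains \<kappa> v where "0 < \<kappa>" "0 < v" "\<And>z A B \<eta>. good c z \<Longrightarrow> A \<subseteq> S \<Longrightarrow> B \<subseteq> S \<Longrightarrow> A \<noteq> {} \<Longrightarrow> B \<noteq> {} \<Longrightarrow> 0 < \<eta> \<Longrightarrow>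
     min v (\<kappa> * \<eta>) \<le> measure P (strip z A B \<eta>)"
proof -
  interpret prob_space P by (rule prob_P)
  define w where "w = c / \<rho>max"
  have w: "0 < w" using c \<rho>_bounds(4) by (simp add: w_def)
  have L: "0 < Lip" by (simp add: Lip_def add_nonneg_pos sum_nonneg)
  define V where "V = measure lborel X"
  obtain q r where q: "0 < r" "cball q r \<subseteq> X" by (rule ex_inner_ball)
  have V: "0 < V"
  proof -
    have "0 < measure lborel (cball q r)" using q by (simp add: content_cball_pos)
    also have "\<dots> \<le> V" unfolding V_def
      by (rule measure_mono_fmeasurable[OF q(2)]) (use fmeasurable_X_Int[of UNIV] in \<open>auto simp: fmeasurable_def\<close>)
    finally show ?thesis .
  qed
  \<comment> \<open>The isoperimetric constant for two sets of volumes \<open>w\<close> and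
    \<open>w / 2\<close> and a layer of height \<open>\<eta> / 2\<close>.\<close>
  define \<kappa>0 where "\<kappa>0 = w * (w / 2) / (Lip * (2 * rad) * 2 * (2 ^ DIM('a) * V))"
  have \<kappa>0: "0 < \<kappa>0" using w L rad V by (simp add: \<kappa>0_def)
  show thesis
  proof (rule that[of "\<rho>min * \<kappa>0" "\<rho>min * (w / 2)"])
    show "0 < \<rho>min * \<kappa>0" "0 < \<rho>min * (w / 2)" using \<rho>_bounds(1) \<kappa>0 w by auto
    fix z A B and \<eta> :: real
    assume z: "good c z" and AB: "A \<subseteq> S" "B \<subseteq> S" "A \<noteq> {}" "B \<noteq> {}" and \<eta>: "0 < \<eta>"
    have fin: "finite A" "finite B" using AB finite_S finite_subset by auto
    define G where "G x = topscore z A x - topscore z B x" for x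
    have G[measurable]: "G \<in> borel_measurable borel" unfolding G_def using fin by measurable
    have lip: "\<bar>G x - G y\<bar> \<le> Lip * norm (x - y)" for x y
      using topscore_lipschitz[OF AB(1,3), of z x y] topscore_lipschitz[OF AB(2,4), of z x y]
      unfolding G_def Lip_def
      by (simp add: distrib_right add_increasing2 abs_le_iff)
    have mass: "w \<le> measure lborel (X \<inter> T)" if T[measurable]: "T \<in> sets borel" and k: "k \<in> S" and sub: "cell z k \<subseteq> T" for T k
    proof -
      have "c \<le> prob (cell z k)" using z k by (simp add: good_def)
      also have "\<dots> \<le> prob T" by (rule finite_measure_mono[OF sub]) simp
      also have "\<dots> \<le> \<rho>max * measure lborel (X \<inter> T)" by (rule measure_P_le[OF T])
      finally show ?thesis using \<rho>_bounds(4) by (simp add: w_def field_simps)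
    qed
    obtain a b where a: "a \<in> A" and b: "b \<in> B" using AB by blast
    have "cell z a \<subseteq> {x. 0 \<le> G x}"
    proof
      fix x assume x: "x \<in> cell z a"
      have "score z a x \<le> topscore z A x" unfolding topscore_def using a fin by (intro Max_ge) auto
      moreover have "topscore z B x \<le> score z a x" unfolding topscore_def
        using fin AB cellD[OF x] by (subst Max_le_iff) auto
      ultimately show "x \<in> {x. 0 \<le> G x}" by (simp add: G_def)
    qed
    then have m1: "w \<le> measure lborel (X \<inter> {x. 0 \<le> G x})" by (rule mass[rotated 2]) (use a AB in auto)
    \<comment> \<open>On this cell only \<open>G x \<le> 0\<close> is known. Starting the layer at
      \<open>\<eta> / 2\<close> yields the strict inequality in the isoperimetric statement and uses
      half of the strip.\<close>
    have sub2: "cell z b \<subseteq> {x. G x - \<eta> / 2 < 0}"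
    proof
      fix x assume x: "x \<in> cell z b"
      have "score z b x \<le> topscore z B x" unfolding topscore_def using b fin by (intro Max_ge) auto
      moreover have "topscore z A x \<le> score z b x" unfolding topscore_def
        using fin AB cellD[OF x] by (subst Max_le_iff) auto
      ultimately show "x \<in> {x. G x - \<eta> / 2 < 0}" using \<eta> by (simp add: G_def)
    qed
    then have m2: "w \<le> measure lborel (X \<inter> {x. G x - \<eta> / 2 < 0})" by (rule mass[rotated 2]) (use b AB in auto)
    define T where "T = X \<inter> {x. 0 \<le> G x \<and> G x < \<eta>}"
    have fm: "X \<inter> T \<in> fmeasurable lborel" if "T \<in> sets borel" for T
      using fmeasurable_X_Int[OF that] that by (simp add: fmeasurable_def)
    have T_fm: "T \<in> fmeasurable lborel" unfolding T_def by (rule fm) measurable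
    have key: "min (w / 2) (\<kappa>0 * \<eta>) \<le> measure lborel T"
    proof (cases "w / 2 \<le> measure lborel (X \<inter> {x. \<eta> \<le> G x})")
      case False
      have "X \<inter> {x. 0 \<le> G x} = T \<union> (X \<inter> {x. \<eta> \<le> G x})" using \<eta> by (auto simp: T_def)
      then have "measure lborel (X \<inter> {x. 0 \<le> G x}) \<le> measure lborel T + measure lborel (X \<inter> {x. \<eta> \<le> G x})"
        using measure_Un_le[of T lborel "X \<inter> {x. \<eta> \<le> G x}"] T_fm fm[of "{x. \<eta> \<le> G x}"]
        by (simp add: fmeasurable_def)
      with m1 False show ?thesis by simp
    next
      case True
      let ?D = "measure lborel {x\<in>X. G x - \<eta> / 2 < 0}" and ?E = "measure lborel {x\<in>X. \<eta> / 2 \<le> G x - \<eta> / 2}"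
      have iso: "?D * ?E * ((\<eta> / 2) / (Lip * (2 * rad))) \<le>
        2 ^ DIM('a) * measure lborel X * measure lborel {x\<in>X. 0 \<le> G x - \<eta> / 2 \<and> G x - \<eta> / 2 < \<eta> / 2}"
        using lip \<eta> L by (intro isoperimetric) auto
      have e: "{x\<in>X. G x - \<eta> / 2 < 0} = X \<inter> {x. G x - \<eta> / 2 < 0}"
        "{x\<in>X. \<eta> / 2 \<le> G x - \<eta> / 2} = X \<inter> {x. \<eta> \<le> G x}" by auto
      have "w * (w / 2) \<le> ?D * ?E" unfolding e using m2 True w by (intro mult_mono) auto
      then have "w * (w / 2) * ((\<eta> / 2) / (Lip * (2 * rad))) \<le> ?D * ?E * ((\<eta> / 2) / (Lip * (2 * rad)))"
        using \<eta> L rad by (intro mult_right_mono) auto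
      also note iso
      also have "measure lborel {x\<in>X. 0 \<le> G x - \<eta> / 2 \<and> G x - \<eta> / 2 < \<eta> / 2} \<le> measure lborel T"
        by (rule measure_mono_fmeasurable[OF _ _ T_fm]) (use \<eta> in \<open>auto simp: T_def\<close>)
      finally have "w * (w / 2) * ((\<eta> / 2) / (Lip * (2 * rad))) \<le> (2 ^ DIM('a) * V) * measure lborel T"
        unfolding V_def by (simp add: mult_left_mono)
      then have "w * (w / 2) * ((\<eta> / 2) / (Lip * (2 * rad))) / (2 ^ DIM('a) * V) \<le> measure lborel T"
        using V by (subst pos_divide_le_eq) (auto simp: mult.commute)
      moreover have "w * (w / 2) * ((\<eta> / 2) / (Lip * (2 * rad))) / (2 ^ DIM('a) * V) = \<kappa>0 * \<eta>"
        by (simp add: \<kappa>0_def)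
      ultimately show ?thesis by simp
    qed
    have "min (\<rho>min * (w / 2)) (\<rho>min * \<kappa>0 * \<eta>) = \<rho>min * min (w / 2) (\<kappa>0 * \<eta>)"
      using \<rho>_bounds(1) by (simp add: min_mult_distrib_left)
    also have "\<dots> \<le> \<rho>min * measure lborel T" using key \<rho>_bounds(1) by (intro mult_left_mono) auto
    also have "\<dots> \<le> measure P {x. 0 \<le> G x \<and> G x < \<eta>}" unfolding T_def by (rule measure_P_ge) measurable
    finally show "min (\<rho>min * (w / 2)) (\<rho>min * \<kappa>0 * \<eta>) \<le>
       measure P (strip z A B \<eta>)"
      by (simp add: G_def)
  qed
qed

text \<open>Quantitative monotonicity of a subgradient. Let \<open>h = z' - z\<close>. If
  \<open>i\<close> wins at \<open>x\<close> under \<open>z\<close> and \<open>j\<close> under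
  \<open>z'\<close>, then \<open>h j \<le> h i\<close>. On the strip the winner even leaves
  \<open>A\<close>, since its margin is less than the relative rise of the potentials of
  \<open>A\<close>, so \<open>h i - h j\<close> is at least \<open>\<eta>\<close>. Integration
  yields the claim.\<close>

lemma cell_mass_monotone:
  assumes A: "A \<subseteq> S" "A \<noteq> {}" "A \<noteq> S" and \<eta>: "0 < \<eta>"
    and gap: "\<And>a b. a \<in> A \<Longrightarrow> b \<in> S - A \<Longrightarrow> z' b - z b + \<eta> \<le> z' a - z a"
  shows "\<eta> * measure P (strip z A (S - A) \<eta>) \<le>
     (\<Sum>i\<in>S. (z' i - z i) * (measure P (cell z i) - measure P (cell z' i)))"
proof -
  interpret prob_space P by (rule prob_P)
  define h where "h i = z' i - z i" for i
  have fin: "finite A" "finite (S - A)" using A finite_S finite_subset by auto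
  have B: "S - A \<noteq> {}" using A by auto
  define T where "T = (strip z A (S - A) \<eta>)"
  have [measurable]: "T \<in> sets borel" unfolding T_def using fin by measurable
  have int: "integrable P (\<lambda>x. h i * indicator (cell y i) x)" for i y
    by (rule integrable_P[of _ "\<bar>h i\<bar>"]) (auto split: split_indicator)
  have eq: "(\<integral>x. (\<Sum>i\<in>S. h i * indicator (cell y i) x) \<partial>P) = (\<Sum>i\<in>S. h i * measure P (cell y i))" for y
    using int by (subst Bochner_Integration.integral_sum) auto
  have "\<eta> * measure P T = (\<integral>x. \<eta> * indicator T x \<partial>P)" by simp
  also have "\<dots> \<le> (\<integral>x. (\<Sum>i\<in>S. h i * indicator (cell z i) x) - (\<Sum>i\<in>S. h i * indicator (cell z' i) x) \<partial>P)"
  proof (rule integral_mono_AE)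
    show "integrable P (\<lambda>x. \<eta> * indicator T x)" by (rule integrable_P[of _ "\<bar>\<eta>\<bar>"]) (auto split: split_indicator)
    show "integrable P (\<lambda>x. (\<Sum>i\<in>S. h i * indicator (cell z i) x) - (\<Sum>i\<in>S. h i * indicator (cell z' i) x))"
      using int by (intro Bochner_Integration.integrable_diff Bochner_Integration.integrable_sum) auto
    show "AE x in P. \<eta> * indicator T x \<le>
      (\<Sum>i\<in>S. h i * indicator (cell z i) x) - (\<Sum>i\<in>S. h i * indicator (cell z' i) x)"
      using AE_unique_cell[of z] AE_unique_cell[of z']
    proof eventually_elim
      case (elim x)
      obtain i where i: "i \<in> S" "x \<in> cell z i" using in_some_cell by blast
      obtain j where j: "j \<in> S" "x \<in> cell z' j" using in_some_cell by blast
      have sc: "score z' y x = score z y x - h y" for y by (simp add: score_def h_def)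
      have "score z' i x \<le> score z' j x" using cellD[OF j(2) i(1)] .
      then have hij: "0 \<le> h i - h j" using cellD[OF i(2) j(1)] by (simp add: sc)
      have "\<eta> \<le> h i - h j" if T: "x \<in> T"
      proof -
        have tA: "topscore z A x \<le> score z i x" unfolding topscore_def
          using fin A cellD[OF i(2)] by (subst Max_le_iff) auto
        \<comment> \<open>The strip allows a tie between \<open>A\<close> and its complement; ties
          are removed by the almost sure uniqueness of the cell.\<close>
        have "i \<in> A"
        proof (rule ccontr)
          assume "i \<notin> A"
          then have "score z i x \<le> topscore z (S - A) x" unfolding topscore_def using i fin by (intro Max_ge) auto
          also have "\<dots> \<le> topscore z A x" using T by (simp add: T_def)
          also have "topscore z A x \<in> (\<lambda>y. score z y x) ` A" unfolding topscore_def using fin A by (intro Max_in) auto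
          then obtain a where a: "a \<in> A" "topscore z A x = score z a x" by blast
          note a(2)
          finally have "x \<in> cell z a" using cellD[OF i(2)] by (force simp: cell_def)
          then have "a = i" using elim(1) i a A by blast
          then show False using a \<open>i \<notin> A\<close> by simp
        qed
        moreover have "j \<notin> A"
        proof
          assume jA: "j \<in> A"
          have "topscore z (S - A) x \<in> (\<lambda>y. score z y x) ` (S - A)" unfolding topscore_def
            using fin B by (intro Max_in) auto
          then obtain b where b: "b \<in> S - A" "topscore z (S - A) x = score z b x" by blast
          have "score z j x \<le> topscore z A x" unfolding topscore_def using jA fin by (intro Max_ge) auto
          also have "\<dots> < score z b x + \<eta>" using T b by (simp add: T_def)
          finally have "score z' j x < score z' b x" using gap[OF jA b(1)] by (simp add: sc h_def)
          then show False using cellD[OF j(2), of b] b by auto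
        qed
        ultimately show ?thesis using gap[of i j] j by (simp add: h_def)
      qed
      then show ?case
        unfolding sum_indicator_cell[OF elim(1) i] sum_indicator_cell[OF elim(2) j] using hij
        by (auto split: split_indicator)
    qed
  qed
  also have "\<dots> = (\<Sum>i\<in>S. h i * measure P (cell z i)) - (\<Sum>i\<in>S. h i * measure P (cell z' i))"
    using int by (subst Bochner_Integration.integral_diff) (auto simp: eq intro!: Bochner_Integration.integrable_sum)
  also have "\<dots> = (\<Sum>i\<in>S. h i * (measure P (cell z i) - measure P (cell z' i)))"
    by (simp add: sum_subtractf right_diff_distrib)
  finally show ?thesis by (simp add: h_def T_def)
qed

abbreviation mass_dist :: "('a \<Rightarrow> real) \<Rightarrow> ('a \<Rightarrow> real) \<Rightarrow> real" where
  "mass_dist z z' \<equiv> (\<Sum>i\<in>S. \<bar>measure P (cell z i) - measure P (cell z' i)\<bar>)"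

text \<open>Let \<open>R\<close> be the oscillation of \<open>h = z' - z\<close> and
  \<open>N\<close> the number of points. Some interval of length \<open>R / N\<close> contains no
  value of \<open>h\<close> in its interior, so \<open>S\<close> splits into two groups.
  Monotonicity bounds the mass of the strip between them by \<open>N\<close> times the mass
  difference, while this mass is at least proportional to \<open>R / N\<close>. Only one potential
  has to be \<open>good\<close>, and the bound is linear.\<close>

theorem cell_mass_stability:
  assumes c: "0 < c"
  obtains C \<delta> where "0 \<le> C" "0 < \<delta>" "\<And>z z' y. good c z \<Longrightarrow> sum z S = 0 \<Longrightarrow> sum z' S = 0 \<Longrightarrow>
     mass_dist z z' < \<delta> \<Longrightarrow> y \<in> S \<Longrightarrow>
     \<bar>z' y - z y\<bar> \<le> C * mass_dist z z'"
proof -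
  obtain \<kappa> v where \<kappa>: "0 < \<kappa>" and v: "0 < v" and mass_strip: "\<And>z A B \<eta>. good c z \<Longrightarrow> A \<subseteq> S \<Longrightarrow> B \<subseteq> S \<Longrightarrow> A \<noteq> {} \<Longrightarrow> B \<noteq> {} \<Longrightarrow> 0 < \<eta> \<Longrightarrow>
     min v (\<kappa> * \<eta>) \<le> measure P (strip z A B \<eta>)"
    by (rule level_strip_mass[OF c]) (rule that)
  define N where "N = real (card S)"
  have N: "0 < N" using finite_S S_nonempty by (simp add: N_def card_gt_0_iff)
  show thesis
  proof (rule that[of "N * N / \<kappa>" "v / N"])
    show "0 \<le> N * N / \<kappa>" "0 < v / N" using \<kappa> N v by auto
    fix z z' :: "'a \<Rightarrow> real" and y
    assume z: "good c z" and sums: "sum z S = 0" "sum z' S = 0" and y: "y \<in> S"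
    define \<Delta> where "\<Delta> = mass_dist z z'"
    assume "mass_dist z z' < v / N"
    then have small: "\<Delta> < v / N" by (simp add: \<Delta>_def)
    have \<Delta>0: "0 \<le> \<Delta>" by (simp add: \<Delta>_def sum_nonneg)
    define h where "h i = z' i - z i" for i
    have sumh: "sum h S = 0" using sums by (simp add: h_def sum_subtractf)
    obtain a where a: "a \<in> S" "\<And>y. y \<in> S \<Longrightarrow> h a \<le> h y"
      using arg_min_if_finite(1)[OF finite_S S_nonempty] arg_min_least[OF finite_S S_nonempty] by metis
    obtain b where b: "b \<in> S" "\<And>y. y \<in> S \<Longrightarrow> h y \<le> h b"
    proof -
      have "Max (h ` S) \<in> h ` S" using finite_S S_nonempty by (intro Max_in) auto
      then obtain b where "b \<in> S" "h b = Max (h ` S)" by auto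
      then show thesis using that[of b] finite_S by simp
    qed
    define R where "R = h b - h a"
    have ha: "h a \<le> 0"
    proof (rule ccontr)
      assume "\<not> h a \<le> 0"
      then have "0 < sum h S" using a finite_S S_nonempty by (intro sum_pos) force+
      then show False using sumh by simp
    qed
    have hb: "0 \<le> h b"
    proof (rule ccontr)
      assume "\<not> 0 \<le> h b"
      then have "0 < sum (\<lambda>i. - h i) S" using b finite_S S_nonempty by (intro sum_pos) force+
      then show False using sumh by (simp add: sum_negf)
    qed
    \<comment> \<open>Both potentials have sum zero, so \<open>h\<close> takes values of both signs,
      zero included, and the oscillation bounds its absolute value.\<close>
    have hR: "\<bar>h i\<bar> \<le> R" if "i \<in> S" for i using a(2)[OF that] b(2)[OF that] ha hb by (simp add: R_def)
    have "R \<le> N * N / \<kappa> * \<Delta>"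
    proof (cases "h a < h b")
      case False
      then show ?thesis using a(2)[OF b(1)] \<Delta>0 \<kappa> N by (simp add: R_def)
    next
      case True
      then have R: "0 < R" by (simp add: R_def)
      obtain t \<eta> where t: "\<eta> = (h b - h a) / card S" "h a \<le> t" "t + \<eta> \<le> h b"
        "\<And>y. y \<in> S \<Longrightarrow> h y \<le> t \<or> t + \<eta> \<le> h y"
        by (rule ex_value_gap[OF finite_S a(1) b(1) _ True]) (erule a(2), rule that)
      have \<eta>: "\<eta> = R / N" using t by (simp add: R_def N_def)
      have \<eta>0: "0 < \<eta>" using R N by (simp add: \<eta>)
      define A where "A = {i\<in>S. t + \<eta> \<le> h i}"
      have "a \<notin> A" "b \<in> A" "A \<subseteq> S" using b(1) t(2,3) \<eta>0 by (auto simp: A_def)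
      then have A: "A \<subseteq> S" "A \<noteq> {}" "A \<noteq> S" "S - A \<noteq> {}" using a(1) by blast+
      define m where "m = measure P (strip z A (S - A) \<eta>)"
      have "\<eta> * m \<le> (\<Sum>i\<in>S. (z' i - z i) * (measure P (cell z i) - measure P (cell z' i)))"
        unfolding m_def
      proof (rule cell_mass_monotone[OF A(1-3) \<eta>0])
        fix p q assume "p \<in> A" "q \<in> S - A"
        then show "z' q - z q + \<eta> \<le> z' p - z p" using t(4)[of q] by (auto simp: A_def h_def)
      qed
      also have "\<dots> \<le> (\<Sum>i\<in>S. R * \<bar>measure P (cell z i) - measure P (cell z' i)\<bar>)"
      proof (intro sum_mono)
        fix i assume i: "i \<in> S"
        have "(z' i - z i) * (measure P (cell z i) - measure P (cell z' i)) \<le>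
            \<bar>h i\<bar> * \<bar>measure P (cell z i) - measure P (cell z' i)\<bar>"
          by (simp add: h_def abs_mult[symmetric])
        also have "\<dots> \<le> R * \<bar>measure P (cell z i) - measure P (cell z' i)\<bar>"
          by (intro mult_right_mono hR i) simp
        finally show "(z' i - z i) * (measure P (cell z i) - measure P (cell z' i)) \<le>
            R * \<bar>measure P (cell z i) - measure P (cell z' i)\<bar>" .
      qed
      also have "\<dots> = R * \<Delta>" by (simp add: \<Delta>_def sum_distrib_left)
      finally have "R * m \<le> R * (N * \<Delta>)" using N by (simp add: \<eta> field_simps)
      then have "m \<le> N * \<Delta>" using R by (simp only: mult_le_cancel_left_pos)
      moreover have "min v (\<kappa> * \<eta>) \<le> m" unfolding m_def by (rule mass_strip[OF z A(1) _ A(2,4) \<eta>0]) auto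
      \<comment> \<open>Smallness of the mass difference rules out that the minimum is attained by
        the constant \<open>v\<close>.\<close>
      moreover have "N * \<Delta> < v" using small N by (simp add: field_simps)
      ultimately have "\<kappa> * \<eta> \<le> N * \<Delta>" by linarith
      then have "\<kappa> * R \<le> N * N * \<Delta>" using N by (simp add: \<eta> field_simps)
      then show ?thesis using \<kappa> by (simp add: field_simps)
    qed
    with hR[OF y] show "\<bar>z' y - z y\<bar> \<le> N * N / \<kappa> * mass_dist z z'"
      by (simp add: h_def \<Delta>_def)
  qed
qed

end

section \<open>Potentials as minimisers\<close>

text \<open>Tychonoff: potentials are functions on the whole space, and the box is a product of
  intervals on the support with singletons off it.\<close>

lemma compact_function_box:
  fixes B :: real
  shows "compact {z :: 'b \<Rightarrow> real. \<forall>y. z y \<in> (if y \<in> A then {-B..B} else {0})}"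
proof -
  have "compactin (product_topology (\<lambda>_. euclidean) UNIV) (PiE UNIV (\<lambda>y. if y \<in> A then {-B..B} else {0::real}))"
    by (subst compactin_PiE) auto
  then show ?thesis
    by (simp add: euclidean_product_topology PiE_UNIV_domain Pi_def)
qed

lemma is_arg_min_real_iff:
  fixes f :: "'b \<Rightarrow> real"
  shows "is_arg_min f Q x \<longleftrightarrow> Q x \<and> (\<forall>y. Q y \<longrightarrow> f x \<le> f y)"
  by (rule is_arg_min_linorder)

locale semidiscrete_target = semidiscrete +
  fixes R :: "'a pmf"
  assumes set_R: "set_pmf R = S"
begin

abbreviation minimiser :: "(('a \<Rightarrow> real) \<Rightarrow> real) \<Rightarrow> ('a \<Rightarrow> real) \<Rightarrow> bool" where
  "minimiser J \<equiv> is_arg_min J (\<lambda>z. z \<in> normalised_potentials R)"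

lemma pmf_R_pos: "y \<in> S \<Longrightarrow> 0 < pmf R y"
  using set_R by (simp add: pmf_positive)

lemma sum_pmf_R: "(\<Sum>y\<in>S. pmf R y) = 1"
  by (rule sum_pmf_eq_1) (use finite_S set_R in auto)

lemma normalised_iff: "z \<in> normalised_potentials R \<longleftrightarrow> (\<forall>y. y \<notin> S \<longrightarrow> z y = 0) \<and> sum z S = 0"
  by (simp add: normalised_potentials_def set_R)

text \<open>The linear term controls the oscillation of a potential on \<open>S\<close>.\<close>

lemma ex_minimiser:
  fixes J :: "('a \<Rightarrow> real) \<Rightarrow> real"
  assumes lip: "\<And>z z'. \<bar>J z - J z'\<bar> \<le> 2 * (\<Sum>y\<in>S. \<bar>z y - z' y\<bar>)"
    and coercive: "\<And>z y. y \<in> S \<Longrightarrow> - K - z y + (\<Sum>y\<in>S. z y * pmf R y) \<le> J z"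
  shows "\<exists>z. minimiser J z"
proof -
  define r0 where "r0 = Min (pmf R ` S)"
  have r0: "0 < r0" "\<And>y. y \<in> S \<Longrightarrow> r0 \<le> pmf R y"
    using finite_S S_nonempty pmf_R_pos by (auto simp: r0_def)
  \<comment> \<open>Large enough that \<open>r0 * B - K\<close> exceeds the value at the zero
    potential, so nothing outside the box can improve on the minimiser over the box.\<close>
  define B where "B = \<bar>J (\<lambda>_. 0) + K\<bar> / r0 + 1"
  have B: "0 < B" using r0 by (simp add: B_def add_nonneg_pos)
  define box where "box = {z :: 'a \<Rightarrow> real. \<forall>y. z y \<in> (if y \<in> S then {-B..B} else {0})}"
  have coord: "continuous_on A (\<lambda>z. z y)" for A and y :: 'a
    by (rule continuous_on_subset[OF continuous_on_product_coordinates]) simp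
  have cont: "continuous_on A J" for A
    unfolding continuous_on_def
  proof
    fix z assume "z \<in> A"
    have "((\<lambda>z'. z' y) \<longlongrightarrow> z y) (at z within A)" for y :: 'a
      using coord[of A y] \<open>z \<in> A\<close> by (simp add: continuous_on_def)
    then have "((\<lambda>z'. 2 * (\<Sum>y\<in>S. \<bar>z' y - z y\<bar>)) \<longlongrightarrow> 2 * (\<Sum>y\<in>S. \<bar>z y - z y\<bar>)) (at z within A)"
      by (intro tendsto_intros)
    then have "((\<lambda>z'. 2 * (\<Sum>y\<in>S. \<bar>z' y - z y\<bar>)) \<longlongrightarrow> 0) (at z within A)" by simp
    then have "((\<lambda>z'. J z' - J z) \<longlongrightarrow> 0) (at z within A)"
      by (rule Lim_null_comparison[rotated]) (use lip in auto)
    then show "(J \<longlongrightarrow> J z) (at z within A)" by (simp add: LIM_zero_iff)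
  qed
  have closed: "closed {z :: 'a \<Rightarrow> real. sum z S = 0}"
    by (intro closed_Collect_eq continuous_on_sum coord continuous_on_const)
  have comp: "compact (box \<inter> {z. sum z S = 0})"
    unfolding box_def by (rule compact_Int_closed[OF compact_function_box closed])
  have zero: "(\<lambda>_. 0) \<in> box \<inter> {z. sum z S = 0}" using B by (auto simp: box_def)
  obtain z0 where z0: "z0 \<in> box \<inter> {z. sum z S = 0}" "\<And>z. z \<in> box \<inter> {z. sum z S = 0} \<Longrightarrow> J z0 \<le> J z"
    using continuous_attains_inf[OF comp _ cont] zero by blast
  have "minimiser J z0"
    unfolding is_arg_min_real_iff
  proof (intro conjI allI impI)
    show "z0 \<in> normalised_potentials R" unfolding normalised_iff using z0(1) by (auto simp: box_def) (metis singletonD)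
    fix z assume z: "z \<in> normalised_potentials R"
    show "J z0 \<le> J z"
    proof (cases "z \<in> box")
      case True
      then show ?thesis using z0(2) z by (simp add: normalised_iff)
    next
      case False
      then obtain y where y': "z y \<notin> (if y \<in> S then {-B..B} else {0})" by (auto simp: box_def)
      then have y: "y \<in> S" "B < \<bar>z y\<bar>"
        using z by (cases "y \<in> S"; auto simp: normalised_iff)+
      obtain a where a: "a \<in> S" "\<And>y. y \<in> S \<Longrightarrow> z a \<le> z y"
        using arg_min_if_finite(1)[OF finite_S S_nonempty] arg_min_least[OF finite_S S_nonempty] by metis
      have sum0: "sum z S = 0" using z by (simp add: normalised_iff)
      have za: "z a \<le> 0"
      proof (rule ccontr)
        assume "\<not> z a \<le> 0"
        then have "0 < sum z S" using a finite_S S_nonempty by (intro sum_pos) force+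
        then show False using sum0 by simp
      qed
      \<comment> \<open>A large coordinate forces a large oscillation: if it is negative, the zero
        sum provides another point where the potential is nonnegative.\<close>
      obtain b where b: "b \<in> S" "B < z b - z a"
      proof (cases "0 \<le> z y")
        case True
        then show thesis using that[of y] y za by simp
      next
        case False
        have "\<exists>b\<in>S. 0 \<le> z b"
        proof (rule ccontr)
          assume "\<not> ?thesis"
          then have "0 < sum (\<lambda>i. - z i) S" using finite_S S_nonempty by (intro sum_pos) force+
          then show False using sum0 by (simp add: sum_negf)
        qed
        then obtain b where "b \<in> S" "0 \<le> z b" by blast
        then show thesis using that[of b] y False a(2)[OF y(1)] by simp
      qed
      \<comment> \<open>All terms \<open>pmf R y * (z y - z a)\<close> are nonnegative, so the one
        at \<open>b\<close> alone bounds the linear part from below.\<close>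
      have "r0 * B \<le> r0 * (z b - z a)" using b r0 by (intro mult_left_mono) auto
      also have "\<dots> \<le> pmf R b * (z b - z a)" using r0(2)[OF b(1)] b B by (intro mult_right_mono) auto
      also have "\<dots> \<le> (\<Sum>y\<in>S. pmf R y * (z y - z a))"
        using finite_S b a(2) by (intro member_le_sum[of b S "\<lambda>y. pmf R y * (z y - z a)"]) auto
      also have "\<dots> = (\<Sum>y\<in>S. z y * pmf R y) - z a * (\<Sum>y\<in>S. pmf R y)"
        by (simp add: right_diff_distrib sum_subtractf sum_distrib_left mult.commute)
      finally have "r0 * B - K \<le> J z" using coercive[OF a(1), of z] by (simp add: sum_pmf_R)
      moreover have "J (\<lambda>_. 0) + K \<le> r0 * B" using r0 by (simp add: B_def distrib_left)
      moreover have "J z0 \<le> J (\<lambda>_. 0)" by (rule z0(2)[OF zero])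
      ultimately show ?thesis by simp
    qed
  qed
  then show ?thesis by blast
qed

text \<open>
  A subgradient inequality for \<open>J\<close> at \<open>z + s e\<^sub>i\<close> gives \<open>F z i \<le> pmf R i\<close> as
  \<open>s\<close> tends to \<open>0\<close> from above, and both sides sum to \<open>1\<close>.
\<close>

lemma first_order_condition:
  fixes J :: "('a \<Rightarrow> real) \<Rightarrow> real"
  assumes min: "minimiser J z"
    and cong: "\<And>z z'. (\<And>y. y \<in> S \<Longrightarrow> z y = z' y) \<Longrightarrow> J z = J z'"
    and shift: "\<And>z a. J (\<lambda>y. z y + a) = J z"
    and grad: "\<And>z z'. J z' + (\<Sum>i\<in>S. (z i - z' i) * (pmf R i - F z' i)) \<le> J z"
    and lower: "\<And>z i. i \<in> S \<Longrightarrow> \<exists>g. (g \<longlongrightarrow> F z i) (at_right 0) \<and> (\<forall>s>0. g s \<le> F (z(i := z i + s)) i)"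
    and total: "\<And>z. (\<Sum>i\<in>S. F z i) = 1"
    and i: "i \<in> S"
  shows "F z i = pmf R i"
proof -
  \<comment> \<open>A normalised minimiser is a global one: \<open>J\<close> ignores values off
    \<open>S\<close> and is invariant under adding constants, so every competitor can be
    centred.\<close>
  have glob: "J z \<le> J z'" for z'
  proof -
    define m where "m = sum z' S / card S"
    define w where "w y = (if y \<in> S then z' y - m else 0)" for y
    have "sum w S = sum z' S - card S * m" by (simp add: w_def sum_subtractf)
    then have "w \<in> normalised_potentials R"
      using finite_S S_nonempty by (simp add: normalised_iff m_def) (simp add: w_def)
    then have "J z \<le> J w" using min by (simp add: is_arg_min_real_iff)
    also have "J w = J (\<lambda>y. z' y + (- m))" by (rule cong) (simp add: w_def)
    also have "\<dots> = J z'" by (rule shift)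
    finally show ?thesis .
  qed
  have le: "F z k \<le> pmf R k" if k: "k \<in> S" for k
  proof -
    obtain g where g: "(g \<longlongrightarrow> F z k) (at_right 0)" "\<And>s. 0 < s \<Longrightarrow> g s \<le> F (z(k := z k + s)) k"
      using lower[OF k] by blast
    have "g s \<le> pmf R k" if s: "0 < s" for s
    proof -
      let ?z' = "z(k := z k + s)"
      have "(\<Sum>j\<in>S. (z j - ?z' j) * (pmf R j - F ?z' j)) = (\<Sum>j\<in>S. if j = k then - s * (pmf R j - F ?z' j) else 0)"
        by (intro sum.cong) auto
      also have "\<dots> = - s * (pmf R k - F ?z' k)" using k finite_S by simp
      finally have "J ?z' - s * (pmf R k - F ?z' k) \<le> J z" using grad[of ?z' z] by simp
      then have "0 \<le> s * (pmf R k - F ?z' k)" using glob[of ?z'] by linarith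
      then have "F ?z' k \<le> pmf R k" using s by (simp add: zero_le_mult_iff)
      with g(2)[OF s] show ?thesis by linarith
    qed
    then show ?thesis
      by (intro tendsto_upperbound[OF g(1)]) (auto simp: eventually_at_right_field intro: exI[of _ 1])
  qed
  show ?thesis
  proof (rule ccontr)
    assume "F z i \<noteq> pmf R i"
    then have "F z i < pmf R i" using le[OF i] by simp
    then have "(\<Sum>i\<in>S. F z i) < (\<Sum>i\<in>S. pmf R i)"
      using finite_S le i by (intro sum_strict_mono_ex1) auto
    then show False using total sum_pmf_R by simp
  qed
qed

end

text \<open>Summand of the symmetrised Kullback-Leibler divergence; its vanishing will identify the
  softmax weights of two entropic minimisers.\<close>

lemma diff_mult_ln_diff_nonneg:
  fixes a b :: real
  assumes "0 < a" "0 < b"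
  shows "0 \<le> (a - b) * (ln a - ln b)" and "(a - b) * (ln a - ln b) = 0 \<Longrightarrow> a = b"
proof -
  show "0 \<le> (a - b) * (ln a - ln b)"
    using assms by (cases "a \<le> b") (auto simp: mult_nonpos_nonpos)
  show "(a - b) * (ln a - ln b) = 0 \<Longrightarrow> a = b" using assms by auto
qed

section \<open>Log-sum-exp and maximum as functions of the potential\<close>

context semidiscrete
begin

definition lse :: "real \<Rightarrow> ('a \<Rightarrow> real) \<Rightarrow> 'a \<Rightarrow> real" where
  "lse \<epsilon> z x = \<epsilon> * ln (\<Sum>y\<in>S. exp (score z y x / \<epsilon>))"

lemma lse_measurable[measurable]: "lse \<epsilon> z \<in> borel_measurable borel"
  unfolding lse_def by measurable

lemma score_change: "score z' y x = score z y x - (z' y - z y)"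
  by (simp add: score_def)

lemma score_translate: "score z y x = score (\<lambda>y. z y - x \<bullet> y) y 0"
  by (simp add: score_def)

text \<open>Convexity in the potential: Jensen's inequality for the exponential under the softmax
  weights, obtained from \<open>1 + u \<le> exp u\<close> after centring the increments at their
  weighted mean \<open>m\<close>.\<close>

lemma lse_grad:
  assumes \<epsilon>: "0 < \<epsilon>"
  shows "lse \<epsilon> z x - (\<Sum>i\<in>S. (z' i - z i) * soft \<epsilon> z i x) \<le> lse \<epsilon> z' x"
proof -
  define h where "h i = z' i - z i" for i
  define m where "m = (\<Sum>i\<in>S. h i * soft \<epsilon> z i x)"
  define W where "W = (\<Sum>y\<in>S. exp (score z y x / \<epsilon>))"
  have W: "0 < W" unfolding W_def by (rule soft_denominator_pos)
  have "1 = (\<Sum>i\<in>S. soft \<epsilon> z i x * (1 + - ((h i - m) / \<epsilon>)))"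
  proof -
    have "(\<Sum>i\<in>S. soft \<epsilon> z i x * (1 + - ((h i - m) / \<epsilon>))) =
        (\<Sum>i\<in>S. soft \<epsilon> z i x) - ((\<Sum>i\<in>S. h i * soft \<epsilon> z i x) - m * (\<Sum>i\<in>S. soft \<epsilon> z i x)) / \<epsilon>"
      by (simp add: sum.distrib sum_subtractf sum_distrib_left sum_divide_distrib algebra_simps diff_divide_distrib)
    then show ?thesis by (simp add: sum_soft m_def)
  qed
  also have "\<dots> \<le> (\<Sum>i\<in>S. soft \<epsilon> z i x * exp (- ((h i - m) / \<epsilon>)))"
    by (intro sum_mono mult_left_mono exp_ge_add_one_self soft_nonneg)
  also have "\<dots> = exp (m / \<epsilon>) * (\<Sum>i\<in>S. soft \<epsilon> z i x * exp (- (h i / \<epsilon>)))"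
  proof -
    have "exp (- ((h i - m) / \<epsilon>)) = exp (m / \<epsilon>) * exp (- (h i / \<epsilon>))" for i
      by (simp add: mult_exp_exp diff_divide_distrib)
    then show ?thesis by (simp add: sum_distrib_left mult.left_commute)
  qed
  also have "(\<Sum>i\<in>S. soft \<epsilon> z i x * exp (- (h i / \<epsilon>))) = (\<Sum>i\<in>S. exp (score z' i x / \<epsilon>)) / W"
    unfolding sum_divide_distrib soft_def W_def[symmetric] h_def
    by (intro sum.cong refl) (simp add: score_change[of z' _ x z] mult_exp_exp diff_divide_distrib)
  finally have "W \<le> exp (m / \<epsilon>) * (\<Sum>i\<in>S. exp (score z' i x / \<epsilon>))" using W by (simp add: field_simps)
  then have "ln W \<le> m / \<epsilon> + ln (\<Sum>i\<in>S. exp (score z' i x / \<epsilon>))"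
    using W soft_denominator_pos[of z' x \<epsilon>] by (subst (asm) ln_le_cancel_iff[symmetric]) (auto simp: ln_mult)
  then have "\<epsilon> * ln W \<le> \<epsilon> * (m / \<epsilon> + ln (\<Sum>i\<in>S. exp (score z' i x / \<epsilon>)))"
    using \<epsilon> by (intro mult_left_mono) auto
  then show ?thesis using \<epsilon> by (simp add: lse_def W_def m_def h_def distrib_left)
qed

lemma lse_lip:
  assumes \<epsilon>: "0 < \<epsilon>"
  shows "\<bar>lse \<epsilon> z x - lse \<epsilon> z' x\<bar> \<le> (\<Sum>y\<in>S. \<bar>z y - z' y\<bar>)"
proof -
  have one: "lse \<epsilon> z x - lse \<epsilon> z' x \<le> (\<Sum>y\<in>S. \<bar>z y - z' y\<bar>)" for z z'
  proof -
    have "lse \<epsilon> z x - lse \<epsilon> z' x \<le> (\<Sum>i\<in>S. (z' i - z i) * soft \<epsilon> z i x)" using lse_grad[OF \<epsilon>, of z x z'] by simp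
    also have "\<dots> \<le> (\<Sum>i\<in>S. \<bar>z i - z' i\<bar> * 1)"
      by (intro sum_mono mult_mono soft_le_1 soft_nonneg) auto
    finally show ?thesis by simp
  qed
  from one[of z z'] one[of z' z] show ?thesis by (simp add: abs_le_iff abs_minus_commute)
qed

lemma score_le_lse:
  assumes "0 < \<epsilon>" "y \<in> S"
  shows "score z y x \<le> lse \<epsilon> z x"
proof -
  have "exp (score z y x / \<epsilon>) \<le> (\<Sum>y\<in>S. exp (score z y x / \<epsilon>))"
    using assms finite_S by (intro member_le_sum) auto
  then have "score z y x / \<epsilon> \<le> ln (\<Sum>y\<in>S. exp (score z y x / \<epsilon>))"
    using soft_denominator_pos[of z x \<epsilon>] by (subst ln_ge_iff)
  then show ?thesis using assms by (simp add: lse_def field_simps)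
qed

lemma lse_shift: "0 < \<epsilon> \<Longrightarrow> lse \<epsilon> (\<lambda>y. z y + a) x = lse \<epsilon> z x - a"
proof -
  assume \<epsilon>: "0 < \<epsilon>"
  have "(\<Sum>y\<in>S. exp (score (\<lambda>y. z y + a) y x / \<epsilon>)) = exp (- (a / \<epsilon>)) * (\<Sum>y\<in>S. exp (score z y x / \<epsilon>))"
    unfolding sum_distrib_left by (intro sum.cong refl) (simp add: score_def mult_exp_exp diff_divide_distrib add_divide_distrib)
  then show ?thesis using \<epsilon> soft_denominator_pos[of z x \<epsilon>]
    by (simp add: lse_def ln_mult right_diff_distrib)
qed

lemma lse_translate: "lse \<epsilon> z x = lse \<epsilon> (\<lambda>y. z y - x \<bullet> y) 0"
  unfolding lse_def by (subst score_translate) simp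

lemma ln_soft_diff:
  assumes \<epsilon>: "0 < \<epsilon>"
  shows "\<epsilon> * (ln (soft \<epsilon> z' i x) - ln (soft \<epsilon> z i x)) = - (z' i - z i) - (lse \<epsilon> z' x - lse \<epsilon> z x)"
proof -
  have "\<epsilon> * ln (soft \<epsilon> z i x) = score z i x - lse \<epsilon> z x" for z
    using \<epsilon> soft_denominator_pos[of z x \<epsilon>] by (simp add: soft_def lse_def ln_div right_diff_distrib)
  then show ?thesis by (simp add: right_diff_distrib score_change[of z' i x z])
qed

lemma soft_pos: "0 < soft \<epsilon> z i x"
  unfolding soft_def using soft_denominator_pos[of z x \<epsilon>] by simp

lemma topscore_lip:
  "\<bar>topscore z S x - topscore z' S x\<bar> \<le> (\<Sum>y\<in>S. \<bar>z y - z' y\<bar>)"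
  unfolding topscore_def
proof (rule Max_diff_le[OF finite_S S_nonempty])
  fix y assume "y \<in> S"
  then show "\<bar>score z y x - score z' y x\<bar> \<le> (\<Sum>y\<in>S. \<bar>z y - z' y\<bar>)"
    using member_le_sum[of y S "\<lambda>y. \<bar>z y - z' y\<bar>"] finite_S by (simp add: score_def abs_minus_commute)
qed

lemma score_le_topscore: "y \<in> S \<Longrightarrow> score z y x \<le> topscore z S x"
  unfolding topscore_def using finite_S by (intro Max_ge) auto

lemma topscore_eq: "k \<in> S \<Longrightarrow> x \<in> cell z k \<Longrightarrow> topscore z S x = score z k x"
  unfolding topscore_def using finite_S by (intro Max_eqI) (auto dest: cellD)

lemma topscore_shift: "topscore (\<lambda>y. z y + a) S x = topscore z S x - a"
proof -
  obtain k where k: "k \<in> S" "x \<in> cell z k" using in_some_cell by blast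
  then have "x \<in> cell (\<lambda>y. z y + a) k" by (auto simp: cell_def score_def)
  then show ?thesis using k by (simp add: topscore_eq) (simp add: score_def)
qed

lemma topscore_translate: "topscore z S x = topscore (\<lambda>y. z y - x \<bullet> y) S 0"
  unfolding topscore_def by (subst score_translate) simp

end

section \<open>First-order conditions and uniqueness of the potentials\<close>

context semidiscrete_target
begin

text \<open>Common treatment of \<open>topscore\<close> with cell indicators and of
  \<open>lse\<close> with softmax weights. The condition \<open>lower\<close> is a one-sided
  semicontinuity of the mass of a cell as its own potential is raised; it takes the place of
  differentiability of the objective.\<close>

lemma potential_characterisation:
  fixes U :: "('a \<Rightarrow> real) \<Rightarrow> 'a \<Rightarrow> real" and w :: "('a \<Rightarrow> real) \<Rightarrow> 'a \<Rightarrow> 'a \<Rightarrow> real"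
  assumes [measurable]: "\<And>z. U z \<in> borel_measurable borel" "\<And>z i. w z i \<in> borel_measurable borel"
    and lip: "\<And>z z' x. \<bar>U z x - U z' x\<bar> \<le> (\<Sum>y\<in>S. \<bar>z y - z' y\<bar>)"
    and ge: "\<And>z y x. y \<in> S \<Longrightarrow> score z y x \<le> U z x"
    and shift: "\<And>z a x. U (\<lambda>y. z y + a) x = U z x - a"
    and translate: "\<And>z x. U z x = U (\<lambda>y. z y - x \<bullet> y) 0"
    and w: "\<And>z i x. i \<in> S \<Longrightarrow> 0 \<le> w z i x" "\<And>z i x. i \<in> S \<Longrightarrow> w z i x \<le> 1"
    and wsum: "\<And>z. AE x in P. (\<Sum>i\<in>S. w z i x) = 1"
    and grad: "\<And>z z'. AE x in P. U z x - (\<Sum>i\<in>S. (z' i - z i) * w z i x) \<le> U z' x"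
    and lower: "\<And>z i. i \<in> S \<Longrightarrow> \<exists>g. (g \<longlongrightarrow> (\<integral>x. w z i x \<partial>P)) (at_right 0) \<and>
        (\<forall>s>0. g s \<le> (\<integral>x. w (z(i := z i + s)) i x \<partial>P))"
  defines "J \<equiv> \<lambda>z. (\<integral>x. U z x \<partial>P) + (\<Sum>y\<in>S. z y * pmf R y)"
  shows "\<exists>z. minimiser J z"
    and "\<And>z i. minimiser J z \<Longrightarrow> i \<in> S \<Longrightarrow> (\<integral>x. w z i x \<partial>P) = pmf R i"
proof -
  interpret prob_space P by (rule prob_P)
  have puniv[simp]: "prob UNIV = 1" using prob_space by simp
  have intU: "integrable P (U z)" for z
  proof (rule integrable_P)
    fix x assume x: "x \<in> X"
    \<comment> \<open>Translation moves \<open>x\<close> into the potential, so the Lipschitz bound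
      in the potential also controls growth in \<open>x\<close>.\<close>
    have "\<bar>U z x - U z 0\<bar> \<le> (\<Sum>y\<in>S. \<bar>(z y - x \<bullet> y) - z y\<bar>)"
      using lip[of "\<lambda>y. z y - x \<bullet> y" 0 z] by (simp add: translate[of z x, symmetric])
    also have "\<dots> \<le> (\<Sum>y\<in>S. rad * norm y)"
    proof (intro sum_mono)
      fix y
      have "\<bar>x \<bullet> y\<bar> \<le> norm x * norm y" by (rule Cauchy_Schwarz_ineq2)
      also have "\<dots> \<le> rad * norm y" using norm_le_rad[OF x] by (intro mult_right_mono) auto
      finally show "\<bar>(z y - x \<bullet> y) - z y\<bar> \<le> rad * norm y" by simp
    qed
    finally show "\<bar>U z x\<bar> \<le> \<bar>U z 0\<bar> + (\<Sum>y\<in>S. rad * norm y)" by linarith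
  qed simp
  have intw: "integrable P (w z i)" if "i \<in> S" for z i
    by (rule integrable_P[of _ 1]) (use w[OF that] in auto)
  have Jlip: "\<bar>J z - J z'\<bar> \<le> 2 * (\<Sum>y\<in>S. \<bar>z y - z' y\<bar>)" for z z'
  proof -
    have "\<bar>(\<integral>x. U z x \<partial>P) - (\<integral>x. U z' x \<partial>P)\<bar> = \<bar>\<integral>x. U z x - U z' x \<partial>P\<bar>" using intU by simp
    also have "\<dots> \<le> (\<integral>x. \<bar>U z x - U z' x\<bar> \<partial>P)" by (rule integral_abs_bound)
    also have "\<dots> \<le> (\<integral>x. (\<Sum>y\<in>S. \<bar>z y - z' y\<bar>) \<partial>P)"
      using intU lip by (intro integral_mono) auto
    also have "\<dots> = (\<Sum>y\<in>S. \<bar>z y - z' y\<bar>)" by simp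
    finally have 1: "\<bar>(\<integral>x. U z x \<partial>P) - (\<integral>x. U z' x \<partial>P)\<bar> \<le> (\<Sum>y\<in>S. \<bar>z y - z' y\<bar>)" .
    have "\<bar>(\<Sum>y\<in>S. z y * pmf R y) - (\<Sum>y\<in>S. z' y * pmf R y)\<bar> = \<bar>\<Sum>y\<in>S. (z y - z' y) * pmf R y\<bar>"
      by (simp add: sum_subtractf left_diff_distrib)
    also have "\<dots> \<le> (\<Sum>y\<in>S. \<bar>(z y - z' y) * pmf R y\<bar>)" by (rule sum_abs)
    also have "\<dots> \<le> (\<Sum>y\<in>S. \<bar>z y - z' y\<bar>)"
      by (intro sum_mono) (simp add: abs_mult pmf_le_1 mult_left_le)
    finally show ?thesis using 1 unfolding J_def by linarith
  qed
  have coercive: "- (\<Sum>y\<in>S. rad * norm y) - z y + (\<Sum>y\<in>S. z y * pmf R y) \<le> J z" if y: "y \<in> S" for z y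
  proof -
    have "- (\<Sum>y\<in>S. rad * norm y) - z y = (\<integral>x. - (\<Sum>y\<in>S. rad * norm y) - z y \<partial>P)" by simp
    also have "\<dots> \<le> (\<integral>x. U z x \<partial>P)"
    proof (rule integral_mono_AE)
      show "AE x in P. - (\<Sum>y\<in>S. rad * norm y) - z y \<le> U z x"
        using AE_X
      proof eventually_elim
        case (elim x)
        have "\<bar>x \<bullet> y\<bar> \<le> norm x * norm y" by (rule Cauchy_Schwarz_ineq2)
        also have "\<dots> \<le> rad * norm y" using norm_le_rad[OF elim] by (intro mult_right_mono) auto
        also have "\<dots> \<le> (\<Sum>y\<in>S. rad * norm y)"
          using y finite_S rad by (intro member_le_sum) auto
        finally show ?case using ge[OF y, of z x] by (simp add: score_def)
      qed
    qed (use intU in auto)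
    finally show ?thesis by (simp add: J_def)
  qed
  show "\<exists>z. minimiser J z"
    by (rule ex_minimiser[OF Jlip coercive])
  fix z i assume min: "minimiser J z" and i: "i \<in> S"
  show "(\<integral>x. w z i x \<partial>P) = pmf R i"
  proof (rule first_order_condition[where F = "\<lambda>z i. \<integral>x. w z i x \<partial>P", OF min _ _ _ lower _ i])
    show "J z = J z'" if "\<And>y. y \<in> S \<Longrightarrow> z y = z' y" for z z'
      using Jlip[of z z'] that by simp
    show "J (\<lambda>y. z y + a) = J z" for z a
    proof -
      have "U (\<lambda>y. z y + a) = (\<lambda>x. U z x - a)" by (rule ext) (rule shift)
      then show ?thesis
      using intU by (simp add: J_def shift distrib_right sum.distrib sum_distrib_left[symmetric] sum_pmf_R)
    qed
    show "(\<Sum>i\<in>S. \<integral>x. w z i x \<partial>P) = 1" for z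
    proof -
      have "(\<Sum>i\<in>S. \<integral>x. w z i x \<partial>P) = (\<integral>x. (\<Sum>i\<in>S. w z i x) \<partial>P)"
        using intw by (subst Bochner_Integration.integral_sum) auto
      also have "\<dots> = (\<integral>x. 1 \<partial>P)" by (rule integral_cong_AE) (use wsum in auto)
      finally show ?thesis by simp
    qed
    show "J z' + (\<Sum>i\<in>S. (z i - z' i) * (pmf R i - (\<integral>x. w z' i x \<partial>P))) \<le> J z" for z z'
    proof -
      have "(\<integral>x. U z' x \<partial>P) - (\<Sum>i\<in>S. (z i - z' i) * (\<integral>x. w z' i x \<partial>P)) =
          (\<integral>x. U z' x - (\<Sum>i\<in>S. (z i - z' i) * w z' i x) \<partial>P)"
        using intU intw by (simp add: Bochner_Integration.integral_sum)
      also have "\<dots> \<le> (\<integral>x. U z x \<partial>P)"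
        using intU intw grad by (intro integral_mono_AE) (auto intro!: Bochner_Integration.integrable_diff Bochner_Integration.integrable_sum)
      finally show ?thesis
        by (simp add: J_def right_diff_distrib left_diff_distrib sum_subtractf)
    qed
  qed
qed

lemma brenier_objective_eq:
  "brenier_objective P R z = (\<integral>x. topscore z S x \<partial>P) + (\<Sum>y\<in>S. z y * pmf R y)"
  by (simp add: brenier_objective_def topscore_def score_def set_R)

lemma entropic_objective_eq:
  "entropic_objective P R \<epsilon> z = (\<integral>x. lse \<epsilon> z x \<partial>P) + (\<Sum>y\<in>S. z y * pmf R y)"
  by (simp add: entropic_objective_def lse_def score_def set_R)

lemma brenier_minimiser:
  shows "\<exists>z. minimiser (brenier_objective P R) z"
    and "\<And>z i. minimiser (brenier_objective P R) z \<Longrightarrow>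
        i \<in> S \<Longrightarrow> measure P (cell z i) = pmf R i"
proof -
  interpret prob_space P by (rule prob_P)
  have lower: "\<exists>g. (g \<longlongrightarrow> (\<integral>x. indicator (cell z i) x \<partial>P)) (at_right 0) \<and>
        (\<forall>s>0. g s \<le> (\<integral>x. indicator (cell (z(i := z i + s)) i) x \<partial>P :: real))" if i: "i \<in> S" for z i
  proof -
    \<comment> \<open>Raising \<open>z i\<close> by \<open>s\<close> takes from cell
      \<open>i\<close> only points whose gap to some \<open>j\<close> is at most \<open>s\<close>.
      These lie in slabs of thickness \<open>s\<close>, of total mass at most
      \<open>C * s\<close>.\<close>
    define C where "C = (\<Sum>j\<in>S - {i}. \<rho>max * slab_const (i - j))"
    have "prob (cell z i) - C * s \<le> prob (cell (z(i := z i + s)) i)" if s: "0 < s" for s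
    proof -
      let ?slab = "\<lambda>j. {x. z i - z j \<le> x \<bullet> (i - j) \<and> x \<bullet> (i - j) \<le> z i - z j + s}"
      have slabs: "(\<Union>j\<in>S - {i}. ?slab j) \<in> sets borel" using finite_S by (intro sets.finite_UN) auto
      have "cell z i \<subseteq> cell (z(i := z i + s)) i \<union> (\<Union>j\<in>S - {i}. ?slab j)"
      proof
        fix x assume x: "x \<in> cell z i"
        show "x \<in> cell (z(i := z i + s)) i \<union> (\<Union>j\<in>S - {i}. ?slab j)"
        proof (cases "x \<in> cell (z(i := z i + s)) i")
          case False
          then obtain j where j: "j \<in> S" "score (z(i := z i + s)) i x < score (z(i := z i + s)) j x"
            by (auto simp: cell_def not_le)
          then have "j \<noteq> i" by auto
          with j have "score z i x - s < score z j x" by (simp add: score_def)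
          moreover have "score z j x \<le> score z i x" using cellD[OF x j(1)] .
          ultimately have "x \<in> ?slab j" using score_diff[of z i x j] by auto
          then show ?thesis using j \<open>j \<noteq> i\<close> by blast
        qed simp
      qed
      then have "prob (cell z i) \<le> prob (cell (z(i := z i + s)) i \<union> (\<Union>j\<in>S - {i}. ?slab j))"
        using slabs by (intro finite_measure_mono) auto
      also have "\<dots> \<le> prob (cell (z(i := z i + s)) i) + prob (\<Union>j\<in>S - {i}. ?slab j)"
        using slabs by (intro measure_Un_le) auto
      also have "prob (\<Union>j\<in>S - {i}. ?slab j) \<le> (\<Sum>j\<in>S - {i}. prob (?slab j))"
        using finite_S by (intro measure_UNION_le) auto
      also have "\<dots> \<le> (\<Sum>j\<in>S - {i}. \<rho>max * slab_const (i - j) * s)"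
        using s by (intro sum_mono measure_P_slab) auto
      also have "\<dots> = C * s" by (simp add: C_def sum_distrib_right)
      finally show ?thesis by linarith
    qed
    moreover have "((\<lambda>s. prob (cell z i) - C * s) \<longlongrightarrow> prob (cell z i)) (at_right 0)"
      by (auto intro!: tendsto_eq_intros)
    ultimately show ?thesis by (intro exI[of _ "\<lambda>s. prob (cell z i) - C * s"]) simp
  qed
  have grad: "AE x in P. topscore z S x - (\<Sum>i\<in>S. (z' i - z i) * indicator (cell z i) x) \<le> topscore z' S x" for z z'
    using AE_unique_cell[of z]
  proof eventually_elim
    case (elim x)
    obtain k where k: "k \<in> S" "x \<in> cell z k" using in_some_cell by blast
    show ?case using score_le_topscore[OF k(1), of z' x]
      unfolding sum_indicator_cell[OF elim k] topscore_eq[OF k] by (simp add: score_change[of z' k x z])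
  qed
  have wsum: "AE x in P. (\<Sum>i\<in>S. indicator (cell z i) x :: real) = 1" for z
    using AE_unique_cell[of z]
  proof eventually_elim
    case (elim x)
    obtain k where k: "k \<in> S" "x \<in> cell z k" using in_some_cell by blast
    show ?case using sum_indicator_cell[OF elim k, of "\<lambda>_. 1"] by simp
  qed
  note char = potential_characterisation[where U = "\<lambda>z. topscore z S" and w = "\<lambda>z i. indicator (cell z i)",
      OF _ _ topscore_lip score_le_topscore topscore_shift topscore_translate _ _ wsum grad lower]
  show "\<exists>z. minimiser (brenier_objective P R) z"
    unfolding brenier_objective_eq[abs_def] by (rule char(1)) (use finite_S in \<open>auto split: split_indicator\<close>)
  fix z i assume z: "minimiser (brenier_objective P R) z" and i: "i \<in> S"
  have "(\<integral>x. indicator (cell z i) x \<partial>P) = pmf R i"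
    by (rule char(2)[OF _ _ _ _ _ _ z[unfolded brenier_objective_eq[abs_def]] i]) (use finite_S in \<open>auto split: split_indicator\<close>)
  then show "prob (cell z i) = pmf R i" by simp
qed

lemma entropic_minimiser:
  assumes \<epsilon>: "0 < \<epsilon>"
  shows "\<exists>z. minimiser (entropic_objective P R \<epsilon>) z"
    and "\<And>z i. minimiser (entropic_objective P R \<epsilon>) z \<Longrightarrow>
        i \<in> S \<Longrightarrow> (\<integral>x. soft \<epsilon> z i x \<partial>P) = pmf R i"
proof -
  interpret prob_space P by (rule prob_P)
  have int: "integrable P (soft \<epsilon> z i)" if "i \<in> S" for z i
    by (rule integrable_P[of _ 1]) (use soft_le_1[OF that, of \<epsilon> z] soft_nonneg[of \<epsilon> z i] in auto)
  have lower: "\<exists>g. (g \<longlongrightarrow> (\<integral>x. soft \<epsilon> z i x \<partial>P)) (at_right 0) \<and>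
        (\<forall>s>0. g s \<le> (\<integral>x. soft \<epsilon> (z(i := z i + s)) i x \<partial>P))" if i: "i \<in> S" for z i
  proof -
    \<comment> \<open>Raising \<open>z i\<close> by \<open>s\<close> multiplies the numerator of the
      weight by this exponential and can only lower the denominator.\<close>
    have "exp (- (s / \<epsilon>)) * (\<integral>x. soft \<epsilon> z i x \<partial>P) \<le> (\<integral>x. soft \<epsilon> (z(i := z i + s)) i x \<partial>P)" if s: "0 < s" for s
    proof -
      have "exp (- (s / \<epsilon>)) * (\<integral>x. soft \<epsilon> z i x \<partial>P) = (\<integral>x. exp (- (s / \<epsilon>)) * soft \<epsilon> z i x \<partial>P)" by simp
      also have "\<dots> \<le> (\<integral>x. soft \<epsilon> (z(i := z i + s)) i x \<partial>P)"
      proof (rule integral_mono)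
        fix x
        let ?z = "z(i := z i + s)"
        have "exp (score ?z i x / \<epsilon>) = exp (- (s / \<epsilon>)) * exp (score z i x / \<epsilon>)"
          by (simp add: score_def mult_exp_exp diff_divide_distrib add_divide_distrib)
        moreover have "(\<Sum>j\<in>S. exp (score ?z j x / \<epsilon>)) \<le> (\<Sum>j\<in>S. exp (score z j x / \<epsilon>))"
          using s \<epsilon> by (intro sum_mono) (auto simp: score_def divide_right_mono)
        ultimately show "exp (- (s / \<epsilon>)) * soft \<epsilon> z i x \<le> soft \<epsilon> ?z i x"
          using soft_denominator_pos[of z x \<epsilon>] soft_denominator_pos[of ?z x \<epsilon>]
          by (simp add: soft_def frac_le)
      qed (use int[OF i] in auto)
      finally show ?thesis .
    qed
    moreover have "((\<lambda>s. exp (- (s / \<epsilon>)) * (\<integral>x. soft \<epsilon> z i x \<partial>P)) \<longlongrightarrow> (\<integral>x. soft \<epsilon> z i x \<partial>P)) (at_right 0)"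
      using \<epsilon> by (auto intro!: tendsto_eq_intros)
    ultimately show ?thesis by (intro exI[of _ "\<lambda>s. exp (- (s / \<epsilon>)) * (\<integral>x. soft \<epsilon> z i x \<partial>P)"]) simp
  qed
  note char = potential_characterisation[where U = "lse \<epsilon>" and w = "soft \<epsilon>",
      OF _ _ lse_lip[OF \<epsilon>] score_le_lse[OF \<epsilon>] lse_shift[OF \<epsilon>] lse_translate soft_nonneg soft_le_1 _ _ lower]
  show "\<exists>z. minimiser (entropic_objective P R \<epsilon>) z"
    unfolding entropic_objective_eq[abs_def] by (rule char(1)) (auto simp: sum_soft lse_grad[OF \<epsilon>])
  fix z i assume z: "minimiser (entropic_objective P R \<epsilon>) z" and i: "i \<in> S"
  show "(\<integral>x. soft \<epsilon> z i x \<partial>P) = pmf R i"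
    by (rule char(2)[OF _ _ _ _ _ _ _ z[unfolded entropic_objective_eq[abs_def]] i]) (auto simp: sum_soft lse_grad[OF \<epsilon>])
qed

lemma good_of_masses: "(\<And>i. i \<in> S \<Longrightarrow> measure P (cell z i) = pmf R i) \<Longrightarrow> (\<And>i. i \<in> S \<Longrightarrow> c \<le> pmf R i) \<Longrightarrow> good c z"
  by (simp add: good_def)

text \<open>Uniqueness is the case of equal masses in the stability theorem: the cells of two
  minimisers both have the masses of \<open>R\<close>, so the difference of the potentials
  vanishes.\<close>

lemma brenier_potential:
  shows "brenier_potential P R \<in> normalised_potentials R"
    and "i \<in> S \<Longrightarrow> measure P (cell (brenier_potential P R) i) = pmf R i"
proof -
  have unique: "z = z'" if z: "minimiser (brenier_objective P R) z"
    and z': "minimiser (brenier_objective P R) z'" for z z'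
  proof -
    define c where "c = Min (pmf R ` S)"
    have c: "0 < c" "\<And>y. y \<in> S \<Longrightarrow> c \<le> pmf R y"
      using finite_S S_nonempty pmf_R_pos by (auto simp: c_def)
    have n: "\<forall>y. y \<notin> S \<longrightarrow> z y = 0" "sum z S = 0" "\<forall>y. y \<notin> S \<longrightarrow> z' y = 0" "sum z' S = 0"
      using z z' by (auto simp: is_arg_min_real_iff normalised_iff)
    obtain C \<delta> where C: "0 < \<delta>" "\<And>z z' y. good c z \<Longrightarrow> sum z S = 0 \<Longrightarrow> sum z' S = 0 \<Longrightarrow>
       mass_dist z z' < \<delta> \<Longrightarrow> y \<in> S \<Longrightarrow>
       \<bar>z' y - z y\<bar> \<le> C * mass_dist z z'"
      by (rule cell_mass_stability[OF c(1)]) (rule that)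
    have 0: "mass_dist z z' = 0"
      by (intro sum.neutral) (simp add: brenier_minimiser(2)[OF z] brenier_minimiser(2)[OF z'])
    have "good c z" by (rule good_of_masses) (use brenier_minimiser(2)[OF z] c in auto)
    then have "z' y = z y" if "y \<in> S" for y using C(2)[of z z' y] C(1) n 0 that by simp
    then show ?thesis using n by (metis ext)
  qed
  then have ex1: "\<exists>!z. minimiser (brenier_objective P R) z"
    using brenier_minimiser(1) by blast
  have *: "minimiser (brenier_objective P R) (brenier_potential P R)"
    unfolding brenier_potential_def by (rule theI'[OF ex1])
  then show "brenier_potential P R \<in> normalised_potentials R" by (simp add: is_arg_min_def)
  show "i \<in> S \<Longrightarrow> measure P (cell (brenier_potential P R) i) = pmf R i"
    by (rule brenier_minimiser(2)[OF *])
qed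

text \<open>Since the softmax masses of two minimisers agree, their symmetrised relative entropy
  integrates to 0 and all weights agree at some point. Equality of the weights at one point already
  makes the potentials differ by a constant on \<open>S\<close>, which the normalisation forces to
  be 0.\<close>

lemma entropic_potential:
  assumes \<epsilon>: "0 < \<epsilon>"
  shows "entropic_potential P R \<epsilon> \<in> normalised_potentials R"
    and "i \<in> S \<Longrightarrow> (\<integral>x. soft \<epsilon> (entropic_potential P R \<epsilon>) i x \<partial>P) = pmf R i"
proof -
  interpret prob_space P by (rule prob_P)
  have unique: "z = z'" if z: "minimiser (entropic_objective P R \<epsilon>) z"
    and z': "minimiser (entropic_objective P R \<epsilon>) z'" for z z'
  proof -
    have n: "\<forall>y. y \<notin> S \<longrightarrow> z y = 0" "sum z S = 0" "\<forall>y. y \<notin> S \<longrightarrow> z' y = 0" "sum z' S = 0"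
      using z z' by (auto simp: is_arg_min_real_iff normalised_iff)
    define h where "h i = z' i - z i" for i
    have sumh: "sum h S = 0" using n by (simp add: h_def sum_subtractf)
    define p q where "p i x = soft \<epsilon> z i x" and "q i x = soft \<epsilon> z' i x" for i x
    have [measurable]: "p i \<in> borel_measurable borel" "q i \<in> borel_measurable borel" for i
      unfolding p_def[abs_def] q_def[abs_def] by measurable
    have int: "integrable P (p i)" "integrable P (q i)" if "i \<in> S" for i
      by (auto intro!: integrable_P[of _ 1] simp: p_def q_def soft_nonneg soft_le_1[OF that])
    define f where "f x = (\<Sum>i\<in>S. h i * (p i x - q i x))" for x
    have fint: "integrable P f" unfolding f_def using int by auto
    have "(\<integral>x. f x \<partial>P) = (\<Sum>i\<in>S. h i * ((\<integral>x. p i x \<partial>P) - (\<integral>x. q i x \<partial>P)))"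
      unfolding f_def using int by (subst Bochner_Integration.integral_sum) auto
    also have "\<dots> = 0"
      by (intro sum.neutral) (simp add: p_def q_def entropic_minimiser(2)[OF \<epsilon> z] entropic_minimiser(2)[OF \<epsilon> z'])
    finally have f0: "(\<integral>x. f x \<partial>P) = 0" .
    \<comment> \<open>The difference of the two \<open>lse\<close> values is the same for all
      \<open>i\<close> and drops out because both families of weights sum to one.\<close>
    have feq: "f x = (\<Sum>i\<in>S. \<epsilon> * ((q i x - p i x) * (ln (q i x) - ln (p i x))))" for x
    proof -
      define l where "l = lse \<epsilon> z' x - lse \<epsilon> z x"
      have "h i = - (\<epsilon> * (ln (q i x) - ln (p i x))) - l" for i
        using ln_soft_diff[OF \<epsilon>, of z' i x z] by (simp add: h_def p_def q_def l_def)
      moreover have "(- (\<epsilon> * d) - l) * (a - b) = \<epsilon> * ((b - a) * d) + l * (b - a)" for a b d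
        by (simp add: algebra_simps)
      ultimately have "f x = (\<Sum>i\<in>S. \<epsilon> * ((q i x - p i x) * (ln (q i x) - ln (p i x))) + l * (q i x - p i x))"
        unfolding f_def by (simp only:)
      also have "\<dots> = (\<Sum>i\<in>S. \<epsilon> * ((q i x - p i x) * (ln (q i x) - ln (p i x)))) + l * ((\<Sum>i\<in>S. q i x) - (\<Sum>i\<in>S. p i x))"
        by (simp add: sum.distrib sum_distrib_left sum_subtractf right_diff_distrib)
      finally show ?thesis by (simp add: p_def q_def sum_soft)
    qed
    have pos: "0 < p i x" "0 < q i x" for i x by (auto simp: p_def q_def soft_pos)
    have nn: "0 \<le> \<epsilon> * ((q i x - p i x) * (ln (q i x) - ln (p i x)))" for i x
      using \<epsilon> diff_mult_ln_diff_nonneg(1)[OF pos(2) pos(1)] by simp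
    have "AE x in P. f x = 0"
      using integral_nonneg_eq_0_iff_AE[OF fint] f0 nn by (simp add: feq sum_nonneg)
    then obtain x where x: "f x = 0"
      using AE_False by (metis (mono_tags, lifting) eventually_mono)
    have eq: "p i x = q i x" if i: "i \<in> S" for i
    proof -
      have "\<epsilon> * ((q i x - p i x) * (ln (q i x) - ln (p i x))) = 0"
        using x unfolding feq by (subst (asm) sum_nonneg_eq_0_iff) (use finite_S nn i in auto)
      then show ?thesis using \<epsilon> diff_mult_ln_diff_nonneg(2)[OF pos(2) pos(1), of i x i x] by simp
    qed
    define l where "l = lse \<epsilon> z' x - lse \<epsilon> z x"
    have hl: "h i = - l" if "i \<in> S" for i
      using ln_soft_diff[OF \<epsilon>, of z' i x z] eq[OF that] by (simp add: h_def p_def q_def l_def)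
    then have "sum h S = card S * (- l)" by simp
    then have "l = 0" using sumh finite_S S_nonempty by simp
    then have "z' i = z i" if "i \<in> S" for i using hl[OF that] by (simp add: h_def)
    then show ?thesis using n by (metis ext)
  qed
  then have ex1: "\<exists>!z. minimiser (entropic_objective P R \<epsilon>) z"
    using entropic_minimiser(1)[OF \<epsilon>] by blast
  have *: "minimiser (entropic_objective P R \<epsilon>) (entropic_potential P R \<epsilon>)"
    unfolding entropic_potential_def by (rule theI'[OF ex1])
  then show "entropic_potential P R \<epsilon> \<in> normalised_potentials R" by (simp add: is_arg_min_def)
  show "i \<in> S \<Longrightarrow> (\<integral>x. soft \<epsilon> (entropic_potential P R \<epsilon>) i x \<partial>P) = pmf R i"
    by (rule entropic_minimiser(2)[OF \<epsilon> *])
qed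

end

section \<open>Distance of the entropic and Brenier maps\<close>

context semidiscrete
begin

lemma soft_hard_uniform:
  assumes c: "0 < c" and \<alpha>: "0 < \<alpha>" "\<alpha> \<le> 1"
  obtains C where "0 \<le> C" "\<And>i z \<epsilon> K f. i \<in> S \<Longrightarrow> good c z \<Longrightarrow> 0 < \<epsilon> \<Longrightarrow> \<epsilon> \<le> 1 \<Longrightarrow> test_function \<alpha> K f \<Longrightarrow>
     soft_defect \<epsilon> z i f \<le> C * K * \<epsilon> powr (1 + \<alpha>)"
proof -
  define bound where "bound i C \<longleftrightarrow> 0 \<le> C \<and> (\<forall>z \<epsilon> K f. good c z \<longrightarrow> 0 < \<epsilon> \<longrightarrow> \<epsilon> \<le> 1 \<longrightarrow> test_function \<alpha> K f \<longrightarrow>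
     soft_defect \<epsilon> z i f \<le> C * K * \<epsilon> powr (1 + \<alpha>))" for i C
  have "\<exists>C. bound i C" if "i \<in> S" for i
    unfolding bound_def by (rule soft_hard_estimate[OF that c \<alpha>]) blast
  then obtain C where C: "\<forall>i\<in>S. bound i (C i)" using bchoice[of S bound] by blast
  then have C0: "0 \<le> C i" if "i \<in> S" for i using that by (auto simp: bound_def)
  show thesis
  proof (rule that[of "sum C S"])
    show "0 \<le> sum C S" by (intro sum_nonneg C0)
    fix i z f and \<epsilon> K :: real
    assume i: "i \<in> S" and a: "good c z" "0 < \<epsilon>" "\<epsilon> \<le> 1" and f: "test_function \<alpha> K f"
    note K = test_functionD(4)[OF f]
    have "soft_defect \<epsilon> z i f \<le> C i * K * \<epsilon> powr (1 + \<alpha>)"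
      using C i a f unfolding bound_def by simp
    also have "\<dots> \<le> sum C S * K * \<epsilon> powr (1 + \<alpha>)"
      using K i finite_S C0 by (intro mult_right_mono member_le_sum) auto
    finally show "soft_defect \<epsilon> z i f \<le>
      sum C S * K * \<epsilon> powr (1 + \<alpha>)" .
  qed
qed

lemma crude_uniform:
  obtains C where "0 \<le> C" "\<And>i z \<epsilon>. i \<in> S \<Longrightarrow> 0 < \<epsilon> \<Longrightarrow>
     \<bar>(\<integral>x. soft \<epsilon> z i x \<partial>P) - measure P (cell z i)\<bar> \<le> C * \<epsilon>"
proof -
  define bound where "bound i C \<longleftrightarrow> 0 \<le> C \<and> (\<forall>z \<epsilon>. 0 < \<epsilon> \<longrightarrow>
     \<bar>(\<integral>x. soft \<epsilon> z i x \<partial>P) - measure P (cell z i)\<bar> \<le> C * \<epsilon>)" for i C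
  have "\<exists>C. bound i C" if "i \<in> S" for i
    unfolding bound_def by (rule soft_hard_crude[OF that]) blast
  then obtain C where C: "\<forall>i\<in>S. bound i (C i)" using bchoice[of S bound] by blast
  then have C0: "0 \<le> C i" if "i \<in> S" for i using that by (auto simp: bound_def)
  show thesis
  proof (rule that[of "sum C S"])
    show "0 \<le> sum C S" by (intro sum_nonneg C0)
    fix i z and \<epsilon> :: real assume i: "i \<in> S" and \<epsilon>: "0 < \<epsilon>"
    have "\<bar>(\<integral>x. soft \<epsilon> z i x \<partial>P) - measure P (cell z i)\<bar> \<le> C i * \<epsilon>"
      using C i \<epsilon> unfolding bound_def by simp
    also have "\<dots> \<le> sum C S * \<epsilon>"
      using \<epsilon> i finite_S C0 by (intro mult_right_mono member_le_sum) auto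
    finally show "\<bar>(\<integral>x. soft \<epsilon> z i x \<partial>P) - measure P (cell z i)\<bar> \<le> sum C S * \<epsilon>" .
  qed
qed

text \<open>A difference of two potential values changes by at most \<open>2 * m\<close>, so points
  that enter or leave the cell are within \<open>2 * m\<close> of one of its bounding hyperplanes:
  slabs of thickness \<open>4 * m\<close>.\<close>

lemma cell_perturbation:
  assumes i: "i \<in> S" and m: "0 \<le> m" "\<And>j. j \<in> S \<Longrightarrow> \<bar>z j - z' j\<bar> \<le> m"
  shows "(\<integral>x. \<bar>indicator (cell z i) x - indicator (cell z' i) x\<bar> \<partial>P) \<le>
    (\<Sum>j\<in>S. 4 * \<rho>max * slab_const (i - j)) * m"
proof -
  interpret prob_space P by (rule prob_P)
  define T where "T j = {x. z i - z j - 2 * m \<le> x \<bullet> (i - j) \<and> x \<bullet> (i - j) \<le> (z i - z j - 2 * m) + 4 * m}" for j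
  have sub: "x \<in> (\<Union>j\<in>S - {i}. T j)"
    if x: "x \<in> cell y i" "x \<notin> cell y' i" and yy: "y = z \<and> y' = z' \<or> y = z' \<and> y' = z" for x y y'
  proof -
    obtain j where j: "j \<in> S" "score y' i x < score y' j x" using x by (auto simp: cell_def not_le)
    then have "j \<noteq> i" by auto
    have "score y j x \<le> score y i x" by (rule cellD[OF x(1) j(1)])
    then have "x \<in> T j" using j(2) yy m(2)[OF i] m(2)[OF j(1)] by (auto simp: T_def score_def inner_diff_right)
    then show ?thesis using j \<open>j \<noteq> i\<close> by blast
  qed
  have Tm: "(\<Union>j\<in>S - {i}. T j) \<in> sets borel" using finite_S by (intro sets.finite_UN) (auto simp: T_def)
  have "(\<integral>x. \<bar>indicat_real (cell z i) x - indicat_real (cell z' i) x\<bar> \<partial>P) \<le> (\<integral>x. indicator (\<Union>j\<in>S - {i}. T j) x \<partial>P)"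
  proof (rule integral_mono)
    show "integrable P (\<lambda>x. \<bar>indicator (cell z i) x - indicator (cell z' i) x\<bar> :: real)"
      by (rule integrable_P[of _ 1]) (auto split: split_indicator)
    show "integrable P (indicator (\<Union>j\<in>S - {i}. T j) :: 'a \<Rightarrow> real)"
      using Tm by (intro integrable_P[of _ 1]) (auto split: split_indicator)
    show "\<bar>indicator (cell z i) x - indicator (cell z' i) x\<bar> \<le> (indicator (\<Union>j\<in>S - {i}. T j) x :: real)" for x
      using sub[of x z z'] sub[of x z' z] by (cases "x \<in> cell z i"; cases "x \<in> cell z' i") auto
  qed
  also have "\<dots> = prob (\<Union>j\<in>S - {i}. T j)" using Tm by simp
  also have "\<dots> \<le> (\<Sum>j\<in>S - {i}. prob (T j))"
    using finite_S by (intro measure_UNION_le) (auto simp: T_def)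
  also have "\<dots> \<le> (\<Sum>j\<in>S - {i}. \<rho>max * slab_const (i - j) * (4 * m))"
    unfolding T_def using m by (intro sum_mono measure_P_slab) auto
  also have "\<dots> \<le> (\<Sum>j\<in>S. \<rho>max * slab_const (i - j) * (4 * m))"
    using finite_S m \<rho>_bounds(4) slab_const_nonneg by (intro sum_mono2 mult_nonneg_nonneg) auto
  also have "\<dots> = (\<Sum>j\<in>S. 4 * \<rho>max * slab_const (i - j)) * m"
    unfolding sum_distrib_right by (intro sum.cong refl) simp
  finally show ?thesis .
qed

end

section \<open>Representation and measurability of the two maps\<close>

context semidiscrete_target
begin

lemma entropic_map_eq:
  "entropic_map P R \<epsilon> x = (\<Sum>y\<in>S. soft \<epsilon> (entropic_potential P R \<epsilon>) y x *\<^sub>R y)"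
  by (simp add: entropic_map_def soft_def score_def set_R Let_def)

lemma brenier_map_cell:
  assumes "x \<in> X"
  shows "brenier_map X P R x \<in> S" "x \<in> cell (brenier_potential P R) (brenier_map X P R x)"
proof -
  let ?z = "brenier_potential P R"
  have iff: "x \<in> laguerre_cell X S ?z y \<longleftrightarrow> x \<in> cell ?z y" if "y \<in> S" for y
    using assms that by (auto simp: laguerre_cell_def cell_def score_def inner_diff_left inner_commute algebra_simps)
  obtain k where "k \<in> S" "x \<in> cell ?z k" using in_some_cell by blast
  then have "\<exists>y. y \<in> set_pmf R \<and> x \<in> laguerre_cell X (set_pmf R) ?z y" using iff by (auto simp: set_R)
  from someI_ex[OF this] have "brenier_map X P R x \<in> set_pmf R \<and>
      x \<in> laguerre_cell X (set_pmf R) ?z (brenier_map X P R x)"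
    unfolding brenier_map_def .
  then show "brenier_map X P R x \<in> S" "x \<in> cell ?z (brenier_map X P R x)"
    using iff by (auto simp: set_R)
qed

text \<open>The selected point depends on \<open>x\<close> only through the set of cells containing
  it, so the map is a finite combination of indicators indexed by the subsets of
  \<open>S\<close>.\<close>

lemma brenier_map_measurable[measurable]: "brenier_map X P R \<in> borel_measurable borel"
proof -
  let ?L = "laguerre_cell X S (brenier_potential P R)"
  define pick where "pick A = (SOME y. y \<in> A)" for A :: "'a set"
  define level where "level A = {x. \<forall>y\<in>S. x \<in> ?L y \<longleftrightarrow> y \<in> A}" for A
  have [measurable]: "?L y \<in> sets borel" for y
    unfolding laguerre_cell_def by (measurable, use finite_S in simp, measurable)
  have [measurable]: "level A \<in> sets borel" for A
    unfolding level_def using finite_S by measurable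
  have eq: "brenier_map X P R x = (\<Sum>A\<in>Pow S. indicator (level A) x *\<^sub>R pick A)" for x
  proof -
    define A where "A = {y\<in>S. x \<in> ?L y}"
    have "(\<Sum>A\<in>Pow S. indicator (level A) x *\<^sub>R pick A) = (\<Sum>B\<in>Pow S. if B = A then pick B else 0)"
      by (intro sum.cong refl) (auto simp: level_def A_def split: split_indicator)
    also have "\<dots> = pick A" using finite_S by (simp add: A_def)
    finally show ?thesis by (simp add: pick_def A_def brenier_map_def set_R)
  qed
  show ?thesis by (subst measurable_cong[OF eq]) measurable
qed

lemma entropic_map_measurable[measurable]: "entropic_map P R \<epsilon> \<in> borel_measurable borel"
  by (subst measurable_cong[OF entropic_map_eq]) measurable

lemma brenier_map_indicator:
  "AE x in P. brenier_map X P R x = (\<Sum>y\<in>S. indicator (cell (brenier_potential P R) y) x *\<^sub>R y)"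
  using AE_unique_cell[of "brenier_potential P R"] AE_X
proof eventually_elim
  case (elim x)
  let ?k = "brenier_map X P R x"
  have k: "?k \<in> S" "x \<in> cell (brenier_potential P R) ?k" using brenier_map_cell[OF elim(2)] by auto
  have "(\<Sum>y\<in>S. indicator (cell (brenier_potential P R) y) x *\<^sub>R y) = (\<Sum>y\<in>S. if y = ?k then y else 0)"
    using elim(1) k by (intro sum.cong) (auto split: split_indicator)
  also have "\<dots> = ?k" using k finite_S by simp
  finally show ?case by simp
qed

end

section \<open>Comparison of the maps, uniform over targets\<close>

context semidiscrete
begin

text \<open>The constants precede \<open>R\<close> and therefore serve every empirical target with
  support \<open>S\<close> and masses at least \<open>c\<close>. The difference of the maps is split
  at the cells of the entropic potential: softmax weights against these cells, then these cells
  against those of the Brenier potential.\<close>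

theorem entropic_brenier_estimate:
  assumes c: "0 < c" and \<alpha>: "0 < \<alpha>" "\<alpha> \<le> 1"
  obtains C \<epsilon>0 where "0 \<le> C" "0 < \<epsilon>0" "\<And>R \<epsilon> \<phi>. set_pmf R = S \<Longrightarrow> (\<And>y. y \<in> S \<Longrightarrow> c \<le> pmf R y) \<Longrightarrow> 0 < \<epsilon> \<Longrightarrow> \<epsilon> \<le> \<epsilon>0 \<Longrightarrow>
    \<phi> \<in> borel_measurable borel \<Longrightarrow> (\<And>x. x \<in> X \<Longrightarrow> norm (\<phi> x) \<le> 1) \<Longrightarrow>
    (\<And>x y. x \<in> X \<Longrightarrow> y \<in> X \<Longrightarrow> norm (\<phi> x - \<phi> y) \<le> norm (x - y) powr \<alpha>) \<Longrightarrow>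
    \<bar>\<integral>x. \<phi> x \<bullet> (entropic_map P R \<epsilon> x - brenier_map X P R x) \<partial>P\<bar> \<le> C * \<epsilon> powr (1 + \<alpha>)"
proof -
  interpret prob_space P by (rule prob_P)
  obtain L where "L-lipschitz_on X \<rho>" using \<rho>_lipschitz by blast
  then have L: "0 \<le> L" "\<And>x y. x \<in> X \<Longrightarrow> y \<in> X \<Longrightarrow> \<bar>\<rho> x - \<rho> y\<bar> \<le> L * norm (x - y)"
    by (auto simp: lipschitz_on_def dist_real_def dist_norm)
  have c2: "0 < c / 2" using c by simp
  have half: "b * (d / (2 * b)) = d / 2" if "b \<noteq> 0" for b d :: real using that by simp
  obtain C1 where C1: "0 \<le> C1" "\<And>i z \<epsilon>. i \<in> S \<Longrightarrow> 0 < \<epsilon> \<Longrightarrow>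
     \<bar>(\<integral>x. soft \<epsilon> z i x \<partial>P) - measure P (cell z i)\<bar> \<le> C1 * \<epsilon>"
    by (rule crude_uniform) (rule that)
  obtain C2 where C2: "0 \<le> C2" "\<And>i z \<epsilon> K f. i \<in> S \<Longrightarrow> good (c/2) z \<Longrightarrow> 0 < \<epsilon> \<Longrightarrow> \<epsilon> \<le> 1 \<Longrightarrow> test_function 1 K f \<Longrightarrow>
     soft_defect \<epsilon> z i f \<le> C2 * K * \<epsilon> powr (1 + 1)"
    by (rule soft_hard_uniform[OF c2 zero_less_one order_refl]) (rule that, assumption, blast)
  obtain C3 where C3: "0 \<le> C3" "\<And>i z \<epsilon> K f. i \<in> S \<Longrightarrow> good (c/2) z \<Longrightarrow> 0 < \<epsilon> \<Longrightarrow> \<epsilon> \<le> 1 \<Longrightarrow> test_function \<alpha> K f \<Longrightarrow>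
     soft_defect \<epsilon> z i f \<le> C3 * K * \<epsilon> powr (1 + \<alpha>)"
    by (rule soft_hard_uniform[OF c2 \<alpha>]) (rule that, assumption, blast)
  obtain C4 \<delta> where C4: "0 \<le> C4" "0 < \<delta>" "\<And>z z' y. good c z \<Longrightarrow> sum z S = 0 \<Longrightarrow> sum z' S = 0 \<Longrightarrow>
       mass_dist z z' < \<delta> \<Longrightarrow> y \<in> S \<Longrightarrow>
       \<bar>z' y - z y\<bar> \<le> C4 * mass_dist z z'"
    by (rule cell_mass_stability[OF c]) (rule that)
  define K\<rho> where "K\<rho> = \<rho>max + L"
  define A where "A = card S * (C2 * K\<rho>)"
  have A: "0 \<le> A" using C2(1) L \<rho>_bounds(4) by (simp add: A_def K\<rho>_def)
  define K\<alpha> where "K\<alpha> = \<rho>max + L * (1 + 2 * rad)"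
  have K\<alpha>: "0 \<le> K\<alpha>" using L rad \<rho>_bounds(4) by (simp add: K\<alpha>_def)
  define C5 where "C5 = (\<Sum>y\<in>S. C3 * (norm y * K\<alpha>))"
  define C6 where "C6 = (\<Sum>y\<in>S. norm y * ((\<Sum>j\<in>S. 4 * \<rho>max * slab_const (y - j)) * (C4 * A)))"
  \<comment> \<open>The second entry keeps mass \<open>c / 2\<close> in the cells of the entropic
    potential; the third brings the mass difference below the threshold \<open>\<delta>\<close> of
    the stability theorem.\<close>
  define \<epsilon>0 where "\<epsilon>0 = min 1 (min (c / (2 * (C1 + 1))) (\<delta> / (2 * (A + 1))))"
  have C50: "0 \<le> C5" unfolding C5_def using C3(1) K\<alpha> by (intro sum_nonneg) auto
  have C60: "0 \<le> C6" unfolding C6_def using C4(1) A \<rho>_bounds(4) slab_const_nonneg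
    by (intro sum_nonneg mult_nonneg_nonneg) auto
  show thesis
  proof (rule that[of "C5 + C6" \<epsilon>0])
    show "0 \<le> C5 + C6" using C50 C60 by simp
    show "0 < \<epsilon>0" using c C1(1) C4(2) A by (simp add: \<epsilon>0_def)
    fix R :: "'a pmf" and \<epsilon> :: real and \<phi> :: "'a \<Rightarrow> 'a"
    assume R: "set_pmf R = S" "\<And>y. y \<in> S \<Longrightarrow> c \<le> pmf R y" and \<epsilon>: "0 < \<epsilon>" "\<epsilon> \<le> \<epsilon>0"
      and \<phi>m[measurable]: "\<phi> \<in> borel_measurable borel" and \<phi>1: "\<And>x. x \<in> X \<Longrightarrow> norm (\<phi> x) \<le> 1"
      and \<phi>2: "\<And>x y. x \<in> X \<Longrightarrow> y \<in> X \<Longrightarrow> norm (\<phi> x - \<phi> y) \<le> norm (x - y) powr \<alpha>"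
    interpret T: semidiscrete_target X P \<rho> S R by unfold_locales (rule R)
    define z where "z = entropic_potential P R \<epsilon>"
    define z0 where "z0 = brenier_potential P R"
    have \<epsilon>1: "\<epsilon> \<le> 1" using \<epsilon> by (simp add: \<epsilon>0_def)
    have soft_mass: "(\<integral>x. soft \<epsilon> z i x \<partial>P) = pmf R i" if "i \<in> S" for i
      unfolding z_def by (rule T.entropic_potential(2)[OF \<epsilon>(1) that])
    have cell_mass: "prob (cell z0 i) = pmf R i" if "i \<in> S" for i
      unfolding z0_def by (rule T.brenier_potential(2)[OF that])
    have sums: "sum z S = 0" "sum z0 S = 0"
      using T.entropic_potential(1)[OF \<epsilon>(1)] T.brenier_potential(1)
      by (auto simp: z_def z0_def T.normalised_iff)
    have good0: "good c z0" using cell_mass R(2) by (simp add: good_def)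
    have good1: "good (c/2) z"
      unfolding good_def
    proof
      fix i assume i: "i \<in> S"
      have "C1 * \<epsilon> \<le> (C1 + 1) * (c / (2 * (C1 + 1)))"
        using C1(1) \<epsilon> by (intro mult_mono) (auto simp: \<epsilon>0_def)
      also have "\<dots> = c / 2" by (rule half) (use C1(1) in simp)
      finally have "C1 * \<epsilon> \<le> c / 2" .
      then show "c / 2 \<le> prob (cell z i)"
        using C1(2)[OF i \<epsilon>(1), of z] soft_mass[OF i] R(2)[OF i] by linarith
    qed
    have softint: "integrable P (soft \<epsilon> z i)" if "i \<in> S" for i
      by (rule integrable_P[of _ 1]) (use soft_le_1[OF that, of \<epsilon> z] soft_nonneg[of \<epsilon> z i] in auto)
    \<comment> \<open>Both potentials reproduce the masses of \<open>R\<close>, one through softmax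
      weights and one through cells, so the difference of cell masses is the softmax defect of the
      single potential \<open>z\<close>. Its test function is the density, with exponent 1.\<close>
    have mass_diff: "\<bar>prob (cell z0 i) - prob (cell z i)\<bar> \<le> C2 * K\<rho> * \<epsilon>\<^sup>2" if i: "i \<in> S" for i
    proof -
      have "prob (cell z0 i) - prob (cell z i) = (\<integral>x. soft \<epsilon> z i x - indicator (cell z i) x \<partial>P)"
      proof -
        have "integrable P (indicat_real (cell z i))" by (rule integrable_P[of _ 1]) (auto split: split_indicator)
        then show ?thesis using softint[OF i] by (simp add: soft_mass[OF i] cell_mass[OF i])
      qed
      also have "\<dots> = (\<integral>x. indicator X x * ((soft \<epsilon> z i x - indicator (cell z i) x) * \<rho> x) \<partial>lborel)"
        by (subst integral_P) (auto simp: mult.commute)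
      also have "\<bar>\<dots>\<bar> \<le> C2 * K\<rho> * \<epsilon> powr (1 + 1)"
      proof (rule C2(2)[OF i good1 \<epsilon>(1) \<epsilon>1])
        show "test_function 1 K\<rho> \<rho>" unfolding test_function_def
        proof (intro conjI ballI)
          show "\<bar>\<rho> x\<bar> \<le> K\<rho>" if "x \<in> X" for x using \<rho>_bounds(3)[OF that] \<rho>_nonneg[of x] L by (simp add: K\<rho>_def)
          show "\<bar>\<rho> x - \<rho> y\<bar> \<le> K\<rho> * norm (x - y) powr 1" if "x \<in> X" "y \<in> X" for x y
          proof -
            have "\<bar>\<rho> x - \<rho> y\<bar> \<le> L * norm (x - y)" by (rule L(2)[OF that])
            also have "\<dots> \<le> K\<rho> * norm (x - y)" using \<rho>_bounds(4) by (intro mult_right_mono) (auto simp: K\<rho>_def)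
            finally show ?thesis by simp
          qed
        qed simp
      qed
      finally show ?thesis using \<epsilon>(1) by simp
    qed
    define \<Delta> where "\<Delta> = (mass_dist z0 z)"
    have \<Delta>: "\<Delta> \<le> A * \<epsilon>\<^sup>2"
    proof -
      have "\<Delta> \<le> (\<Sum>i\<in>S. C2 * K\<rho> * \<epsilon>\<^sup>2)" unfolding \<Delta>_def by (intro sum_mono mass_diff)
      then show ?thesis by (simp add: A_def)
    qed
    have "\<Delta> < \<delta>"
    proof -
      have "\<epsilon>\<^sup>2 \<le> \<epsilon>" using \<epsilon>(1) \<epsilon>1 by (simp add: power2_eq_square mult_left_le)
      then have "A * \<epsilon>\<^sup>2 \<le> (A + 1) * (\<delta> / (2 * (A + 1)))"
        using A \<epsilon> by (intro mult_mono) (auto simp: \<epsilon>0_def)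
      also have "\<dots> = \<delta> / 2" by (rule half) (use A in simp)
      finally show ?thesis using \<Delta> C4(2) by simp
    qed
    then have zz: "\<bar>z j - z0 j\<bar> \<le> C4 * A * \<epsilon>\<^sup>2" if "j \<in> S" for j
      using C4(3)[OF good0 sums(2,1) _ that] mult_left_mono[OF \<Delta> C4(1)] by (simp add: \<Delta>_def mult.assoc)
    have \<epsilon>sq: "\<epsilon>\<^sup>2 \<le> \<epsilon> powr (1 + \<alpha>)"
    proof -
      have "\<epsilon>\<^sup>2 = \<epsilon> powr 2" using \<epsilon> by simp
      also have "\<dots> \<le> \<epsilon> powr (1 + \<alpha>)" using \<epsilon>(1) \<epsilon>1 \<alpha> by (intro powr_mono') auto
      finally show ?thesis .
    qed
    have \<phi>y: "\<bar>\<phi> x \<bullet> y\<bar> \<le> norm y" if "x \<in> X" for x y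
      using Cauchy_Schwarz_ineq2[of "\<phi> x" y] mult_right_mono[OF \<phi>1[OF that], of "norm y"] by simp
    have bulk: "\<bar>\<integral>x. (\<phi> x \<bullet> y) * (soft \<epsilon> z y x - indicator (cell z y) x) \<partial>P\<bar> \<le> C3 * (norm y * K\<alpha>) * \<epsilon> powr (1 + \<alpha>)"
      if y: "y \<in> S" for y
    proof -
      have "(\<integral>x. (\<phi> x \<bullet> y) * (soft \<epsilon> z y x - indicator (cell z y) x) \<partial>P) =
          (\<integral>x. indicator X x * ((soft \<epsilon> z y x - indicator (cell z y) x) * ((\<phi> x \<bullet> y) * \<rho> x)) \<partial>lborel)"
        by (subst integral_P) (auto simp: mult_ac)
      also have "\<bar>\<dots>\<bar> \<le> C3 * (norm y * K\<alpha>) * \<epsilon> powr (1 + \<alpha>)"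
      proof (rule C3(2)[OF y good1 \<epsilon>(1) \<epsilon>1])
        show "test_function \<alpha> (norm y * K\<alpha>) (\<lambda>x. (\<phi> x \<bullet> y) * \<rho> x)" unfolding test_function_def
        proof (intro conjI ballI)
          show "\<bar>(\<phi> x \<bullet> y) * \<rho> x\<bar> \<le> norm y * K\<alpha>" if "x \<in> X" for x
          proof -
            have "\<bar>(\<phi> x \<bullet> y) * \<rho> x\<bar> \<le> norm y * \<rho>max"
              unfolding abs_mult using \<phi>y[OF that] \<rho>_bounds(3)[OF that] \<rho>_nonneg[of x] by (intro mult_mono) auto
            also have "\<dots> \<le> norm y * K\<alpha>" using L rad by (intro mult_left_mono) (auto simp: K\<alpha>_def)
            finally show ?thesis .
          qed
          show "\<bar>(\<phi> x \<bullet> y) * \<rho> x - (\<phi> x' \<bullet> y) * \<rho> x'\<bar> \<le> norm y * K\<alpha> * norm (x - x') powr \<alpha>"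
            if x: "x \<in> X" "x' \<in> X" for x x'
          proof -
            let ?d = "norm (x - x')"
            \<comment> \<open>Turns the Lipschitz bound of the density into a Hoelder bound: short
              distances use \<open>\<alpha> \<le> 1\<close>, long ones the bound
              \<open>2 * rad\<close> on distances in \<open>X\<close>.\<close>
            have dd: "?d \<le> (1 + 2 * rad) * ?d powr \<alpha>"
            proof (cases "?d \<le> 1")
              case True
              show ?thesis
              proof (cases "?d = 0")
                case False
                have "?d = ?d powr 1" by simp
                also have "\<dots> \<le> 1 * ?d powr \<alpha>" using True False \<alpha> powr_mono'[of \<alpha> 1 ?d] by simp
                also have "\<dots> \<le> (1 + 2 * rad) * ?d powr \<alpha>" using rad by (intro mult_right_mono) auto
                finally show ?thesis .
              qed simp
            next
              case False
              have "?d \<le> 2 * rad" using norm_triangle_ineq4[of x x'] norm_le_rad[OF x(1)] norm_le_rad[OF x(2)] by simp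
              also have "\<dots> \<le> (1 + 2 * rad) * 1" by simp
              also have "\<dots> \<le> (1 + 2 * rad) * ?d powr \<alpha>"
                using False rad \<alpha> by (intro mult_left_mono ge_one_powr_ge_zero) auto
              finally show ?thesis .
            qed
            have "(\<phi> x \<bullet> y) * \<rho> x - (\<phi> x' \<bullet> y) * \<rho> x' = ((\<phi> x - \<phi> x') \<bullet> y) * \<rho> x + (\<phi> x' \<bullet> y) * (\<rho> x - \<rho> x')"
              by (simp add: inner_diff_left algebra_simps)
            also have "\<bar>\<dots>\<bar> \<le> \<bar>(\<phi> x - \<phi> x') \<bullet> y\<bar> * \<bar>\<rho> x\<bar> + \<bar>\<phi> x' \<bullet> y\<bar> * \<bar>\<rho> x - \<rho> x'\<bar>"
              unfolding abs_mult[symmetric] by (rule abs_triangle_ineq)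
            also have "\<dots> \<le> (?d powr \<alpha> * norm y) * \<rho>max + norm y * (L * ((1 + 2 * rad) * ?d powr \<alpha>))"
            proof (intro add_mono mult_mono)
              show "\<bar>(\<phi> x - \<phi> x') \<bullet> y\<bar> \<le> ?d powr \<alpha> * norm y"
                using Cauchy_Schwarz_ineq2[of "\<phi> x - \<phi> x'" y] mult_right_mono[OF \<phi>2[OF x], of "norm y"] by simp
              show "\<bar>\<rho> x\<bar> \<le> \<rho>max" using \<rho>_bounds(3)[OF x(1)] \<rho>_nonneg[of x] by simp
              show "\<bar>\<phi> x' \<bullet> y\<bar> \<le> norm y" by (rule \<phi>y[OF x(2)])
              show "\<bar>\<rho> x - \<rho> x'\<bar> \<le> L * ((1 + 2 * rad) * ?d powr \<alpha>)"
                using L(2)[OF x] mult_left_mono[OF dd L(1)] by simp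
            qed auto
            also have "\<dots> = norm y * K\<alpha> * ?d powr \<alpha>" by (simp add: K\<alpha>_def algebra_simps)
            finally show ?thesis .
          qed
        qed simp
      qed
      finally show ?thesis .
    qed
    have move: "\<bar>\<integral>x. (\<phi> x \<bullet> y) * (indicator (cell z y) x - indicator (cell z0 y) x) \<partial>P\<bar> \<le>
        norm y * ((\<Sum>j\<in>S. 4 * \<rho>max * slab_const (y - j)) * (C4 * A)) * \<epsilon> powr (1 + \<alpha>)" if y: "y \<in> S" for y
    proof -
      have "\<bar>\<integral>x. (\<phi> x \<bullet> y) * (indicator (cell z y) x - indicator (cell z0 y) x) \<partial>P\<bar> \<le>
          (\<integral>x. \<bar>(\<phi> x \<bullet> y) * (indicator (cell z y) x - indicator (cell z0 y) x)\<bar> \<partial>P)"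
        by (rule integral_abs_bound)
      also have "\<dots> \<le> (\<integral>x. norm y * \<bar>indicator (cell z y) x - indicator (cell z0 y) x\<bar> \<partial>P)"
      proof (rule integral_mono_AE)
        show "integrable P (\<lambda>x. \<bar>(\<phi> x \<bullet> y) * (indicator (cell z y) x - indicator (cell z0 y) x)\<bar>)"
        proof (rule integrable_P[of _ "norm y"])
          show "\<bar>\<bar>(\<phi> x \<bullet> y) * (indicator (cell z y) x - indicator (cell z0 y) x)\<bar>\<bar> \<le> norm y" if "x \<in> X" for x
            using \<phi>y[OF that, of y] by (auto split: split_indicator)
        qed simp
        show "integrable P (\<lambda>x. norm y * \<bar>indicator (cell z y) x - indicator (cell z0 y) x\<bar>)"
          by (rule integrable_P[of _ "norm y"]) (auto split: split_indicator)
        show "AE x in P. \<bar>(\<phi> x \<bullet> y) * (indicator (cell z y) x - indicator (cell z0 y) x)\<bar> \<le>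
            norm y * \<bar>indicator (cell z y) x - indicator (cell z0 y) x\<bar>"
          using AE_X by eventually_elim (auto simp: abs_mult intro!: mult_right_mono \<phi>y)
      qed
      also have "\<dots> = norm y * (\<integral>x. \<bar>indicator (cell z y) x - indicator (cell z0 y) x\<bar> \<partial>P)" by simp
      also have "\<dots> \<le> norm y * ((\<Sum>j\<in>S. 4 * \<rho>max * slab_const (y - j)) * (C4 * A * \<epsilon>\<^sup>2))"
        using C4(1) A zz by (intro mult_left_mono cell_perturbation y) auto
      also have "\<dots> \<le> norm y * ((\<Sum>j\<in>S. 4 * \<rho>max * slab_const (y - j)) * (C4 * A * \<epsilon> powr (1 + \<alpha>)))"
        using C4(1) A \<epsilon>sq \<rho>_bounds(4) slab_const_nonneg
        by (intro mult_left_mono sum_nonneg mult_nonneg_nonneg) auto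
      finally show ?thesis by (simp add: mult_ac)
    qed
    define B where "B y x = (\<phi> x \<bullet> y) * (soft \<epsilon> z y x - indicator (cell z y) x)" for y x
    define D where "D y x = (\<phi> x \<bullet> y) * (indicator (cell z y) x - indicator (cell z0 y) x)" for y x
    have [measurable]: "B y \<in> borel_measurable borel" "D y \<in> borel_measurable borel" for y
      unfolding B_def D_def by measurable
    have intB: "integrable P (B y)" if y: "y \<in> S" for y
    proof (rule integrable_P[of _ "norm y * 1"])
      show "\<bar>B y x\<bar> \<le> norm y * 1" if "x \<in> X" for x
        unfolding B_def abs_mult using \<phi>y[OF that, of y] soft_le_1[OF y, of \<epsilon> z x] soft_nonneg[of \<epsilon> z y x]
        by (intro mult_mono) (auto split: split_indicator)
    qed simp
    have intD: "integrable P (D y)" for y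
    proof (rule integrable_P[of _ "norm y * 1"])
      show "\<bar>D y x\<bar> \<le> norm y * 1" if "x \<in> X" for x
        unfolding D_def abs_mult using \<phi>y[OF that, of y]
        by (intro mult_mono) (auto split: split_indicator)
    qed simp
    have "(\<integral>x. \<phi> x \<bullet> (entropic_map P R \<epsilon> x - brenier_map X P R x) \<partial>P) =
      (\<integral>x. (\<Sum>y\<in>S. B y x + D y x) \<partial>P)"
    proof (rule integral_cong_AE)
      show "AE x in P. \<phi> x \<bullet> (entropic_map P R \<epsilon> x - brenier_map X P R x) = (\<Sum>y\<in>S. B y x + D y x)"
        using T.brenier_map_indicator
      proof eventually_elim
        case (elim x)
        have "entropic_map P R \<epsilon> x - brenier_map X P R x =
            (\<Sum>y\<in>S. (soft \<epsilon> z y x - indicator (cell z0 y) x) *\<^sub>R y)"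
          unfolding elim T.entropic_map_eq z_def z0_def by (simp add: sum_subtractf scaleR_diff_left)
        then show ?case
          by (simp add: inner_sum_right B_def D_def) (intro sum.cong refl, simp add: algebra_simps)
      qed
    qed measurable
    also have "\<dots> = (\<Sum>y\<in>S. (\<integral>x. B y x \<partial>P) + (\<integral>x. D y x \<partial>P))"
      using intB intD by (simp add: Bochner_Integration.integral_sum)
    also have "\<bar>\<dots>\<bar> \<le> (\<Sum>y\<in>S. \<bar>(\<integral>x. B y x \<partial>P) + (\<integral>x. D y x \<partial>P)\<bar>)" by (rule sum_abs)
    also have "\<dots> \<le> (\<Sum>y\<in>S. C3 * (norm y * K\<alpha>) * \<epsilon> powr (1 + \<alpha>) +
        norm y * ((\<Sum>j\<in>S. 4 * \<rho>max * slab_const (y - j)) * (C4 * A)) * \<epsilon> powr (1 + \<alpha>))"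
      using bulk move unfolding B_def D_def by (intro sum_mono order_trans[OF abs_triangle_ineq] add_mono) auto
    also have "\<dots> = (C5 + C6) * \<epsilon> powr (1 + \<alpha>)"
      unfolding C5_def C6_def sum.distrib[symmetric] sum_distrib_right
      by (intro sum.cong refl) (simp only: distrib_right)
    finally show "\<bar>\<integral>x. \<phi> x \<bullet> (entropic_map P R \<epsilon> x - brenier_map X P R x) \<partial>P\<bar> \<le> (C5 + C6) * \<epsilon> powr (1 + \<alpha>)" .
  qed
qed

end

section \<open>Perturbation of convergence in distribution\<close>

lemma space_borel_of: "space (borel_of T) = topspace T"
  unfolding borel_of_def by (rule space_measure_of) (auto dest: openin_subset)

lemma sets_borel_of_open: "openin T U \<Longrightarrow> U \<in> sets (borel_of T)"
  unfolding borel_of_def by (subst sets_measure_of) (auto dest: openin_subset)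

lemma continuous_map_borel_of_measurable:
  fixes f :: "'b \<Rightarrow> real"
  assumes "continuous_map T euclideanreal f"
  shows "f \<in> borel_measurable (borel_of T)"
proof (rule borel_measurableI)
  fix U :: "real set" assume "open U"
  then have "openin T {x \<in> topspace T. f x \<in> U}"
    using assms by (intro openin_continuous_map_preimage) auto
  moreover have "f -` U \<inter> space (borel_of T) = {x \<in> topspace T. f x \<in> U}"
    by (auto simp: space_borel_of)
  ultimately show "f -` U \<inter> space (borel_of T) \<in> sets (borel_of T)" by (simp add: sets_borel_of_open)
qed

section \<open>Lipschitz envelopes and perturbation\<close>

context Metric_space
begin

text \<open>The Pasch-Hausdorff envelope, that is the infimal convolution with \<open>k * d\<close>;
  for bounded \<open>f\<close> and \<open>k \<ge> 0\<close> it is the largest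
  \<open>k\<close>-Lipschitz minorant.\<close>

definition lip_env :: "real \<Rightarrow> ('a \<Rightarrow> real) \<Rightarrow> 'a \<Rightarrow> real" where
  "lip_env k f x = Inf ((\<lambda>y. f y + k * d x y) ` M)"

lemma lip_env_bounds:
  assumes B: "\<And>y. y \<in> M \<Longrightarrow> \<bar>f y\<bar> \<le> B" and k: "0 \<le> k" and x: "x \<in> M"
  shows "lip_env k f x \<le> f x" "- B \<le> lip_env k f x"
    "\<And>y. y \<in> M \<Longrightarrow> lip_env k f x \<le> f y + k * d x y"
proof -
  have low: "- B \<le> f y + k * d x y" if "y \<in> M" for y
    using B[OF that] mult_nonneg_nonneg[OF k nonneg[of x y]] by linarith
  have bdd: "bdd_below ((\<lambda>y. f y + k * d x y) ` M)" using low by (intro bdd_belowI2) auto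
  show up: "lip_env k f x \<le> f y + k * d x y" if "y \<in> M" for y
    unfolding lip_env_def by (rule cInf_lower[OF _ bdd]) (use that in auto)
  show "lip_env k f x \<le> f x" using up[OF x] x by simp
  show "- B \<le> lip_env k f x" unfolding lip_env_def using low x by (intro cInf_greatest) auto
qed

lemma lip_env_lipschitz:
  assumes B: "\<And>y. y \<in> M \<Longrightarrow> \<bar>f y\<bar> \<le> B" and k: "0 \<le> k" and x: "x \<in> M" and x': "x' \<in> M"
  shows "\<bar>lip_env k f x - lip_env k f x'\<bar> \<le> k * d x x'"
proof -
  have one: "lip_env k f x - k * d x x' \<le> lip_env k f x'" if x: "x \<in> M" and x': "x' \<in> M" for x x'
    unfolding lip_env_def[of k f x']
  proof (rule cInf_greatest)
    fix v assume "v \<in> (\<lambda>y. f y + k * d x' y) ` M"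
    then obtain y where y: "y \<in> M" "v = f y + k * d x' y" by blast
    have "k * d x y \<le> k * (d x x' + d x' y)" using triangle[OF x x' y(1)] k by (intro mult_left_mono) auto
    then show "lip_env k f x - k * d x x' \<le> v"
      using lip_env_bounds(3)[where f = f, OF B k x y(1)] y(2) by (simp add: distrib_left)
  qed (use x' in auto)
  from one[OF x x'] one[OF x' x] show ?thesis by (simp add: abs_le_iff commute)
qed

lemma lip_env_continuous:
  assumes B: "\<And>y. y \<in> M \<Longrightarrow> \<bar>f y\<bar> \<le> B" and k: "0 \<le> k"
  shows "continuous_map mtopology euclideanreal (lip_env k f)"
proof -
  have "continuous_map mtopology (Met_TC.mtopology :: real topology) (lip_env k f)"
    unfolding metric_continuous_map[OF Met_TC.Metric_space_axioms]
  proof (intro conjI ballI allI impI)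
    fix a and e :: real assume a: "a \<in> M" and e: "0 < e"
    show "\<exists>\<delta>>0. \<forall>x. x \<in> M \<and> d a x < \<delta> \<longrightarrow> dist (lip_env k f a) (lip_env k f x) < e"
    proof (intro exI[of _ "e / (k + 1)"] conjI allI impI)
      show "0 < e / (k + 1)" using e k by simp
      fix x assume x: "x \<in> M \<and> d a x < e / (k + 1)"
      have "dist (lip_env k f a) (lip_env k f x) \<le> k * d a x"
        unfolding dist_real_def by (rule lip_env_lipschitz[where f = f, OF B k a]) (use x in auto)
      also have "\<dots> \<le> (k + 1) * d a x" using nonneg[of a x] by (intro mult_right_mono) auto
      also have "\<dots> < e" using x k by (simp add: field_simps)
      finally show "dist (lip_env k f a) (lip_env k f x) < e" .
    qed
  qed simp
  then show ?thesis by simp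
qed

text \<open>Points farther than \<open>\<delta>\<close> from \<open>x\<close> are ruled out once
  \<open>k * \<delta>\<close> reaches the oscillation bound \<open>2 * B\<close>; the nearer ones
  are handled by continuity of \<open>f\<close> at \<open>x\<close>.\<close>

lemma lip_env_tendsto:
  assumes B: "\<And>y. y \<in> M \<Longrightarrow> \<bar>f y\<bar> \<le> B" and cont: "continuous_map mtopology euclideanreal f" and x: "x \<in> M"
  shows "(\<lambda>k. lip_env (real k) f x) \<longlonglongrightarrow> f x"
proof (rule LIMSEQ_I)
  fix r :: real assume r: "0 < r"
  have "continuous_map mtopology (Met_TC.mtopology :: real topology) f" using cont by simp
  then obtain \<delta> where \<delta>: "0 < \<delta>" "\<And>y. y \<in> M \<Longrightarrow> d x y < \<delta> \<Longrightarrow> dist (f x) (f y) < r / 2"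
    unfolding metric_continuous_map[OF Met_TC.Metric_space_axioms] using x r by (meson half_gt_zero)
  obtain k0 :: nat where k0: "2 * B / \<delta> \<le> real k0" using real_arch_simple by blast
  show "\<exists>no. \<forall>k\<ge>no. norm (lip_env (real k) f x - f x) < r"
  proof (intro exI[of _ k0] allI impI)
    fix k assume k: "k0 \<le> k"
    have "f x - r / 2 \<le> lip_env (real k) f x"
      unfolding lip_env_def
    proof (rule cInf_greatest)
      fix v assume "v \<in> (\<lambda>y. f y + real k * d x y) ` M"
      then obtain y where y: "y \<in> M" "v = f y + real k * d x y" by blast
      show "f x - r / 2 \<le> v"
      proof (cases "d x y < \<delta>")
        case True
        have "dist (f x) (f y) < r / 2" by (rule \<delta>(2)[OF y(1) True])
        moreover have "0 \<le> real k * d x y" by simp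
        ultimately show ?thesis unfolding y(2) dist_real_def by linarith
      next
        case False
        have "2 * B / \<delta> * \<delta> \<le> real k * d x y"
          using k0 k False \<delta> by (intro mult_mono) auto
        then have "2 * B \<le> real k * d x y" using \<delta> by simp
        then show ?thesis using B[OF x] B[OF y(1)] y(2) r by linarith
      qed
    qed (use x in auto)
    moreover have "lip_env (real k) f x \<le> f x" by (rule lip_env_bounds(1)[where f = f, OF B _ x]) auto
    ultimately show "norm (lip_env (real k) f x - f x) < r" using r by simp
  qed
qed

text \<open>
  Distances of random elements need not be measurable on a non-separable space, so
  closeness in probability is expressed by events on which the distance is uniformly small.
\<close>

lemma converges_in_distribution_perturb:
  assumes PM: "prob_space PM" and PN: "prob_space PN"
    and conv: "converges_in_distribution mtopology PM Z PN G"
    and Z': "\<And>n. Z' n \<in> completion PM \<rightarrow>\<^sub>M borel_of mtopology"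
    and A: "\<And>n. A n \<in> sets PM" "(\<lambda>n. measure PM (A n)) \<longlonglongrightarrow> 1"
    and \<delta>: "\<delta> \<longlonglongrightarrow> 0" "\<And>n. 0 \<le> \<delta> n"
    and close: "\<forall>\<^sub>F n in sequentially. \<forall>\<omega>\<in>A n. d (Z n \<omega>) (Z' n \<omega>) \<le> \<delta> n"
  shows "converges_in_distribution mtopology PM Z' PN G"
proof -
  interpret pm: prob_space "completion PM" by (rule prob_space.prob_space_completion[OF PM])
  interpret pm0: prob_space PM by (rule PM)
  interpret pn: prob_space PN by (rule PN)
  have Z: "\<And>n. Z n \<in> completion PM \<rightarrow>\<^sub>M borel_of mtopology" and G: "G \<in> PN \<rightarrow>\<^sub>M borel_of mtopology"
    and lim: "\<And>f. continuous_map mtopology euclideanreal f \<Longrightarrow> bounded (f ` M) \<Longrightarrow>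
        (\<lambda>n. \<integral>\<omega>. f (Z n \<omega>) \<partial>completion PM) \<longlonglongrightarrow> (\<integral>\<omega>. f (G \<omega>) \<partial>PN)"
    using conv by (auto simp: converges_in_distribution_def)
  have inM: "Z n \<omega> \<in> M" "Z' n \<omega> \<in> M" if "\<omega> \<in> space PM" for n \<omega>
    using measurable_space[OF Z, of \<omega> n] measurable_space[OF Z', of \<omega> n] that by (auto simp: space_borel_of)
  have GM: "G \<omega> \<in> M" if "\<omega> \<in> space PN" for \<omega>
    using measurable_space[OF G that] by (simp add: space_borel_of)
  have int: "integrable (completion PM) (\<lambda>\<omega>. f (W n \<omega>))"
    if "continuous_map mtopology euclideanreal f" "\<And>y. y \<in> M \<Longrightarrow> \<bar>f y\<bar> \<le> B" "W = Z \<or> W = Z'" for f W n B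
  proof (rule pm.integrable_const_bound[of _ B])
    show "(\<lambda>\<omega>. f (W n \<omega>)) \<in> borel_measurable (completion PM)"
      using measurable_compose[OF _ continuous_map_borel_of_measurable[OF that(1)]] Z Z' that(3) by blast
    show "AE \<omega> in completion PM. norm (f (W n \<omega>)) \<le> B"
      using that inM by (intro AE_I2) auto
  qed
  have intG: "integrable PN (\<lambda>\<omega>. f (G \<omega>))"
    if "continuous_map mtopology euclideanreal f" "\<And>y. y \<in> M \<Longrightarrow> \<bar>f y\<bar> \<le> B" for f B
  proof (rule pn.integrable_const_bound[of _ B])
    show "(\<lambda>\<omega>. f (G \<omega>)) \<in> borel_measurable PN"
      by (rule measurable_compose[OF G continuous_map_borel_of_measurable[OF that(1)]])
    show "AE \<omega> in PN. norm (f (G \<omega>)) \<le> B" using that GM by (intro AE_I2) auto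
  qed
  \<comment> \<open>One-sided bounds suffice, since \<open>- f\<close> is again bounded and
    continuous. A one-sided bound lets \<open>f\<close> be replaced by a Lipschitz minorant with
    nearly the same integral under the limit.\<close>
  have lower: "\<forall>\<^sub>F n in sequentially. (\<integral>\<omega>. f (G \<omega>) \<partial>PN) - e < (\<integral>\<omega>. f (Z' n \<omega>) \<partial>completion PM)"
    if f: "continuous_map mtopology euclideanreal f" and B: "\<And>y. y \<in> M \<Longrightarrow> \<bar>f y\<bar> \<le> B" and e: "0 < e" for f B e
  proof -
    have "(\<lambda>k. \<integral>\<omega>. lip_env (real k) f (G \<omega>) \<partial>PN) \<longlonglongrightarrow> (\<integral>\<omega>. f (G \<omega>) \<partial>PN)"
    proof (rule integral_dominated_convergence[where w = "\<lambda>_. B"])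
      show "(\<lambda>\<omega>. f (G \<omega>)) \<in> borel_measurable PN" using intG[OF f B] by simp
      show "(\<lambda>\<omega>. lip_env (real k) f (G \<omega>)) \<in> borel_measurable PN" for k
        by (rule measurable_compose[OF G continuous_map_borel_of_measurable[OF lip_env_continuous[where f = f, OF B]]]) auto
      show "AE \<omega> in PN. (\<lambda>k. lip_env (real k) f (G \<omega>)) \<longlonglongrightarrow> f (G \<omega>)"
        using lip_env_tendsto[where f = f, OF B f GM] by (intro AE_I2) auto
      show "AE \<omega> in PN. norm (lip_env (real k) f (G \<omega>)) \<le> B" for k
      proof (rule AE_I2)
        fix \<omega> assume "\<omega> \<in> space PN"
        note g = GM[OF this]
        show "norm (lip_env (real k) f (G \<omega>)) \<le> B"
          using lip_env_bounds(1,2)[where f = f and k = "real k", OF B _ g] B[OF g] by (simp add: abs_le_iff)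
      qed
    qed simp
    then have "\<forall>\<^sub>F k in sequentially. (\<integral>\<omega>. f (G \<omega>) \<partial>PN) - e / 3 < (\<integral>\<omega>. lip_env (real k) f (G \<omega>) \<partial>PN)"
      using e by (intro order_tendstoD(1)) auto
    then obtain k where k: "(\<integral>\<omega>. f (G \<omega>) \<partial>PN) - e / 3 < (\<integral>\<omega>. lip_env (real k) f (G \<omega>) \<partial>PN)"
      using eventually_happens' sequentially_bot by blast
    define g where "g = lip_env (real k) f"
    have gc: "continuous_map mtopology euclideanreal g" unfolding g_def by (rule lip_env_continuous[where f = f, OF B]) auto
    have gB: "\<bar>g y\<bar> \<le> B" and gf: "g y \<le> f y" if "y \<in> M" for y
      using lip_env_bounds(1,2)[where f = f and k = "real k", OF B _ that] B[OF that] by (auto simp: g_def)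
    have "bounded (g ` M)" using gB by (intro boundedI[of _ B]) auto
    then have ev1: "\<forall>\<^sub>F n in sequentially. (\<integral>\<omega>. g (G \<omega>) \<partial>PN) - e / 3 < (\<integral>\<omega>. g (Z n \<omega>) \<partial>completion PM)"
      using lim[OF gc] e by (intro order_tendstoD(1)) auto
    \<comment> \<open>With \<open>k\<close> fixed beforehand, replacing \<open>Z n\<close> by
      \<open>Z' n\<close> costs at most \<open>real k * \<delta> n\<close> on \<open>A n\<close> and
      at most \<open>2 * B\<close> off it.\<close>
    have "(\<lambda>n. real k * \<delta> n + 2 * B * (1 - measure PM (A n))) \<longlonglongrightarrow> real k * 0 + 2 * B * (1 - 1)"
      by (intro tendsto_intros \<delta> A)
    then have ev2: "\<forall>\<^sub>F n in sequentially. real k * \<delta> n + 2 * B * (1 - measure PM (A n)) < e / 3"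
      using e by (intro order_tendstoD(2)) auto
    show ?thesis
      using ev1 ev2 close
    proof eventually_elim
      case (elim n)
      have Am: "A n \<in> sets (completion PM)" using A(1) by simp
      have "(\<integral>\<omega>. g (Z n \<omega>) \<partial>completion PM) - (\<integral>\<omega>. g (Z' n \<omega>) \<partial>completion PM) =
          (\<integral>\<omega>. g (Z n \<omega>) - g (Z' n \<omega>) \<partial>completion PM)"
        using int[OF gc gB] by (subst Bochner_Integration.integral_diff) auto
      also have "\<dots> \<le> (\<integral>\<omega>. real k * \<delta> n + 2 * B * indicator (space PM - A n) \<omega> \<partial>completion PM)"
      proof (rule integral_mono)
        show "integrable (completion PM) (\<lambda>\<omega>. g (Z n \<omega>) - g (Z' n \<omega>))"
          using int[OF gc gB] by (intro Bochner_Integration.integrable_diff) auto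
        have "space (completion PM) - A n \<in> sets (completion PM)" using Am by blast
        then show "integrable (completion PM) (\<lambda>\<omega>. real k * \<delta> n + 2 * B * indicator (space PM - A n) \<omega>)"
          by (intro Bochner_Integration.integrable_add integrable_mult_right) (auto simp: pm.emeasure_eq_measure)
        fix \<omega> assume "\<omega> \<in> space (completion PM)"
        then have \<omega>: "\<omega> \<in> space PM" by simp
        show "g (Z n \<omega>) - g (Z' n \<omega>) \<le> real k * \<delta> n + 2 * B * indicator (space PM - A n) \<omega>"
        proof (cases "\<omega> \<in> A n")
          case True
          have "\<bar>g (Z n \<omega>) - g (Z' n \<omega>)\<bar> \<le> real k * d (Z n \<omega>) (Z' n \<omega>)"
            unfolding g_def by (rule lip_env_lipschitz[where f = f, OF B _ inM(1)[OF \<omega>] inM(2)[OF \<omega>]]) auto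
          also have "\<dots> \<le> real k * \<delta> n" using elim(3) True by (intro mult_left_mono) auto
          finally show ?thesis using True by simp
        next
          case False
          then show ?thesis using gB[OF inM(1)[OF \<omega>, of n]] gB[OF inM(2)[OF \<omega>, of n]] \<delta>(2)[of n] \<omega>
            by (simp add: abs_le_iff add_increasing)
        qed
      qed
      also have "\<dots> = real k * \<delta> n + 2 * B * measure (completion PM) (space PM - A n)"
      proof -
        have "space (completion PM) - A n \<in> sets (completion PM)" using Am by blast
        moreover have "(space PM - A n) \<inter> space PM = space PM - A n" by blast
        ultimately show ?thesis using pm.prob_space
          by (subst Bochner_Integration.integral_add) (auto simp: pm.emeasure_eq_measure)
      qed
      also have "measure (completion PM) (space PM - A n) = 1 - measure PM (A n)"
        using pm0.prob_compl[OF A(1)[of n]] A(1)[of n] by (simp add: sets.compl_sets)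
      finally have 1: "(\<integral>\<omega>. g (Z n \<omega>) \<partial>completion PM) - e / 3 < (\<integral>\<omega>. g (Z' n \<omega>) \<partial>completion PM)"
        using elim(2) by linarith
      have "(\<integral>\<omega>. g (Z' n \<omega>) \<partial>completion PM) \<le> (\<integral>\<omega>. f (Z' n \<omega>) \<partial>completion PM)"
        using int[OF gc gB] int[OF f B] gf inM by (intro integral_mono) auto
      then show ?case using 1 k elim(1) by (simp add: g_def)
    qed
  qed
  show ?thesis
    unfolding converges_in_distribution_def
  proof (intro conjI allI impI)
    show "Z' n \<in> completion PM \<rightarrow>\<^sub>M borel_of mtopology" for n by (rule Z')
    show "G \<in> PN \<rightarrow>\<^sub>M borel_of mtopology" by (rule G)
    fix f assume f: "continuous_map mtopology euclideanreal f \<and> bounded (f ` topspace mtopology)"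
    then obtain B where B: "\<And>y. y \<in> M \<Longrightarrow> \<bar>f y\<bar> \<le> B" by (auto simp: bounded_iff)
    have c: "continuous_map mtopology euclideanreal f" "continuous_map mtopology euclideanreal (\<lambda>x. - f x)"
      using f by (auto intro: continuous_map_minus)
    show "(\<lambda>n. \<integral>\<omega>. f (Z' n \<omega>) \<partial>completion PM) \<longlonglongrightarrow> (\<integral>\<omega>. f (G \<omega>) \<partial>PN)"
    proof (rule order_tendstoI)
      fix a assume "a < (\<integral>\<omega>. f (G \<omega>) \<partial>PN)"
      then show "\<forall>\<^sub>F n in sequentially. a < (\<integral>\<omega>. f (Z' n \<omega>) \<partial>completion PM)"
        using lower[OF c(1) B, of "(\<integral>\<omega>. f (G \<omega>) \<partial>PN) - a"] by simp
    next
      fix a assume a: "(\<integral>\<omega>. f (G \<omega>) \<partial>PN) < a"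
      have "\<bar>- f y\<bar> \<le> B" if "y \<in> M" for y using B[OF that] by simp
      from lower[OF c(2) this, of "a - (\<integral>\<omega>. f (G \<omega>) \<partial>PN)"] a
      show "\<forall>\<^sub>F n in sequentially. (\<integral>\<omega>. f (Z' n \<omega>) \<partial>completion PM) < a" by simp
    qed
  qed
qed

end

text \<open>A preimage is a finite union of the events \<open>E k\<close> together with part of a
  null set, whatever the sigma-algebra of the target. This handles random elements of a
  non-separable space.\<close>

lemma measurable_completion_finite_valued:
  assumes K: "finite K" and \<Omega>: "\<And>k. k \<in> K \<Longrightarrow> E k \<in> sets M"
    and AE: "AE \<omega> in M. \<exists>k\<in>K. \<omega> \<in> E k" and val: "\<And>k \<omega>. k \<in> K \<Longrightarrow> \<omega> \<in> E k \<Longrightarrow> f \<omega> = h k"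
    and sp: "\<And>\<omega>. \<omega> \<in> space M \<Longrightarrow> f \<omega> \<in> space N"
  shows "f \<in> completion M \<rightarrow>\<^sub>M N"
proof (rule measurableI)
  fix B assume B: "B \<in> sets N"
  have "(\<Union>k\<in>{k\<in>K. h k \<in> B}. E k) \<in> sets M" using K \<Omega> by (intro sets.finite_UN) auto
  then have U: "(\<Union>k\<in>{k\<in>K. h k \<in> B}. E k) \<in> sets (completion M)" by simp
  obtain N' where N': "N' \<in> null_sets M" "{\<omega>\<in>space M. \<not> (\<exists>k\<in>K. \<omega> \<in> E k)} \<subseteq> N'"
    using AE by (auto simp: eventually_ae_filter)
  define R where "R = {\<omega>\<in>space M. f \<omega> \<in> B \<and> \<not> (\<exists>k\<in>K. \<omega> \<in> E k)}"
  have "R \<subseteq> N'" using N'(2) by (auto simp: R_def)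
  then have R: "R \<in> sets (completion M)" by (rule null_sets_completion[OF N'(1)])
  have "f -` B \<inter> space (completion M) = (\<Union>k\<in>{k\<in>K. h k \<in> B}. E k) \<union> R"
    using val sets.sets_into_space[OF \<Omega>] by (auto simp: R_def)
  then show "f -` B \<inter> space (completion M) \<in> sets (completion M)" using U R by auto
qed (use sp in auto)

section \<open>The dual Hoelder space\<close>

text \<open>The complement is the union of all open null sets, and the Lindelof property reduces
  this union to a countable one.\<close>

lemma emeasure_compl_topological_support:
  fixes P :: "'a::euclidean_space measure"
  assumes "sets P = sets borel"
  shows "emeasure P (- topological_support P) = 0"
proof -
  define \<U> where "\<U> = {U. open U \<and> emeasure P U = 0}"
  have eq: "- topological_support P = \<Union>\<U>"
    by (auto simp: topological_support_def \<U>_def not_gr_zero)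
  obtain \<V> where \<V>: "\<V> \<subseteq> \<U>" "countable \<V>" "\<Union>\<V> = \<Union>\<U>"
    using Lindelof[of \<U>] by (auto simp: \<U>_def)
  have "(\<Union>V\<in>\<V>. V) \<in> null_sets P"
    using \<V> assms by (intro null_sets_UN') (auto simp: \<U>_def null_sets_def)
  then show ?thesis using eq \<V>(3) by (auto dest: null_setsD1)
qed

context
  fixes X :: "'a::euclidean_space set" and \<alpha> :: real
begin

lemma holder_space_bounds:
  assumes "\<phi> \<in> holder_space X \<alpha>"
  shows "x \<in> X \<Longrightarrow> norm (\<phi> x) \<le> enn2real (holder_norm X \<alpha> \<phi>)"
    and "x \<in> X \<Longrightarrow> y \<in> X \<Longrightarrow> norm (\<phi> x - \<phi> y) \<le> enn2real (holder_norm X \<alpha> \<phi>) * norm (x - y) powr \<alpha>"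
proof -
  have fin: "holder_norm X \<alpha> \<phi> < top" using assms by (simp add: holder_space_def)
  let ?q = "\<lambda>(x, y). ennreal (norm (\<phi> x - \<phi> y) / norm (x - y) powr \<alpha>)"
  show "norm (\<phi> x) \<le> enn2real (holder_norm X \<alpha> \<phi>)" if "x \<in> X"
  proof -
    have "ennreal (norm (\<phi> x)) \<le> (SUP x\<in>X. ennreal (norm (\<phi> x)))" using that by (rule SUP_upper)
    also have "\<dots> \<le> holder_norm X \<alpha> \<phi>" by (simp add: holder_norm_def)
    finally have "ennreal (norm (\<phi> x)) \<le> holder_norm X \<alpha> \<phi>" .
    from enn2real_mono[OF this fin] show ?thesis by simp
  qed
  show "norm (\<phi> x - \<phi> y) \<le> enn2real (holder_norm X \<alpha> \<phi>) * norm (x - y) powr \<alpha>" if "x \<in> X" "y \<in> X"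
  proof (cases "x = y")
    case False
    have "?q (x, y) \<le> (SUP p\<in>{(x, y). x \<in> X \<and> y \<in> X \<and> x \<noteq> y}. ?q p)"
      by (rule SUP_upper) (use that False in auto)
    also have "\<dots> \<le> holder_norm X \<alpha> \<phi>" by (simp add: holder_norm_def)
    finally have "?q (x, y) \<le> holder_norm X \<alpha> \<phi>" .
    from enn2real_mono[OF this fin]
    have "norm (\<phi> x - \<phi> y) / norm (x - y) powr \<alpha> \<le> enn2real (holder_norm X \<alpha> \<phi>)" by simp
    moreover have "0 < norm (x - y) powr \<alpha>" using False by simp
    ultimately show ?thesis by (simp add: pos_divide_le_eq)
  qed simp
qed

lemma holder_spaceI:
  assumes "\<And>x. x \<notin> X \<Longrightarrow> \<phi> x = 0" and "\<And>x. x \<in> X \<Longrightarrow> norm (\<phi> x) \<le> K"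
    and "\<And>x y. x \<in> X \<Longrightarrow> y \<in> X \<Longrightarrow> norm (\<phi> x - \<phi> y) \<le> L * norm (x - y) powr \<alpha>"
  shows "\<phi> \<in> holder_space X \<alpha>"
proof -
  have "holder_norm X \<alpha> \<phi> \<le> ennreal K + ennreal L"
    unfolding holder_norm_def
  proof (intro add_mono SUP_least)
    show "ennreal (norm (\<phi> x)) \<le> ennreal K" if "x \<in> X" for x using assms(2)[OF that] by (rule ennreal_leI)
    fix p assume "p \<in> {(x, y). x \<in> X \<and> y \<in> X \<and> x \<noteq> y}"
    then obtain x y where p: "p = (x, y)" "x \<in> X" "y \<in> X" "x \<noteq> y" by blast
    have "0 < norm (x - y) powr \<alpha>" using p by simp
    then have "norm (\<phi> x - \<phi> y) / norm (x - y) powr \<alpha> \<le> L"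
      using assms(3)[OF p(2,3)] by (simp add: pos_divide_le_eq)
    then show "(case p of (x, y) \<Rightarrow> ennreal (norm (\<phi> x - \<phi> y) / norm (x - y) powr \<alpha>)) \<le> ennreal L"
      using p by (simp add: ennreal_leI)
  qed
  also have "\<dots> < \<infinity>" by simp
  finally show ?thesis using assms(1) by (simp add: holder_space_def)
qed

lemma holder_space_add:
  assumes "\<phi> \<in> holder_space X \<alpha>" "\<psi> \<in> holder_space X \<alpha>"
  shows "(\<lambda>x. \<phi> x + \<psi> x) \<in> holder_space X \<alpha>"
proof (rule holder_spaceI)
  let ?K = "enn2real (holder_norm X \<alpha> \<phi>) + enn2real (holder_norm X \<alpha> \<psi>)"
  show "\<phi> x + \<psi> x = 0" if "x \<notin> X" for x using assms that by (simp add: holder_space_def)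
  show "norm (\<phi> x + \<psi> x) \<le> ?K" if "x \<in> X" for x
    using norm_triangle_ineq[of "\<phi> x" "\<psi> x"] holder_space_bounds(1)[OF assms(1) that] holder_space_bounds(1)[OF assms(2) that]
    by linarith
  show "norm ((\<phi> x + \<psi> x) - (\<phi> y + \<psi> y)) \<le> ?K * norm (x - y) powr \<alpha>" if "x \<in> X" "y \<in> X" for x y
  proof -
    have eq: "(\<phi> x + \<psi> x) - (\<phi> y + \<psi> y) = (\<phi> x - \<phi> y) + (\<psi> x - \<psi> y)" by simp
    show ?thesis unfolding eq distrib_right
      using norm_triangle_ineq[of "\<phi> x - \<phi> y" "\<psi> x - \<psi> y"]
        holder_space_bounds(2)[OF assms(1) that] holder_space_bounds(2)[OF assms(2) that]
      by linarith
  qed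
qed

lemma holder_space_scale:
  assumes "\<phi> \<in> holder_space X \<alpha>"
  shows "(\<lambda>x. c *\<^sub>R \<phi> x) \<in> holder_space X \<alpha>"
  using assms by (auto simp: holder_space_def holder_norm_scale ennreal_mult_less_top)

lemma holder_space_measurable:
  assumes \<phi>: "\<phi> \<in> holder_space X \<alpha>" and X: "X \<in> sets borel" and \<alpha>: "0 < \<alpha>"
  shows "\<phi> \<in> borel_measurable borel"
proof -
  let ?K = "enn2real (holder_norm X \<alpha> \<phi>)"
  have "continuous_on X \<phi>"
    unfolding continuous_on_def
  proof
    fix x assume x: "x \<in> X"
    have "((\<lambda>y. ?K * norm (y - x) powr \<alpha>) \<longlongrightarrow> ?K * norm (x - x) powr \<alpha>) (at x within X)"
      using \<alpha> by (intro tendsto_intros tendsto_powr') auto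
    then have "((\<lambda>y. ?K * norm (y - x) powr \<alpha>) \<longlongrightarrow> 0) (at x within X)" by simp
    moreover have "\<forall>\<^sub>F y in at x within X. norm (\<phi> y - \<phi> x) \<le> ?K * norm (y - x) powr \<alpha>"
      using holder_space_bounds(2)[OF \<phi> _ x] by (auto simp: eventually_at_filter)
    ultimately have "((\<lambda>y. \<phi> y - \<phi> x) \<longlongrightarrow> 0) (at x within X)" by (rule Lim_null_comparison[rotated])
    then show "(\<phi> \<longlongrightarrow> \<phi> x) (at x within X)" by (simp add: LIM_zero_iff)
  qed
  then have "(\<lambda>x. indicator X x *\<^sub>R \<phi> x) \<in> borel_measurable borel"
    using X by (rule borel_measurable_continuous_on_indicator[rotated])
  moreover have "(\<lambda>x. indicator X x *\<^sub>R \<phi> x) = \<phi>"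
    using \<phi> by (auto simp: holder_space_def split: split_indicator)
  ultimately show ?thesis by simp
qed

end

lemma dual_dist_le:
  assumes "0 \<le> \<delta>" "\<And>\<phi>. \<phi> \<in> holder_space X \<alpha> \<Longrightarrow> holder_norm X \<alpha> \<phi> \<le> 1 \<Longrightarrow> \<bar>l \<phi> - l' \<phi>\<bar> \<le> \<delta>"
  shows "dual_dist X \<alpha> l l' \<le> \<delta>"
proof -
  have "(SUP \<phi>\<in>{\<phi>\<in>holder_space X \<alpha>. holder_norm X \<alpha> \<phi> \<le> 1}. ennreal \<bar>l \<phi> - l' \<phi>\<bar>) \<le> ennreal \<delta>"
    using assms(2) by (intro SUP_least ennreal_leI) auto
  then show ?thesis unfolding dual_dist_def dual_norm_def using assms(1) by (intro enn2real_leI) auto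
qed

context convex_density
begin

lemma integrable_inner_holder:
  assumes \<phi>: "\<phi> \<in> holder_space X \<alpha>" and \<alpha>: "0 < \<alpha>" and T: "T \<in> borel_measurable borel"
    and B: "\<And>x. x \<in> X \<Longrightarrow> norm (T x) \<le> B"
  shows "integrable P (\<lambda>x. \<phi> x \<bullet> T x)"
    and "\<bar>\<integral>x. \<phi> x \<bullet> T x \<partial>P\<bar> \<le> B * enn2real (holder_norm X \<alpha> \<phi>)"
proof -
  interpret prob_space P by (rule prob_P)
  have [measurable]: "\<phi> \<in> borel_measurable borel" by (rule holder_space_measurable[OF \<phi> _ \<alpha>]) simp
  note T[measurable]
  let ?K = "enn2real (holder_norm X \<alpha> \<phi>)"
  have le: "\<bar>\<phi> x \<bullet> T x\<bar> \<le> ?K * B" if "x \<in> X" for x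
  proof -
    have "\<bar>\<phi> x \<bullet> T x\<bar> \<le> norm (\<phi> x) * norm (T x)" by (rule Cauchy_Schwarz_ineq2)
    also have "\<dots> \<le> ?K * B"
      using holder_space_bounds(1)[OF \<phi> that] B[OF that] by (intro mult_mono) auto
    finally show ?thesis .
  qed
  show int: "integrable P (\<lambda>x. \<phi> x \<bullet> T x)"
    by (rule integrable_const_bound[of _ "?K * B"]) (use AE_X le in \<open>auto elim!: eventually_mono\<close>)
  have "\<bar>\<integral>x. \<phi> x \<bullet> T x \<partial>P\<bar> \<le> (\<integral>x. \<bar>\<phi> x \<bullet> T x\<bar> \<partial>P)" by (rule integral_abs_bound)
  also have "\<dots> \<le> (\<integral>x. ?K * B \<partial>P)"
    using int AE_X le by (intro integral_mono_AE) (auto elim!: eventually_mono)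
  also have "\<dots> = B * ?K" using prob_space by simp
  finally show "\<bar>\<integral>x. \<phi> x \<bullet> T x \<partial>P\<bar> \<le> B * ?K" .
qed

lemma dual_embedding_in_dual:
  assumes \<alpha>: "0 < \<alpha>" and T: "T \<in> borel_measurable borel" and B: "\<And>x. x \<in> X \<Longrightarrow> norm (T x) \<le> B"
  shows "dual_embedding X \<alpha> P T \<in> holder_dual X \<alpha>"
  unfolding holder_dual_def
proof (intro CollectI conjI allI ballI impI)
  show "dual_embedding X \<alpha> P T \<phi> = 0" if "\<phi> \<notin> holder_space X \<alpha>" for \<phi>
    using that by (simp add: dual_embedding_def)
  show "dual_embedding X \<alpha> P T (\<lambda>x. \<phi> x + \<psi> x) = dual_embedding X \<alpha> P T \<phi> + dual_embedding X \<alpha> P T \<psi>"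
    if "\<phi> \<in> holder_space X \<alpha>" "\<psi> \<in> holder_space X \<alpha>" for \<phi> \<psi>
    using that integrable_inner_holder(1)[OF _ \<alpha> T B]
    by (simp add: dual_embedding_def holder_space_add inner_add_left)
  show "dual_embedding X \<alpha> P T (\<lambda>x. c *\<^sub>R \<phi> x) = c * dual_embedding X \<alpha> P T \<phi>" if "\<phi> \<in> holder_space X \<alpha>" for \<phi> c
    using that by (simp add: dual_embedding_def holder_space_scale)
  show "\<exists>K. \<forall>\<phi>\<in>holder_space X \<alpha>. \<bar>dual_embedding X \<alpha> P T \<phi>\<bar> \<le> K * enn2real (holder_norm X \<alpha> \<phi>)"
    using integrable_inner_holder(2)[OF _ \<alpha> T B] by (intro exI[of _ B]) (simp add: dual_embedding_def)
qed

end

section \<open>Empirical measures\<close>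

lemma pmf_empirical:
  assumes "0 < n"
  shows "pmf (empirical_pmf Y n \<omega>) y = (\<Sum>i<n. indicator {y} (Y i \<omega>)) / real n"
proof -
  have "pmf (empirical_pmf Y n \<omega>) y = real (card ({..<n} \<inter> (\<lambda>i. Y i \<omega>) -` {y})) / real n"
    unfolding empirical_pmf_def using assms
    by (simp add: pmf_map measure_pmf_of_set lessThan_empty_iff)
  also have "real (card ({..<n} \<inter> (\<lambda>i. Y i \<omega>) -` {y})) = (\<Sum>i<n. indicator {y} (Y i \<omega>))"
    by (subst sum_indicator_eq_card[symmetric]) (auto simp: indicator_def intro!: sum.cong)
  finally show ?thesis .
qed

lemma set_pmf_empirical: "0 < n \<Longrightarrow> set_pmf (empirical_pmf Y n \<omega>) = (\<lambda>i. Y i \<omega>) ` {..<n}"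
  unfolding empirical_pmf_def by (simp add: set_pmf_of_set lessThan_empty_iff)

locale iid_sample = prob_space M for M :: "'w measure" +
  fixes Y :: "nat \<Rightarrow> 'w \<Rightarrow> 'a::euclidean_space" and Q :: "'a pmf" and c :: real
  assumes indep_Y: "indep_vars (\<lambda>_. borel) Y UNIV"
    and distr_Y: "\<And>i. distr M borel (Y i) = distr (measure_pmf Q) borel (\<lambda>y. y)"
    and finite_Q: "finite (set_pmf Q)" and c_pos: "0 < c" and c_le: "\<And>y. y \<in> set_pmf Q \<Longrightarrow> c \<le> pmf Q y"
begin

lemma Y_measurable[measurable]: "Y i \<in> borel_measurable M"
  using indep_Y by (simp add: indep_vars_def)

lemma AE_Y: "AE \<omega> in M. Y i \<omega> \<in> set_pmf Q"
proof -
  have [measurable]: "set_pmf Q \<in> sets borel" using finite_Q by (simp add: finite_imp_closed borel_closed)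
  have "AE y in distr (measure_pmf Q) borel (\<lambda>y. y). y \<in> set_pmf Q"
    by (subst AE_distr_iff) (auto simp: AE_measure_pmf)
  then have "AE y in distr M borel (Y i). y \<in> set_pmf Q" by (subst distr_Y)
  then show ?thesis by (subst (asm) AE_distr_iff) auto
qed

lemma AE_sample: "AE \<omega> in M. \<forall>i<n. Y i \<omega> \<in> set_pmf Q"
proof -
  have "AE \<omega> in M. \<forall>i\<in>{..<n}. Y i \<omega> \<in> set_pmf Q" by (intro AE_finite_allI AE_Y) auto
  then show ?thesis by (rule eventually_mono) auto
qed

lemma expectation_hit: "expectation (\<lambda>\<omega>. indicat_real {y} (Y i \<omega>)) = pmf Q y"
proof -
  have "expectation (\<lambda>\<omega>. indicat_real {y} (Y i \<omega>)) = (\<integral>x. indicat_real {y} x \<partial>distr M borel (Y i))"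
    by (rule integral_distr[symmetric]) auto
  also have "\<dots> = (\<integral>x. indicat_real {y} x \<partial>measure_pmf Q)"
    unfolding distr_Y by (rule integral_distr) auto
  also have "\<dots> = pmf Q y" by (simp add: pmf.rep_eq)
  finally show ?thesis .
qed

abbreviation hits :: "nat \<Rightarrow> 'a \<Rightarrow> 'w \<Rightarrow> real" where
  "hits n y \<omega> \<equiv> (\<Sum>i<n. indicator {y} (Y i \<omega>))"

text \<open>The event on which the empirical measure has exactly the support of \<open>Q\<close> and
  masses at least \<open>c / 2\<close>, so that a single constant of the deterministic estimate
  applies.\<close>

definition typical :: "nat \<Rightarrow> 'w set" where
  "typical n = {\<omega>\<in>space M. (\<forall>i<n. Y i \<omega> \<in> set_pmf Q) \<and>
     (\<forall>y\<in>set_pmf Q. real n * (c / 2) < hits n y \<omega>)}"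

lemma typical_sets: "typical n \<in> sets M"
proof -
  have [measurable]: "set_pmf Q \<in> sets borel" using finite_Q by (simp add: finite_imp_closed borel_closed)
  show ?thesis unfolding typical_def using finite_Q by measurable
qed

text \<open>The expected number of hits is at least \<open>n * c\<close>, so this event is a
  deviation of at least \<open>n * (c / 2)\<close> below the mean; the Hoeffding bound
  \<open>exp (- 2 * (n * c / 2)\<^sup>2 / n)\<close> gives the exponent.\<close>

lemma rare_hits:
  assumes n: "0 < n" and y: "y \<in> set_pmf Q"
  shows "prob {\<omega>\<in>space M. hits n y \<omega> \<le> real n * (c / 2)} \<le> exp (- (real n * (c\<^sup>2 / 2)))"
proof -
  interpret H: Hoeffding_ineq M "{..<n}" "\<lambda>i \<omega>. indicator {y} (Y i \<omega>)" "\<lambda>_. 0" "\<lambda>_. 1"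
    "\<Sum>i<n. expectation (\<lambda>\<omega>. indicator {y} (Y i \<omega>))"
  proof unfold_locales
    show "indep_vars (\<lambda>_. borel) (\<lambda>i \<omega>. indicat_real {y} (Y i \<omega>)) {..<n}"
      by (rule indep_vars_compose2[OF indep_vars_subset[OF indep_Y]]) auto
  qed (auto split: split_indicator)
  have \<mu>: "(\<Sum>i<n. expectation (\<lambda>\<omega>. indicator {y} (Y i \<omega>))) = real n * pmf Q y"
    by (simp add: expectation_hit)
  have "prob {\<omega>\<in>space M. hits n y \<omega> \<le> real n * (c / 2)} \<le>
    prob {\<omega>\<in>space M. hits n y \<omega> \<le> real n * pmf Q y - real n * (c / 2)}"
  proof (rule finite_measure_mono)
    have "real n * c \<le> real n * pmf Q y" using c_le[OF y] by (intro mult_left_mono) auto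
    then show "{\<omega>\<in>space M. hits n y \<omega> \<le> real n * (c / 2)} \<subseteq>
      {\<omega>\<in>space M. hits n y \<omega> \<le> real n * pmf Q y - real n * (c / 2)}" by auto
  qed measurable
  also have "\<dots> \<le> exp (- 2 * (real n * (c / 2))\<^sup>2 / (\<Sum>i<n. (1 - 0)\<^sup>2))"
    using H.Hoeffding_ineq_le[of "real n * (c / 2)"] n c_pos unfolding \<mu> by simp
  also have "- 2 * (real n * (c / 2))\<^sup>2 / (\<Sum>i<n. (1 - 0)\<^sup>2 :: real) = - (real n * (c\<^sup>2 / 2))"
    using n by (simp add: power2_eq_square)
  finally show ?thesis .
qed

lemma typical_prob: "(\<lambda>n. prob (typical n)) \<longlonglongrightarrow> 1"
proof -
  have lower: "1 - card (set_pmf Q) * exp (- (real n * (c\<^sup>2 / 2))) \<le> prob (typical n)" if n: "0 < n" for n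
  proof -
    let ?R = "\<lambda>y. {\<omega>\<in>space M. hits n y \<omega> \<le> real n * (c / 2)}"
    have Rm: "?R y \<in> sets M" for y by measurable
    have "prob (space M - typical n) \<le> prob (\<Union>y\<in>set_pmf Q. ?R y)"
    proof (rule finite_measure_mono_AE)
      show "AE \<omega> in M. \<omega> \<in> space M - typical n \<longrightarrow> \<omega> \<in> (\<Union>y\<in>set_pmf Q. ?R y)"
        using AE_sample[of n] by eventually_elim (auto simp: typical_def not_less)
      show "(\<Union>y\<in>set_pmf Q. ?R y) \<in> sets M" using finite_Q Rm by (intro sets.finite_UN) auto
    qed
    also have "\<dots> \<le> (\<Sum>y\<in>set_pmf Q. prob (?R y))"
      using finite_Q Rm by (intro measure_UNION_le) auto
    also have "\<dots> \<le> (\<Sum>y\<in>set_pmf Q. exp (- (real n * (c\<^sup>2 / 2))))"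
      by (intro sum_mono rare_hits n)
    finally show ?thesis using prob_compl[OF typical_sets[of n]] by simp
  qed
  show ?thesis
  proof (rule tendsto_sandwich[of "\<lambda>n. 1 - card (set_pmf Q) * exp (- (real n * (c\<^sup>2 / 2)))" _ _ "\<lambda>_. 1"])
    show "\<forall>\<^sub>F n in sequentially. 1 - card (set_pmf Q) * exp (- (real n * (c\<^sup>2 / 2))) \<le> prob (typical n)"
      using eventually_gt_at_top[of 0] by eventually_elim (rule lower)
    have "0 < c\<^sup>2 / 2" using c_pos by simp
    then show "(\<lambda>n. 1 - card (set_pmf Q) * exp (- (real n * (c\<^sup>2 / 2)))) \<longlonglongrightarrow> 1"
      by real_asymp
  qed auto
qed

lemma typical_empirical:
  assumes n: "0 < n" and \<omega>: "\<omega> \<in> typical n"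
  shows "set_pmf (empirical_pmf Y n \<omega>) = set_pmf Q"
    and "y \<in> set_pmf Q \<Longrightarrow> c / 2 \<le> pmf (empirical_pmf Y n \<omega>) y"
proof -
  show ge: "c / 2 \<le> pmf (empirical_pmf Y n \<omega>) y" if "y \<in> set_pmf Q" for y
  proof -
    have "real n * (c / 2) < hits n y \<omega>" using \<omega> that by (simp add: typical_def)
    then show ?thesis using n unfolding pmf_empirical[OF n] by (simp add: field_simps)
  qed
  show "set_pmf (empirical_pmf Y n \<omega>) = set_pmf Q"
  proof
    show "set_pmf (empirical_pmf Y n \<omega>) \<subseteq> set_pmf Q"
      using \<omega> n by (auto simp: set_pmf_empirical typical_def)
    show "set_pmf Q \<subseteq> set_pmf (empirical_pmf Y n \<omega>)"
      using ge c_pos by (force simp: set_pmf_iff)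
  qed
qed

text \<open>Almost surely the sample is one of finitely many lists of length \<open>n\<close> over
  the support, and the empirical measure is constant on each of these events. Hence no measurability
  of \<open>F\<close> enters.\<close>

lemma measurable_of_empirical:
  assumes n: "0 < n" and sp: "\<And>\<omega>. \<omega> \<in> space M \<Longrightarrow> F (empirical_pmf Y n \<omega>) \<in> space N"
  shows "(\<lambda>\<omega>. F (empirical_pmf Y n \<omega>)) \<in> completion M \<rightarrow>\<^sub>M N"
proof (rule measurable_completion_finite_valued)
  let ?K = "{ys. set ys \<subseteq> set_pmf Q \<and> length ys = n}"
  let ?E = "\<lambda>ys. {\<omega>\<in>space M. \<forall>i<n. Y i \<omega> = ys ! i}"
  show "finite ?K" using finite_Q by (rule finite_lists_length_eq)
  show "?E ys \<in> sets M" for ys by measurable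
  show "AE \<omega> in M. \<exists>ys\<in>?K. \<omega> \<in> ?E ys"
    using AE_sample[of n] AE_space
  proof eventually_elim
    case (elim \<omega>)
    then show ?case by (intro bexI[of _ "map (\<lambda>i. Y i \<omega>) [0..<n]"]) auto
  qed
  show "F (empirical_pmf Y n \<omega>) = F (map_pmf (\<lambda>i. ys ! i) (pmf_of_set {..<n}))" if "\<omega> \<in> ?E ys" for ys \<omega>
    unfolding empirical_pmf_def using that n
    by (intro arg_cong[where f = F] map_pmf_cong) (auto simp: set_pmf_of_set lessThan_empty_iff)
qed (use sp in auto)

end

text \<open>Raising the bound \<open>e * n powr (- (1 / (2 * (1 + \<alpha>))))\<close> to the power
  \<open>1 + \<alpha>\<close> produces exactly the factor \<open>n powr (- (1 / 2))\<close> that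
  cancels the square root.\<close>

lemma smallo_rate:
  fixes \<epsilon> :: "nat \<Rightarrow> real"
  assumes pos: "\<And>n. 0 < \<epsilon> n" and \<alpha>: "0 < \<alpha>"
    and o: "\<epsilon> \<in> o(\<lambda>n. min (real n powr (- (1 / (2 * (1 + \<alpha>))))) (g n))"
    and g: "\<forall>\<^sub>F n in sequentially. 0 \<le> g n"
  shows "(\<lambda>n. sqrt (real n) * \<epsilon> n powr (1 + \<alpha>)) \<longlonglongrightarrow> 0" and "\<epsilon> \<longlonglongrightarrow> 0"
proof -
  let ?b = "\<lambda>n. real n powr (- (1 / (2 * (1 + \<alpha>))))"
  have ev: "\<forall>\<^sub>F n in sequentially. \<epsilon> n \<le> e * ?b n" if e: "0 < e" for e
    using landau_o.smallD[OF o e] g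
  proof eventually_elim
    case (elim n)
    have "\<epsilon> n \<le> e * min (?b n) (g n)" using elim pos[of n] by simp
    also have "\<dots> \<le> e * ?b n" using e by (intro mult_left_mono) auto
    finally show ?case .
  qed
  have b0: "?b \<longlonglongrightarrow> 0"
  proof -
    have "0 < 1 / (2 * (1 + \<alpha>))" using \<alpha> by simp
    then show ?thesis by real_asymp
  qed
  show "\<epsilon> \<longlonglongrightarrow> 0"
    by (rule tendsto_sandwich[OF _ _ tendsto_const b0])
      (use ev[of 1] pos in \<open>auto simp: less_imp_le\<close>)
  show "(\<lambda>n. sqrt (real n) * \<epsilon> n powr (1 + \<alpha>)) \<longlonglongrightarrow> 0"
  proof (rule LIMSEQ_I)
    fix r :: real assume r: "0 < r"
    \<comment> \<open>The solution of \<open>e powr (1 + \<alpha>) = r / 2\<close>, with one half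
      left for strictness.\<close>
    define e where "e = (r / 2) powr (1 / (1 + \<alpha>))"
    have e: "0 < e" using r by (simp add: e_def)
    have er: "e powr (1 + \<alpha>) = r / 2" using r \<alpha> by (simp add: e_def powr_powr)
    have "\<forall>\<^sub>F n in sequentially. norm (sqrt (real n) * \<epsilon> n powr (1 + \<alpha>) - 0) < r"
      using ev[OF e] eventually_gt_at_top[of 0]
    proof eventually_elim
      case (elim n)
      have "\<epsilon> n powr (1 + \<alpha>) \<le> (e * ?b n) powr (1 + \<alpha>)"
        using elim pos[of n] \<alpha> by (intro powr_mono2) auto
      also have "\<dots> = r / 2 * real n powr (- (1 / 2))"
      proof -
        have "- (1 / (2 * (1 + \<alpha>))) * (1 + \<alpha>) = - (1 / 2)" using \<alpha> by (simp add: field_simps)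
        then show ?thesis using e by (simp only: powr_mult er powr_powr)
      qed
      finally have "sqrt (real n) * \<epsilon> n powr (1 + \<alpha>) \<le> sqrt (real n) * (r / 2 * real n powr (- (1 / 2)))"
        by (intro mult_left_mono) auto
      also have "\<dots> = r / 2"
        using elim by (simp add: powr_minus powr_half_sqrt)
      finally show ?case using r by simp
    qed
    then show "\<exists>no. \<forall>n\<ge>no. norm (sqrt (real n) * \<epsilon> n powr (1 + \<alpha>) - 0) < r"
      by (simp add: eventually_sequentially)
  qed
qed

section \<open>Maps for finite targets as functionals on the Hoelder space\<close>

context convex_density
begin

lemma finite_target_maps:
  assumes "finite (set_pmf R)"
  shows "brenier_map X P R \<in> borel_measurable borel" "entropic_map P R \<epsilon> \<in> borel_measurable borel"
    and "\<exists>B. \<forall>x\<in>X. norm (brenier_map X P R x) \<le> B" "\<exists>B. \<forall>x\<in>X. norm (entropic_map P R \<epsilon> x) \<le> B"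
proof -
  interpret T: semidiscrete_target X P \<rho> "set_pmf R" R
    by unfold_locales (use assms set_pmf_not_empty in auto)
  show "brenier_map X P R \<in> borel_measurable borel" "entropic_map P R \<epsilon> \<in> borel_measurable borel"
    by (rule T.brenier_map_measurable, rule T.entropic_map_measurable)
  have "norm (brenier_map X P R x) \<le> (\<Sum>y\<in>set_pmf R. norm y)" if "x \<in> X" for x
    using T.brenier_map_cell(1)[OF that] assms by (intro member_le_sum) auto
  then show "\<exists>B. \<forall>x\<in>X. norm (brenier_map X P R x) \<le> B" by blast
  have "norm (entropic_map P R \<epsilon> x) \<le> (\<Sum>y\<in>set_pmf R. norm y)" for x
    unfolding T.entropic_map_eq
    by (rule sum_norm_le) (simp add: T.soft_nonneg T.soft_le_1 mult_left_le_one_le)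
  then show "\<exists>B. \<forall>x\<in>X. norm (entropic_map P R \<epsilon> x) \<le> B" by blast
qed

lemma scaled_difference_in_dual:
  assumes \<alpha>: "0 < \<alpha>" and T: "T \<in> borel_measurable borel" "T' \<in> borel_measurable borel"
    and B: "\<exists>B. \<forall>x\<in>X. norm (T x) \<le> B" "\<exists>B. \<forall>x\<in>X. norm (T' x) \<le> B"
  shows "dual_embedding X \<alpha> P (\<lambda>x. s *\<^sub>R (T x - T' x)) \<in> holder_dual X \<alpha>"
proof -
  obtain B1 B2 where B: "\<And>x. x \<in> X \<Longrightarrow> norm (T x) \<le> B1" "\<And>x. x \<in> X \<Longrightarrow> norm (T' x) \<le> B2" using B by blast
  show ?thesis
  proof (rule dual_embedding_in_dual[OF \<alpha>, of _ "\<bar>s\<bar> * (B1 + B2)"])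
    fix x assume x: "x \<in> X"
    have "norm (T x - T' x) \<le> B1 + B2" using norm_triangle_ineq4[of "T x" "T' x"] B[OF x] by simp
    then show "norm (s *\<^sub>R (T x - T' x)) \<le> \<bar>s\<bar> * (B1 + B2)" by (simp add: mult_left_mono)
  qed (use T in simp)
qed

end

section \<open>Conclusion\<close>

theorem corollary2:
  fixes X :: "'a::euclidean_space set" and P :: "'a measure" and \<rho> :: "'a \<Rightarrow> real"
    and Q :: "'a pmf" and c\<^sub>0 \<alpha> :: real and \<epsilon> :: "nat \<Rightarrow> real"
    and M :: "'w measure" and Y :: "nat \<Rightarrow> 'w \<Rightarrow> 'a"
    and N :: "'v measure" and G :: "'v \<Rightarrow> ('a \<Rightarrow> 'a) \<Rightarrow> real"
  assumes \<alpha>: "0 < \<alpha>" "\<alpha> \<le> 1"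
    and X: "compact X" "convex X" "interior X \<noteq> {}"
    and P: "prob_space P" "P = density lborel (\<lambda>x. ennreal (\<rho> x))" "topological_support P = X"
    and \<rho>: "\<rho> \<in> borel_measurable borel" "\<And>x. 0 \<le> \<rho> x" "\<And>x. x \<in> X \<Longrightarrow> 0 < \<rho> x"
      "\<exists>L. L-lipschitz_on X \<rho>"
    and Q: "finite (set_pmf Q)" "0 < c\<^sub>0" "c\<^sub>0 < 1" "Min (pmf Q ` set_pmf Q) \<ge> c\<^sub>0"
    and boundary: "polytope X \<or>
      (\<forall>a b. a \<noteq> 0 \<longrightarrow> hausdorff_measure (DIM('a) - 1) (frontier X \<inter> {x. a \<bullet> x = b}) = 0)"
    and Y: "prob_space M" "prob_space.indep_vars M (\<lambda>_. borel) Y UNIV"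
      "\<And>i. distr M borel (Y i) = distr (measure_pmf Q) borel (\<lambda>y. y)"
    and \<epsilon>: "\<And>n. 0 < \<epsilon> n"
      "\<epsilon> \<in> o(\<lambda>n. min (real n powr (- (1 / (2 * (1 + \<alpha>)))))
                     (real n powr (- (1 / 4)) / ln (real n) powr (3 / 2)))"
    and G: "prob_space N" "centered_gaussian X \<alpha> N G"
      "converges_in_distribution (dual_topology X \<alpha>) M
         (\<lambda>n \<omega>. dual_embedding X \<alpha> P
            (\<lambda>x. sqrt (real n) *\<^sub>R (brenier_map X P (empirical_pmf Y n \<omega>) x - brenier_map X P Q x)))
         N G"
  shows "converges_in_distribution (dual_topology X \<alpha>) M
           (\<lambda>n \<omega>. dual_embedding X \<alpha> P
              (\<lambda>x. sqrt (real n) *\<^sub>R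
                 (entropic_map P (empirical_pmf Y n \<omega>) (\<epsilon> n) x - brenier_map X P Q x)))
           N G"
proof -
  interpret prob_space P by (rule P(1))
  have "emeasure P (- X) = 0"
    using emeasure_compl_topological_support[of P] P(2,3) by simp
  then have "AE x in P. x \<in> X"
    using X(1) P(2) by (intro AE_I[of _ _ "- X"]) (auto intro: borel_comp borel_compact)
  with X P \<rho> interpret D: convex_density X P \<rho> by unfold_locales auto
  interpret S: semidiscrete X P \<rho> "set_pmf Q"
    by unfold_locales (use Q(1) set_pmf_not_empty in auto)
  have c0: "c\<^sub>0 \<le> pmf Q y" if "y \<in> set_pmf Q" for y
    using Q(1,4) that by (simp add: Min_ge_iff set_pmf_not_empty)
  interpret I: iid_sample M Y Q c\<^sub>0
    unfolding iid_sample_def iid_sample_axioms_def using Y Q(1,2) c0 by blast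
  interpret H: Metric_space "holder_dual X \<alpha>" "dual_dist X \<alpha>" by (rule Metric_space_holder_dual)
  \<comment> \<open>The lower mass bound is \<open>c\<^sub>0 / 2\<close>, because that is what a
    typical sample guarantees.\<close>
  obtain C \<epsilon>\<^sub>0 where C: "0 \<le> C" "0 < \<epsilon>\<^sub>0" and estimate:
    "\<And>R \<epsilon> \<phi>. set_pmf R = set_pmf Q \<Longrightarrow> (\<And>y. y \<in> set_pmf Q \<Longrightarrow> c\<^sub>0 / 2 \<le> pmf R y) \<Longrightarrow>
      0 < \<epsilon> \<Longrightarrow> \<epsilon> \<le> \<epsilon>\<^sub>0 \<Longrightarrow> \<phi> \<in> borel_measurable borel \<Longrightarrow> (\<And>x. x \<in> X \<Longrightarrow> norm (\<phi> x) \<le> 1) \<Longrightarrow>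
      (\<And>x y. x \<in> X \<Longrightarrow> y \<in> X \<Longrightarrow> norm (\<phi> x - \<phi> y) \<le> norm (x - y) powr \<alpha>) \<Longrightarrow>
      \<bar>\<integral>x. \<phi> x \<bullet> (entropic_map P R \<epsilon> x - brenier_map X P R x) \<partial>P\<bar> \<le> C * \<epsilon> powr (1 + \<alpha>)"
    by (rule S.entropic_brenier_estimate[OF half_gt_zero[OF Q(2)] \<alpha>]) (rule that, assumption, assumption, blast)
  have rate: "(\<lambda>n. sqrt (real n) * \<epsilon> n powr (1 + \<alpha>)) \<longlonglongrightarrow> 0" "\<epsilon> \<longlonglongrightarrow> 0"
  proof -
    have "\<forall>\<^sub>F n in sequentially. 0 \<le> real n powr (- (1 / 4)) / ln (real n) powr (3 / 2)" by simp
    from smallo_rate[OF \<epsilon>(1) \<alpha>(1) \<epsilon>(2) this]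
    show "(\<lambda>n. sqrt (real n) * \<epsilon> n powr (1 + \<alpha>)) \<longlonglongrightarrow> 0" "\<epsilon> \<longlonglongrightarrow> 0" .
  qed
  have fin: "finite (set_pmf (empirical_pmf Y n \<omega>))" if "0 < n" for n \<omega>
    using that by (simp add: set_pmf_empirical)
  note in_dual = D.scaled_difference_in_dual[OF \<alpha>(1)]
  note maps = D.finite_target_maps
  let ?Z = "\<lambda>n \<omega>. dual_embedding X \<alpha> P
     (\<lambda>x. sqrt (real n) *\<^sub>R (brenier_map X P (empirical_pmf Y n \<omega>) x - brenier_map X P Q x))"
  let ?Z' = "\<lambda>n \<omega>. dual_embedding X \<alpha> P
     (\<lambda>x. sqrt (real n) *\<^sub>R (entropic_map P (empirical_pmf Y n \<omega>) (\<epsilon> n) x - brenier_map X P Q x))"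
  have close: "dual_dist X \<alpha> (?Z n \<omega>) (?Z' n \<omega>) \<le> C * (sqrt (real n) * \<epsilon> n powr (1 + \<alpha>))"
    if n: "0 < n" and small: "\<epsilon> n \<le> \<epsilon>\<^sub>0" and \<omega>: "\<omega> \<in> I.typical n" for n \<omega>
  proof (rule dual_dist_le)
    let ?R = "empirical_pmf Y n \<omega>"
    let ?B = "brenier_map X P ?R" and ?E = "entropic_map P ?R (\<epsilon> n)" and ?T = "brenier_map X P Q"
    show "0 \<le> C * (sqrt (real n) * \<epsilon> n powr (1 + \<alpha>))" using C by simp
    fix \<phi> assume \<phi>: "\<phi> \<in> holder_space X \<alpha>" and \<phi>1: "holder_norm X \<alpha> \<phi> \<le> 1"
    have K: "enn2real (holder_norm X \<alpha> \<phi>) \<le> 1" using \<phi>1 by (intro enn2real_leI) auto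
    have int: "integrable P (\<lambda>x. \<phi> x \<bullet> T x)"
      if "T \<in> borel_measurable borel" "\<exists>b. \<forall>x\<in>X. norm (T x) \<le> b" for T
      using D.integrable_inner_holder(1)[OF \<phi> \<alpha>(1) that(1)] that(2) by blast
    note ints = int[OF maps(1,3)[OF fin[OF n, of \<omega>]]] int[OF maps(2,4)[OF fin[OF n, of \<omega>]], of "\<epsilon> n"]
      int[OF maps(1,3)[OF Q(1)]]
    \<comment> \<open>The limit map \<open>?T\<close> cancels, leaving the two maps for one and the
      same empirical target.\<close>
    have "?Z n \<omega> \<phi> - ?Z' n \<omega> \<phi> = - (sqrt (real n) * (\<integral>x. \<phi> x \<bullet> (?E x - ?B x) \<partial>P))"
      using \<phi> ints by (simp add: dual_embedding_def inner_diff_right algebra_simps)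
    then have "\<bar>?Z n \<omega> \<phi> - ?Z' n \<omega> \<phi>\<bar> = sqrt (real n) * \<bar>\<integral>x. \<phi> x \<bullet> (?E x - ?B x) \<partial>P\<bar>"
      by (simp add: abs_mult)
    also have "\<dots> \<le> sqrt (real n) * (C * \<epsilon> n powr (1 + \<alpha>))"
    proof (intro mult_left_mono estimate)
      show "set_pmf ?R = set_pmf Q" by (rule I.typical_empirical(1)[OF n \<omega>])
      show "c\<^sub>0 / 2 \<le> pmf ?R y" if "y \<in> set_pmf Q" for y by (rule I.typical_empirical(2)[OF n \<omega> that])
      show "\<phi> \<in> borel_measurable borel" by (rule holder_space_measurable[OF \<phi> D.X_sets \<alpha>(1)])
      show "norm (\<phi> x) \<le> 1" if "x \<in> X" for x using holder_space_bounds(1)[OF \<phi> that] K by linarith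
      show "norm (\<phi> x - \<phi> y) \<le> norm (x - y) powr \<alpha>" if "x \<in> X" "y \<in> X" for x y
        using holder_space_bounds(2)[OF \<phi> that] mult_right_mono[OF K, of "norm (x - y) powr \<alpha>"] by simp
    qed (use \<epsilon>(1) small in auto)
    finally show "\<bar>?Z n \<omega> \<phi> - ?Z' n \<omega> \<phi>\<bar> \<le> C * (sqrt (real n) * \<epsilon> n powr (1 + \<alpha>))"
      by (simp add: mult_ac)
  qed
  have meas: "?Z' n \<in> completion M \<rightarrow>\<^sub>M borel_of H.mtopology" for n
  proof (cases "n = 0")
    \<comment> \<open>For the empty sample the factor \<open>sqrt 0\<close> makes the functional
      zero, whatever value the empirical measure takes by default.\<close>
    case True
    have "dual_embedding X \<alpha> P (\<lambda>x. 0) \<in> holder_dual X \<alpha>"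
      by (rule D.dual_embedding_in_dual[OF \<alpha>(1), of _ 0]) auto
    then show ?thesis using True by (simp add: space_borel_of)
  next
    case False
    then have n: "0 < n" by simp
    show ?thesis
      by (rule I.measurable_of_empirical[OF n, where F = "\<lambda>R. dual_embedding X \<alpha> P
          (\<lambda>x. sqrt (real n) *\<^sub>R (entropic_map P R (\<epsilon> n) x - brenier_map X P Q x))"])
        (simp add: space_borel_of in_dual maps fin[OF n] Q(1))
  qed
  show ?thesis
    unfolding dual_topology_def
  proof (rule H.converges_in_distribution_perturb[OF Y(1) G(1) G(3)[unfolded dual_topology_def] meas
        I.typical_sets I.typical_prob])
    show "(\<lambda>n. C * (sqrt (real n) * \<epsilon> n powr (1 + \<alpha>))) \<longlonglongrightarrow> 0"
      using tendsto_mult_left[OF rate(1), of C] by simp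
    show "0 \<le> C * (sqrt (real n) * \<epsilon> n powr (1 + \<alpha>))" for n using C by simp
    have "\<forall>\<^sub>F n in sequentially. \<epsilon> n < \<epsilon>\<^sub>0" by (rule order_tendstoD(2)[OF rate(2) C(2)])
    then show "\<forall>\<^sub>F n in sequentially. \<forall>\<omega>\<in>I.typical n.
        dual_dist X \<alpha> (?Z n \<omega>) (?Z' n \<omega>) \<le> C * (sqrt (real n) * \<epsilon> n powr (1 + \<alpha>))"
      using eventually_gt_at_top[of 0] by eventually_elim (use close in auto)
  qed
qed

end
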